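(* Let $\mathcal{L}$ be the set of real-valued limit-periodic sequences on $\mathbb{Z}$. For $0<\tau<1$, let $\mathcal{H}^{\mathrm{S}}_\tau\subseteq\mathcal{L}$ be the set of $V\in\mathcal{L}$ such that $\sigma(H_V)$ is a $\tau$-homogeneous Cantor set and $H_V$ has purely absolutely continuous spectrum. Then $\mathcal{H}^{\mathrm{S}}_\tau$ is $\ell^\infty$-dense in $\mathcal{L}$ for every $0<\tau<1$.
   Context: For a bounded real sequence $V$ on $\mathbb{Z}$, the discrete Schr\"odinger operator $H_V:\ell^2(\mathbb{Z})\to\ell^2(\mathbb{Z})$ is the bounded self-adjoint operator $(H_V\psi)(n)=\psi(n-1)+\psi(n+1)+V(n)\psi(n)$, $n\in\mathbb{Z}$. A sequence on $\mathbb{Z}$ is limit-periodic if it is a limit in $\ell^\infty(\mathbb{Z})$ (uniform limit) of periodic sequences (periodic sequences themselves are included). For $\tau>0$, a compact set $K\subseteq\mathbb{R}$ is $\tau$-homogeneous if there exists $\delta_0>0$ such that $|(x-\delta,x+\delta)\cap K|\ge\tau\delta$ for every $x\in K$ and every $0<\delta\le\delta_0$, where $|\cdot|$ is Lebesgue measure. A Cantor set is a totally disconnected (nonempty) compact set with no isolated points. *)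

theory Defs
  imports "HOL-Analysis.Analysis" "HOL-Computational_Algebra.Polynomial"
begin

text \<open>
  Bounded real sequences on \<open>\<int>\<close> are the elements of \<open>int \<Rightarrow>\<^sub>C real\<close>: the topology of \<open>int\<close>
  is discrete, so every bounded function is included, and the distance is the supremum
  distance. This type is therefore the metric space \<open>\<ell>\<^sup>\<infinity>(\<int>,\<real>)\<close>, and \<open>closure\<close> is closure
  in it.
\<close>

definition periodic_seq :: "(int \<Rightarrow> real) \<Rightarrow> bool" where
  "periodic_seq V \<longleftrightarrow> (\<exists>p>0. \<forall>n. V (n + p) = V n)"

definition limit_periodic :: "(int \<Rightarrow>\<^sub>C real) set" where
  "limit_periodic = closure {V. periodic_seq (apply_bcontfun V)}"

subsection \<open>The Hilbert space \<open>\<ell>\<^sup>2(\<int>)\<close> and operators on it\<close>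

definition l2 :: "(int \<Rightarrow> complex) set" where
  "l2 = {\<psi>. (\<lambda>n. (cmod (\<psi> n))\<^sup>2) summable_on UNIV}"

definition l2_inner :: "(int \<Rightarrow> complex) \<Rightarrow> (int \<Rightarrow> complex) \<Rightarrow> complex" where
  "l2_inner \<phi> \<psi> = (\<Sum>\<^sub>\<infinity>n. cnj (\<phi> n) * \<psi> n)"

definition l2_norm :: "(int \<Rightarrow> complex) \<Rightarrow> real" where
  "l2_norm \<psi> = sqrt (\<Sum>\<^sub>\<infinity>n. (cmod (\<psi> n))\<^sup>2)"

definition schroedinger :: "(int \<Rightarrow>\<^sub>C real) \<Rightarrow> (int \<Rightarrow> complex) \<Rightarrow> (int \<Rightarrow> complex)" where
  "schroedinger V \<psi> = (\<lambda>n. \<psi> (n - 1) + \<psi> (n + 1) + complex_of_real (apply_bcontfun V n) * \<psi> n)"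

text \<open>
  The resolvent set of an everywhere defined linear operator \<open>T\<close> on \<open>\<ell>\<^sup>2(\<int>)\<close>: \<open>T - z\<close> is a
  bijection of \<open>\<ell>\<^sup>2(\<int>)\<close> with bounded inverse.
\<close>

definition resolvent_set :: "((int \<Rightarrow> complex) \<Rightarrow> (int \<Rightarrow> complex)) \<Rightarrow> complex set" where
  "resolvent_set T = {z. bij_betw (\<lambda>\<psi> n. T \<psi> n - z * \<psi> n) l2 l2 \<and>
     (\<exists>C. \<forall>\<psi>\<in>l2. l2_norm \<psi> \<le> C * l2_norm (\<lambda>n. T \<psi> n - z * \<psi> n))}"

definition spectrum :: "((int \<Rightarrow> complex) \<Rightarrow> (int \<Rightarrow> complex)) \<Rightarrow> complex set" where
  "spectrum T = - resolvent_set T"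

text \<open>
  \<open>schroedinger V\<close> is self-adjoint, so all of its spectrum is real; this is the same set as a
  subset of \<open>real\<close>.
\<close>

definition schroedinger_spectrum :: "(int \<Rightarrow>\<^sub>C real) \<Rightarrow> real set" where
  "schroedinger_spectrum V = {x. complex_of_real x \<in> spectrum (schroedinger V)}"

subsection \<open>Spectral measures and purely absolutely continuous spectrum\<close>

definition poly_op ::
  "real poly \<Rightarrow> ((int \<Rightarrow> complex) \<Rightarrow> (int \<Rightarrow> complex)) \<Rightarrow> (int \<Rightarrow> complex) \<Rightarrow> (int \<Rightarrow> complex)" where
  "poly_op p T \<psi> = (\<lambda>n. \<Sum>k\<le>degree p. complex_of_real (coeff p k) * (T ^^ k) \<psi> n)"

text \<open>
  The spectral measure of \<open>\<psi>\<close> is the finite Borel measure \<open>M\<close> carried by the spectrum with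
  \<open>\<langle>\<psi>, f(H) \<psi>\<rangle> = \<integral> f dM\<close> for all continuous \<open>f\<close>. As \<open>H\<close> is bounded, the spectrum is compact,
  and \<open>f(H)\<close> is the norm limit of \<open>p(H)\<close> for polynomials \<open>p\<close> converging to \<open>f\<close> uniformly on
  the spectrum; so it is enough to ask for polynomials, and \<open>M\<close> is unique.
\<close>

definition is_spectral_measure :: "(int \<Rightarrow>\<^sub>C real) \<Rightarrow> (int \<Rightarrow> complex) \<Rightarrow> real measure \<Rightarrow> bool" where
  "is_spectral_measure V \<psi> M \<longleftrightarrow>
     finite_measure M \<and> sets M = sets borel \<and>
     (AE x in M. x \<in> schroedinger_spectrum V) \<and>
     (\<forall>p. l2_inner \<psi> (poly_op p (schroedinger V) \<psi>) = complex_of_real (\<integral>x. poly p x \<partial>M))"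

text \<open>
  All spectral measures are absolutely continuous with respect to Lebesgue measure. By
  existence and uniqueness of the spectral measure, the existential quantifier over \<open>M\<close> may
  be read as ``the spectral measure of \<open>\<psi>\<close>''.
\<close>

definition purely_ac_spectrum :: "(int \<Rightarrow>\<^sub>C real) \<Rightarrow> bool" where
  "purely_ac_spectrum V \<longleftrightarrow>
     (\<forall>\<psi>\<in>l2. \<exists>M. is_spectral_measure V \<psi> M \<and> absolutely_continuous lborel M)"

subsection \<open>Homogeneous sets and Cantor sets\<close>

definition homogeneous_set :: "real \<Rightarrow> real set \<Rightarrow> bool" where
  "homogeneous_set \<tau> K \<longleftrightarrow> compact K \<and>
     (\<exists>\<delta>\<^sub>0>0. \<forall>x\<in>K. \<forall>\<delta>. 0 < \<delta> \<and> \<delta> \<le> \<delta>\<^sub>0 \<longrightarrow> measure lborel ({x - \<delta><..<x + \<delta>} \<inter> K) \<ge> \<tau> * \<delta>)"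

definition cantor_set :: "real set \<Rightarrow> bool" where
  "cantor_set K \<longleftrightarrow> K \<noteq> {} \<and> compact K \<and> (\<forall>x\<in>K. \<not> x isolated_in K) \<and>
     (\<forall>C\<subseteq>K. connected C \<longrightarrow> (\<exists>a. C \<subseteq> {a}))"

definition homogeneous_ac_potentials :: "real \<Rightarrow> (int \<Rightarrow>\<^sub>C real) set" where
  "homogeneous_ac_potentials \<tau> = {V \<in> limit_periodic.
     homogeneous_set \<tau> (schroedinger_spectrum V) \<and> cantor_set (schroedinger_spectrum V) \<and>
     purely_ac_spectrum V}"

end

theory Submission
  imports Defs "HOL-Computational_Algebra.Fundamental_Theorem_Algebra"
begin

text \<open>
  Start from a periodic potential with discriminant \<open>D\<close>. The spectral measures have the explicit
  densities \<open>\<plusminus>A\<^sub>m\<^sub>n / (\<pi> \<surd>(4 - D\<^sup>2))\<close> on \<open>{|D| < 2}\<close>, where \<open>A\<close> is the symmetric form of the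
  monodromy; they have total mass \<open>\<delta>\<^sub>m\<^sub>n\<close> by Lagrange interpolation at the roots of \<open>D = c\<close>.
  A closed gap at a rational rotation number is opened by adding \<open>t\<close> and \<open>-t\<close> on two adjacent
  sites of a multiple of the period. As \<open>t\<close> tends to 0, the densities converge almost everywhere,
  hence in \<open>L\<^sup>1\<close> by Scheffe's lemma, the loss of band measure tends to 0, and the band lengths stay
  bounded below because \<open>D\<close> has a derivative bound uniform in \<open>t\<close>. Iterating with rapidly
  decreasing perturbations, one gap in each rational interval, the limit has \<open>L\<^sup>1\<close> spectral densities
  and a Cantor spectrum. Next to each of its points, at every small scale, one side lies in a band of
  some earlier stage, of which the later gaps remove only a small fraction; this is homogeneity.
\<close>

section \<open>Solutions of the three-term recursion\<close>

text \<open>Homogeneity dictates the order of the choices. Opening a gap passes to a longer period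
  with shorter bands, and the loss must be small against the new band length, not the old one. So a
  length valid for all perturbations t in [0,1] is fixed before t. Closed gaps occur inside every
  band because over several periods the form is multiplied by a Chebyshev polynomial of D, which
  vanishes at rational rotation numbers. Altering one site alone would give plus or minus a single
  shear, of trace plus or minus 2, and leave the energy on a band edge; the pair t, -t puts the
  energy itself inside the gap. Weak limits of absolutely continuous measures can be singular, which
  is why the densities are controlled in L^1. At a scale delta with m (k+1) < delta <= m k, moving
  from a spectral point to a band of stage k costs 4 kappa m (k+1), and the later gaps remove at
  most 2 kappa m (k+1); hence kappa = (1 - tau) / 6. Spectra are compared through lower bounds |(H -
  E) x| >= c |x|, which are stable under perturbation and can be read off from the
  densities.\<close>

lemma periodic_multiple:
  fixes f :: "int \<Rightarrow> 'a"
  assumes "\<And>n. f (n + int p) = f n" shows "f (n + int j * int p) = f n"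
proof (induction j)
  case (Suc j)
  have "n + int (Suc j) * int p = n + int j * int p + int p" by (simp add: algebra_simps)
  then show ?case using assms[of "n + int j * int p"] Suc by (simp only:)
qed simp

lemma periodic_representative:
  fixes f :: "int \<Rightarrow> 'a"
  assumes per: "\<And>n. f (n + int p) = f n" and p: "p > 0" shows "\<exists>i<p. f n = f (int i + k)"
proof -
  define i where "i = nat ((n - k) mod int p)"
  have i: "i < p" "int i = (n - k) mod int p" using p by (auto simp: i_def nat_less_iff)
  have n: "n = int i + k + ((n - k) div int p) * int p"
    unfolding i(2) by (simp add: minus_div_mult_eq_mod[symmetric])
  have "f n = f (int i + k)"
  proof (cases "(n - k) div int p \<ge> 0")
    case True
    then have "n = int i + k + int (nat ((n - k) div int p)) * int p" using n by simp
    then show ?thesis using periodic_multiple[of f p, OF per] by metis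
  next
    case False
    then have "int i + k = n + int (nat (- ((n - k) div int p))) * int p" using n by (simp add: algebra_simps)
    then show ?thesis using periodic_multiple[of f p, OF per] by metis
  qed
  then show ?thesis using i(1) by blast
qed

text \<open>Determinant of the tridiagonal matrix with diagonal x (n+1), ..., x (n+j-1) and
  off-diagonal entries 1. The index is shifted so that this is also the value at n + j of the
  solution with values 0, 1 at n, n + 1.\<close>

fun continuant :: "(int \<Rightarrow> 'a::comm_ring_1) \<Rightarrow> int \<Rightarrow> nat \<Rightarrow> 'a" where
  "continuant x n 0 = 0"
| "continuant x n (Suc 0) = 1"
| "continuant x n (Suc (Suc j)) = x (n + int j + 1) * continuant x n (Suc j) - continuant x n j"

text \<open>Cofactor expansion at the other end of the matrix, needed when the starting site moves
  instead of the final one.\<close>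

lemma continuant_front:
  "continuant x n (Suc (Suc j)) = x (n + 1) * continuant x (n + 1) (Suc j) - continuant x (n + 2) j"
proof (induction j rule: less_induct)
  case (less j)
  show ?case
  proof (cases j)
    case (Suc i)
    show ?thesis
    proof (cases i)
      case (Suc k)
      have "continuant x n (Suc (Suc j)) = x (n + int j + 1) * continuant x n (Suc (Suc i)) - continuant x n (Suc (Suc k))"
        using Suc \<open>j = Suc i\<close> by simp
      also have "\<dots> = x (n + int j + 1) * (x (n + 1) * continuant x (n + 1) (Suc i) - continuant x (n + 2) i)
         - (x (n + 1) * continuant x (n + 1) (Suc k) - continuant x (n + 2) k)"
        using less[of i] less[of k] Suc \<open>j = Suc i\<close> by simp
      also have "\<dots> = x (n + 1) * (x (n + int j + 1) * continuant x (n + 1) (Suc i) - continuant x (n + 1) (Suc k))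
         - (x (n + int j + 1) * continuant x (n + 2) i - continuant x (n + 2) k)"
        by (simp add: algebra_simps)
      also have "\<dots> = x (n + 1) * continuant x (n + 1) (Suc j) - continuant x (n + 2) j"
        using Suc \<open>j = Suc i\<close> by (simp add: algebra_simps)
      finally show ?thesis .
    qed (use Suc in \<open>simp add: algebra_simps\<close>)
  qed simp
qed

lemma continuant_cong:
  assumes "\<And>m. n < m \<Longrightarrow> m < n + int j \<Longrightarrow> x m = y m"
  shows "continuant x n j = continuant y n j"
  using assms by (induction x n j rule: continuant.induct) auto

lemma continuant_shift:
  "continuant x (n + p) j = continuant (\<lambda>m. x (m + p)) n j"
  by (induction "\<lambda>m. x (m + p)" n j rule: continuant.induct) (auto simp: algebra_simps)

text \<open>For \<open>x m = E - V m\<close> this is the eigenvalue equation at energy \<open>E\<close>. Its solution with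
  \<open>u(n) = 0\<close>, \<open>u(n+1) = 1\<close> is \<open>sol x n\<close> below.\<close>

definition jacobi_sol :: "(int \<Rightarrow> 'a::comm_ring_1) \<Rightarrow> (int \<Rightarrow> 'a) \<Rightarrow> bool" where
  "jacobi_sol x u \<longleftrightarrow> (\<forall>m. u (m + 1) + u (m - 1) = x m * u m)"

definition sol :: "(int \<Rightarrow> 'a::comm_ring_1) \<Rightarrow> int \<Rightarrow> int \<Rightarrow> 'a" where
  "sol x n m = (if n \<le> m then continuant x n (nat (m - n)) else - continuant x m (nat (n - m)))"

lemma sol_antisym: "sol x n m = - sol x m n"
  by (auto simp: sol_def)

lemma sol_self [simp]: "sol x n n = 0"
  by (simp add: sol_def)

lemma sol_next [simp]: "sol x n (n + 1) = 1" "sol x n (1 + n) = 1"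
  by (simp_all add: sol_def)

lemma sol_prev [simp]: "sol x (n + 1) n = -1"
  by (simp add: sol_def)

lemma sol_continuant: "sol x n (n + int j) = continuant x n j"
  by (simp add: sol_def)

text \<open>Right of n this is the recursion for continuants. Left of n, where \<open>sol\<close> is
  extended by antisymmetry, the moving site is the first one and the front expansion takes
  over.\<close>

lemma jacobi_sol_sol: "jacobi_sol x (sol x n)"
  unfolding jacobi_sol_def
proof
  fix m
  consider "m = n" | j where "m = n + int (Suc j)" | j where "m = n - int (Suc j)"
  proof (cases m n rule: linorder_cases)
    case less
    then obtain j where "n = m + int (Suc j)" using zless_iff_Suc_zadd by blast
    then show ?thesis using that(3)[of j] by simp
  next
    case greater
    then show ?thesis using that(2) zless_iff_Suc_zadd by blast
  qed (use that in blast)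
  then show "sol x n (m + 1) + sol x n (m - 1) = x m * sol x n m"
  proof cases
    case 1 then show ?thesis using sol_prev[of x "n - 1"] by simp
  next
    case (2 j)
    then show ?thesis
      using sol_continuant[of x n "Suc (Suc j)"] sol_continuant[of x n "Suc j"] sol_continuant[of x n j]
      by (simp add: algebra_simps)
  next
    case (3 j)
    have "n = m + 1 + int j" "n = m - 1 + int (Suc (Suc j))" "n = m + int (Suc j)" using 3 by simp_all
    then have "sol x (m + 1) n = continuant x (m + 1) j" "sol x (m - 1) n = continuant x (m - 1) (Suc (Suc j))"
      "sol x m n = continuant x m (Suc j)"
      by (metis sol_continuant)+
    then have "sol x n (m + 1) = - continuant x (m + 1) j" "sol x n (m - 1) = - continuant x (m - 1) (Suc (Suc j))"
      "sol x n m = - continuant x m (Suc j)"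
      using sol_antisym[of x n] by (simp_all del: continuant.simps)
    moreover have "continuant x (m - 1) (Suc (Suc j)) = x m * continuant x m (Suc j) - continuant x (m + 1) j"
      using continuant_front[of x "m - 1" j] by (simp del: continuant.simps add: add.commute)
    ultimately show ?thesis by (simp only:) simp
  qed
qed

text \<open>The working principle for the identities below: both sides solve the recursion in one
  index, so two adjacent sites suffice.\<close>

lemma jacobi_sol_unique:
  assumes "jacobi_sol x u" "jacobi_sol x v" "u n = v n" "u (n + 1) = v (n + 1)"
  shows "u m = v m"
proof -
  have "u m = v m \<and> u (m + 1) = v (m + 1)"
  proof (induction m rule: int_induct[where k=n])
    case base then show ?case using assms by simp
  next
    case (step1 i)
    then show ?case using assms(1,2) unfolding jacobi_sol_def
      by (metis add_diff_cancel_right' add_right_cancel)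
  next
    case (step2 i)
    then show ?case using assms(1,2) unfolding jacobi_sol_def
      by (metis add_left_cancel diff_add_cancel)
  qed
  then show ?thesis ..
qed

lemma jacobi_sol_scale: "jacobi_sol x u \<Longrightarrow> jacobi_sol x (\<lambda>m. c * u m)"
  unfolding jacobi_sol_def by (metis distrib_left mult.left_commute)

lemma jacobi_sol_add: "jacobi_sol x u \<Longrightarrow> jacobi_sol x v \<Longrightarrow> jacobi_sol x (\<lambda>m. u m + v m)"
  unfolding jacobi_sol_def by (simp add: algebra_simps)

lemma jacobi_sol_diff: "jacobi_sol x u \<Longrightarrow> jacobi_sol x v \<Longrightarrow> jacobi_sol x (\<lambda>m. u m - v m)"
  unfolding jacobi_sol_def by (simp add: algebra_simps)

lemma jacobi_sol_minus: "jacobi_sol x u \<Longrightarrow> jacobi_sol x (\<lambda>m. - u m)"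
  unfolding jacobi_sol_def by (metis minus_add_distrib mult_minus_right)

lemma jacobi_sol_sol': "jacobi_sol x (\<lambda>m. sol x m n)"
  using jacobi_sol_minus[OF jacobi_sol_sol[of x n]] sol_antisym[of x _ n] by simp

lemma sol_expand:
  assumes "jacobi_sol x u"
  shows "u m = u (n + 1) * sol x n m - u n * sol x (n + 1) m"
  by (rule jacobi_sol_unique[OF assms jacobi_sol_diff[OF jacobi_sol_scale[OF jacobi_sol_sol] jacobi_sol_scale[OF jacobi_sol_sol]],
        where n=n]) simp_all

text \<open>Determinant of a transfer matrix, a product of matrices of determinant one; the sign is
  fixed by the case m = k.\<close>

lemma sol_wronskian:
  "sol x k (m + 1) * sol x (k + 1) m - sol x k m * sol x (k + 1) (m + 1) = -1"
proof (induction m rule: int_induct[where k=k])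
  case (step1 i)
  have "sol x k (i + 1 + 1) = x (i + 1) * sol x k (i + 1) - sol x k i"
    "sol x (k + 1) (i + 1 + 1) = x (i + 1) * sol x (k + 1) (i + 1) - sol x (k + 1) i"
    using jacobi_sol_sol[of x k] jacobi_sol_sol[of x "k + 1"] unfolding jacobi_sol_def
    by (metis add_diff_cancel_right')+
  then have "sol x k (i + 1 + 1) * sol x (k + 1) (i + 1) - sol x k (i + 1) * sol x (k + 1) (i + 1 + 1)
      = sol x k (i + 1) * sol x (k + 1) i - sol x k i * sol x (k + 1) (i + 1)"
    by (simp only: left_diff_distrib right_diff_distrib) (simp add: mult_ac)
  then show ?case using step1 by (simp only:)
next
  case (step2 i)
  have eqs: "sol x k (i - 1) = x i * sol x k i - sol x k (i + 1)"
    "sol x (k + 1) (i - 1) = x i * sol x (k + 1) i - sol x (k + 1) (i + 1)"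
    using jacobi_sol_sol[of x k] jacobi_sol_sol[of x "k + 1"] unfolding jacobi_sol_def
    by (metis add_diff_cancel_left')+
  have "sol x k (i - 1 + 1) * sol x (k + 1) (i - 1) - sol x k (i - 1) * sol x (k + 1) (i - 1 + 1)
      = sol x k (i + 1) * sol x (k + 1) i - sol x k i * sol x (k + 1) (i + 1)"
    unfolding eqs diff_add_cancel by (simp only: left_diff_distrib right_diff_distrib) (simp add: mult_ac)
  then show ?case using step2 by (simp only:)
qed simp

section \<open>Trace and symmetric form of the monodromy of a periodic recursion\<close>

definition disc :: "(int \<Rightarrow> 'a::comm_ring_1) \<Rightarrow> nat \<Rightarrow> 'a" where
  "disc x p = sol x 0 (int p + 1) - sol x 1 (int p)"

text \<open>Twice the symmetric form associated with the monodromy minus its inverse.\<close>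

definition mono_form :: "(int \<Rightarrow> 'a::comm_ring_1) \<Rightarrow> nat \<Rightarrow> int \<Rightarrow> int \<Rightarrow> 'a" where
  "mono_form x p m n = sol x n (m + int p) + sol x m (n + int p)"

lemma mono_form_commute: "mono_form x p m n = mono_form x p n m"
  by (simp add: mono_form_def)

lemma mono_form_diag: "mono_form x p n n = 2 * sol x n (n + int p)"
  by (simp add: mono_form_def)

locale periodic_jacobi =
  fixes x :: "int \<Rightarrow> 'a::comm_ring_1" and p :: nat
  assumes per: "x (n + int p) = x n"
begin

lemma per': "x (n - int p) = x n"
  using per[of "n - int p"] by simp

lemma jacobi_sol_shift:
  assumes "jacobi_sol x u" shows "jacobi_sol x (\<lambda>m. u (m + int p))"
  unfolding jacobi_sol_def
proof
  fix m
  have "u (m + int p + 1) + u (m + int p - 1) = x (m + int p) * u (m + int p)"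
    using assms unfolding jacobi_sol_def by blast
  then show "u (m + 1 + int p) + u (m - 1 + int p) = x m * u (m + int p)"
    by (simp add: per algebra_simps)
qed

lemma jacobi_sol_shift':
  assumes "jacobi_sol x u" shows "jacobi_sol x (\<lambda>m. u (m - int p))"
  unfolding jacobi_sol_def
proof
  fix m
  have "u (m - int p + 1) + u (m - int p - 1) = x (m - int p) * u (m - int p)"
    using assms unfolding jacobi_sol_def by blast
  then show "u (m + 1 - int p) + u (m - 1 - int p) = x m * u (m - int p)"
    by (simp add: per' algebra_simps)
qed

lemma sol_shift: "sol x (n + int p) (m + int p) = sol x n m"
  by (simp add: sol_def continuant_shift per)

lemma sol_shift': "sol x n (m - int p) = - sol x m (n + int p)"
  using sol_shift[of n "m - int p"] sol_antisym[of x "n + int p" m] by simp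

text \<open>Cayley-Hamilton for the monodromy M of determinant one, M + M^-1 = tr M, applied to
  \<open>sol x n\<close>. At m = n the left side cancels by \<open>sol_shift'\<close>.\<close>

lemma trace_aux:
  "sol x n (m + int p) + sol x n (m - int p) = (sol x n (n + 1 + int p) - sol x (n + 1) (n + int p)) * sol x n m"
proof (rule jacobi_sol_unique[where n=n and x=x])
  show "jacobi_sol x (\<lambda>m. sol x n (m + int p) + sol x n (m - int p))"
    by (rule jacobi_sol_add[OF jacobi_sol_shift[OF jacobi_sol_sol] jacobi_sol_shift'[OF jacobi_sol_sol]])
  show "jacobi_sol x (\<lambda>m. (sol x n (n + 1 + int p) - sol x (n + 1) (n + int p)) * sol x n m)"
    by (rule jacobi_sol_scale[OF jacobi_sol_sol])
qed (simp_all add: sol_shift')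

text \<open>Evaluating \<open>trace_aux\<close> with base n + 1 at the site n equates the traces at
  neighbouring bases, so the trace may be read off at site 0, as in \<open>disc\<close>.\<close>

lemma disc_eq: "sol x n (n + 1 + int p) - sol x (n + 1) (n + int p) = disc x p"
proof -
  let ?d = "\<lambda>n. sol x n (n + 1 + int p) - sol x (n + 1) (n + int p)"
  have step: "?d n = ?d (n + 1)" for n
  proof -
    have "sol x (n + 1) (n + int p) + - sol x n (n + 1 + int p) = ?d (n + 1) * - 1"
      using trace_aux[of "n + 1" n] unfolding sol_shift' sol_prev .
    then show ?thesis by (simp only: mult_minus1_right) (simp add: algebra_simps)
  qed
  have "?d n = ?d 0"
  proof (induction n rule: int_induct[where k=0])
    case (step1 i)
    then show ?case using step[of i] by (simp only:)
  next
    case (step2 i)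
    then show ?case using step[of "i - 1"] by (simp only: diff_add_cancel)
  qed (rule refl)
  then show ?thesis by (simp add: disc_def add.commute)
qed

lemma trace: "sol x n (m + int p) + sol x n (m - int p) = disc x p * sol x n m"
  using trace_aux disc_eq by simp

lemma mono_form_disc: "mono_form x p m n = 2 * sol x m (n + int p) + disc x p * sol x n m"
  using trace[of n m] by (simp add: mono_form_def sol_shift' algebra_simps)

lemma jacobi_sol_mono_form: "jacobi_sol x (\<lambda>m. mono_form x p m n)"
  unfolding mono_form_def
  by (rule jacobi_sol_add[OF jacobi_sol_shift[OF jacobi_sol_sol] jacobi_sol_sol'])

text \<open>With monodromy entries a, b, c, d the form has coefficients -2c, d - a, 2b, and ad - bc
  = 1 turns its determinant into 4 - (a + d)^2. Over the reals the form is therefore definite when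
  |tr M| < 2.\<close>

lemma mono_form_gram1:
  "mono_form x p (k + 1) (k + 1) * mono_form x p k k - (mono_form x p (k + 1) k)\<^sup>2 = 4 - (disc x p)\<^sup>2"
proof -
  define a b c d where "a = - sol x (k + 1) (k + int p)" and "b = sol x k (k + int p)"
    and "c = - sol x (k + 1) (k + 1 + int p)" and "d = sol x k (k + 1 + int p)"
  have "a * d - b * c = 1"
    using sol_wronskian[of x k "k + int p"] by (simp add: a_def b_def c_def d_def algebra_simps)
  moreover have "disc x p = a + d" using disc_eq[of k] by (simp add: a_def d_def)
  moreover have "mono_form x p (k + 1) k = d - a" "mono_form x p k k = 2 * b"
    "mono_form x p (k + 1) (k + 1) = - 2 * c"
    by (simp_all add: mono_form_def a_def b_def c_def d_def)
  moreover have "4 - (a + d)\<^sup>2 - ((- 2 * c) * (2 * b) - (d - a)\<^sup>2) = 4 * (1 - (a * d - b * c))"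
    by (simp add: power2_eq_square algebra_simps)
  ultimately show ?thesis by simp
qed

text \<open>Extends the determinant identity to arbitrary sites, one index at a time. Read as a
  formula for B_mn B_kk it is a sum of two rank-one terms, the source of positivity in
  \<open>B_positive\<close>.\<close>

lemma mono_form_gram:
  "mono_form x p m n * mono_form x p k k - mono_form x p m k * mono_form x p n k
     = (4 - (disc x p)\<^sup>2) * sol x k m * sol x k n"
proof -
  let ?B = "mono_form x p"
  have 1: "?B (k + 1) n * ?B k k - ?B (k + 1) k * ?B n k = (4 - (disc x p)\<^sup>2) * sol x k n" for n
  proof (rule jacobi_sol_unique[where n=k and x=x])
    show "jacobi_sol x (\<lambda>n. ?B (k + 1) n * ?B k k - ?B (k + 1) k * ?B n k)"
      using jacobi_sol_diff[OF jacobi_sol_scale[OF jacobi_sol_mono_form[of "k+1"], of "?B k k"]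
        jacobi_sol_scale[OF jacobi_sol_mono_form[of k], of "?B (k + 1) k"]]
      by (simp add: mono_form_commute[of x p "k+1"] mult.commute)
    show "jacobi_sol x (\<lambda>n. (4 - (disc x p)\<^sup>2) * sol x k n)"
      by (intro jacobi_sol_scale jacobi_sol_sol)
    show "?B (k + 1) (k + 1) * ?B k k - ?B (k + 1) k * ?B (k + 1) k = (4 - (disc x p)\<^sup>2) * sol x k (k + 1)"
      using mono_form_gram1[of k] by (simp add: power2_eq_square)
  qed simp
  show ?thesis
  proof (rule jacobi_sol_unique[where n=k and x=x and u="\<lambda>m. ?B m n * ?B k k - ?B m k * ?B n k"
        and v="\<lambda>m. (4 - (disc x p)\<^sup>2) * sol x k m * sol x k n"])
    show "jacobi_sol x (\<lambda>m. ?B m n * ?B k k - ?B m k * ?B n k)"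
      using jacobi_sol_diff[OF jacobi_sol_scale[OF jacobi_sol_mono_form[of n], of "?B k k"]
        jacobi_sol_scale[OF jacobi_sol_mono_form[of k], of "?B n k"]]
      by (simp add: mult.commute)
    show "jacobi_sol x (\<lambda>m. (4 - (disc x p)\<^sup>2) * sol x k m * sol x k n)"
      using jacobi_sol_scale[OF jacobi_sol_sol[of x k], of "(4 - (disc x p)\<^sup>2) * sol x k n"]
      by (simp add: mult_ac)
  qed (use 1[of n] in \<open>simp_all add: mono_form_commute[of x p k n]\<close>)
qed

text \<open>Iterated Cayley-Hamilton, M^(j+1) = U_j M - U_(j-1): the continuant with constant entry
  tr M is the Chebyshev polynomial of the second kind U_j at tr M / 2. Where U_j vanishes, M^(j+1)
  is scalar.\<close>

lemma sol_multi_period: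
  "sol x n (m + int (Suc j) * int p) =
     continuant (\<lambda>_. disc x p) 0 (Suc j) * sol x n (m + int p) - continuant (\<lambda>_. disc x p) 0 j * sol x n m"
proof (induction j rule: less_induct)
  case (less j)
  show ?case
  proof (cases j)
    case 0 then show ?thesis by simp
  next
    case (Suc i)
    have rec: "sol x n (m + int (Suc j) * int p) = disc x p * sol x n (m + int j * int p) - sol x n (m + int i * int p)"
      using trace[of n "m + int j * int p"] Suc by (simp add: algebra_simps)
    show ?thesis
    proof (cases i)
      case 0
      then show ?thesis using rec Suc by simp
    next
      case (Suc k)
      have jp: "sol x n (m + int j * int p) = continuant (\<lambda>_. disc x p) 0 (Suc i) * sol x n (m + int p) - continuant (\<lambda>_. disc x p) 0 i * sol x n m"
        and ip: "sol x n (m + int i * int p) = continuant (\<lambda>_. disc x p) 0 i * sol x n (m + int p) - continuant (\<lambda>_. disc x p) 0 k * sol x n m"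
        using less[of i] less[of k] \<open>j = Suc i\<close> Suc by simp_all
      show ?thesis unfolding rec jp ip using \<open>j = Suc i\<close> Suc by (simp add: algebra_simps)
    qed
  qed
qed

lemma mono_form_multi_period:
  "mono_form x (Suc j * p) m n = continuant (\<lambda>_. disc x p) 0 (Suc j) * mono_form x p m n"
  using sol_multi_period[of n m j] sol_multi_period[of m n j] sol_antisym[of x m n]
  unfolding mono_form_def by (simp add: algebra_simps)

lemma periodic_multi: "periodic_jacobi x (Suc j * p)"
proof
  fix n
  show "x (n + int (Suc j * p)) = x n"
  proof (induction j)
    case (Suc j)
    have "n + int (Suc (Suc j) * p) = n + int (Suc j * p) + int p" by (simp add: algebra_simps)
    then show ?case using per[of "n + int (Suc j * p)"] Suc by (simp only:)
  qed (simp add: per)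
qed

text \<open>Comparison of \<open>mono_form_gram1\<close> for the two periods: the form is multiplied
  by the Chebyshev factor, its determinant by the square.\<close>

lemma disc_multi_period:
  "4 - (disc x (Suc j * p))\<^sup>2 = (continuant (\<lambda>_. disc x p) 0 (Suc j))\<^sup>2 * (4 - (disc x p)\<^sup>2)"
  unfolding periodic_jacobi.mono_form_gram1[OF periodic_multi, symmetric, of _ 0] mono_form_gram1[symmetric, of 0]
    mono_form_multi_period by (simp add: power2_eq_square algebra_simps)

end

text \<open>At a closed gap the monodromy is \<open>\<plusminus>1\<close>. Adding \<open>t\<close> and \<open>-t\<close> on two adjacent sites multiplies
  it by a product of two shears, whose trace has absolute value \<open>2 + t\<^sup>2\<close>.\<close>

lemma disc_gap_opening:
  fixes x y :: "int \<Rightarrow> real"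
  assumes q: "q \<ge> 3" and per: "\<And>n. x (n + int q) = x n"
    and zero: "\<And>m n. mono_form x q m n = 0"
    and y1: "y 1 = x 1 - t" and y2: "y 2 = x 2 + t"
    and y: "\<And>m. 2 < m \<Longrightarrow> m \<le> int q \<Longrightarrow> y m = x m"
  shows "disc y q = disc x q * (1 + t\<^sup>2 / 2)"
proof -
  interpret periodic_jacobi x q by standard (rule per)
  obtain r where r: "q = Suc (Suc (Suc r))" using q by (intro that[of "q - 3"]) simp
  have disc_cont: "disc z q = z 1 * (z 2 * continuant z 2 (Suc (Suc r)) - continuant z 3 (Suc r))
      - continuant z 2 (Suc (Suc r)) - (z 2 * continuant z 2 (Suc r) - continuant z 3 r)" for z :: "int \<Rightarrow> real"
  proof -
    have "sol z 0 (int q + 1) = continuant z 0 (Suc (Suc (Suc (Suc r))))"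
      "sol z 1 (int q) = continuant z 1 (Suc (Suc r))"
      using sol_continuant[of z 0 "Suc (Suc (Suc (Suc r)))"] sol_continuant[of z 1 "Suc (Suc r)"]
      by (simp_all add: r algebra_simps)
    then show ?thesis
      unfolding disc_def by (simp only: continuant_front) simp
  qed
  have eqs: "continuant y 2 (Suc (Suc r)) = continuant x 2 (Suc (Suc r))"
    "continuant y 3 (Suc r) = continuant x 3 (Suc r)" "continuant y 2 (Suc r) = continuant x 2 (Suc r)"
    "continuant y 3 r = continuant x 3 r"
    by (rule continuant_cong, use y in \<open>simp add: r\<close>)+
  \<comment> \<open>The zeros of the form at (1,1), (2,2) and (1,2) are exactly what appears in the
    expansion in t: the linear terms vanish, and the quadratic one is a multiple of the
    discriminant.\<close>
  have s1: "x 2 * continuant x 2 (Suc (Suc r)) - continuant x 3 (Suc r) = 0"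
    using zero[of 1 1] sol_continuant[of x 1 q] continuant_front[of x 1 "Suc r"]
    by (simp add: mono_form_diag r add.commute)
  have s2: "x 1 * continuant x 2 (Suc (Suc r)) - continuant x 2 (Suc r) = 0"
    using zero[of 2 2] sol_continuant[of x 2 q] per[of 1]
    by (simp add: mono_form_diag r add.commute)
  have s3: "disc x q = - 2 * continuant x 2 (Suc (Suc r))"
    using zero[of 1 2] disc_eq[of 1] sol_continuant[of x 2 "Suc (Suc r)"]
    by (simp add: mono_form_def r add.commute)
  have "disc y q - disc x q = t * ((x 1 * continuant x 2 (Suc (Suc r)) - continuant x 2 (Suc r))
      - (x 2 * continuant x 2 (Suc (Suc r)) - continuant x 3 (Suc r))) - t\<^sup>2 * continuant x 2 (Suc (Suc r))"
    unfolding disc_cont eqs y1 y2 by (simp add: power2_eq_square algebra_simps)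
  also have "\<dots> = t\<^sup>2 * disc x q / 2" unfolding s1 s2 s3 by (simp del: continuant.simps)
  finally show ?thesis by (simp add: algebra_simps)
qed

text \<open>The Floquet multipliers l and cnj l lie on the unit circle because |c| <= 2. By
  Cayley-Hamilton, M - cnj l maps every solution into the eigenspace of l. Only consequences of |l|
  = 1 are recorded, so that the multiplier itself need not be carried along.\<close>

lemma bloch_solution:
  fixes x :: "int \<Rightarrow> complex"
  assumes "periodic_jacobi x p" and c: "disc x p = complex_of_real c" "\<bar>c\<bar> \<le> 2"
  shows "\<exists>u k. jacobi_sol x u \<and> u k \<noteq> 0 \<and> (\<forall>m. cmod (u (m + int p)) = cmod (u m)) \<and>
    (\<forall>m. cnj (u (m + int p)) * u (m + int p + 1) = cnj (u m) * u (m + 1))"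
proof -
  interpret periodic_jacobi x p by fact
  define l where "l = Complex (c / 2) (sqrt (1 - c\<^sup>2 / 4))"
  have "c\<^sup>2 \<le> 4" using c(2) abs_le_square_iff[of c 2] by simp
  then have sq: "(sqrt (1 - c\<^sup>2 / 4))\<^sup>2 = 1 - c\<^sup>2 / 4" by simp
  have l1: "l + cnj l = complex_of_real c" by (simp add: l_def complex_eq_iff)
  have l2: "l * cnj l = 1"
    using sq by (simp add: l_def complex_eq_iff power2_eq_square)
  have gen: ?thesis if u: "jacobi_sol x u" "u k \<noteq> 0" and qp: "\<And>m. u (m + int p) = \<mu> * u m"
     and mu: "\<mu> * cnj \<mu> = 1" for u k \<mu>
  proof (rule exI[of _ u], rule exI[of _ k], intro conjI allI u)
    fix m
    have "complex_of_real ((cmod \<mu>)\<^sup>2) = 1" using mu by (simp only: complex_norm_square)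
    then have "(cmod \<mu>)\<^sup>2 = 1" by (simp only: of_real_eq_1_iff)
    then have n1: "cmod \<mu> = 1" by (smt (verit) norm_ge_zero power2_eq_1_iff)
    show "cmod (u (m + int p)) = cmod (u m)" by (simp add: qp norm_mult n1)
    have "u (m + int p + 1) = \<mu> * u (m + 1)" using qp[of "m + 1"] by (simp add: algebra_simps)
    then have "cnj (u (m + int p)) * u (m + int p + 1) = (\<mu> * cnj \<mu>) * (cnj (u m) * u (m + 1))"
      by (simp add: qp mult_ac)
    then show "cnj (u (m + int p)) * u (m + int p + 1) = cnj (u m) * u (m + 1)" using mu by simp
  qed
  define w where "w m = sol x 0 (m + int p) - cnj l * sol x 0 m" for m
  have w: "jacobi_sol x w" unfolding w_def
    by (rule jacobi_sol_diff[OF jacobi_sol_shift[OF jacobi_sol_sol] jacobi_sol_scale[OF jacobi_sol_sol]])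
  have wp: "w (m + int p) = l * w m" for m
  proof -
    have "sol x 0 (m + int p + int p) = (l + cnj l) * sol x 0 (m + int p) - (l * cnj l) * sol x 0 m"
      using trace[of 0 "m + int p"] unfolding l1 l2 c(1) by (simp add: algebra_simps)
    then show ?thesis unfolding w_def by (simp add: algebra_simps)
  qed
  show ?thesis
  proof (cases "\<exists>k. w k \<noteq> 0")
    case True
    then show ?thesis using gen[OF w _ wp l2] by blast
  next
    \<comment> \<open>If M - cnj l annihilates \<open>sol x 0\<close>, that solution is itself an
      eigenvector, with multiplier cnj l.\<close>
    case False
    then have "sol x 0 (m + int p) = cnj l * sol x 0 m" for m unfolding w_def by simp
    then show ?thesis using gen[OF jacobi_sol_sol, of 0 1 "cnj l"] sol_next(1)[of x 0] l2 by (simp add: mult.commute)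
  qed
qed

text \<open>Flux argument: the imaginary part of cnj (u n) * u (n+1) changes by Im E |u|^2 at each
  site and returns after a period. This makes all complex roots of D = c real in
  \<open>card_roots\<close>.\<close>

lemma disc_real_energy:
  fixes V :: "int \<Rightarrow> real" and E :: complex
  assumes p: "p > 0" and per: "\<And>n. V (n + int p) = V n"
    and c: "disc (\<lambda>n. E - complex_of_real (V n)) p = complex_of_real c" "\<bar>c\<bar> \<le> 2"
  shows "Im E = 0"
proof -
  have "periodic_jacobi (\<lambda>n. E - complex_of_real (V n)) p" by standard (simp add: per)
  then obtain u k where u: "jacobi_sol (\<lambda>n. E - complex_of_real (V n)) u" "u k \<noteq> 0"
    and qp: "\<And>m. cnj (u (m + int p)) * u (m + int p + 1) = cnj (u m) * u (m + 1)"
    using bloch_solution[OF _ c] by blast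
  define W where "W n = Im (cnj (u n) * u (n + 1))" for n
  have W: "W m - W (m - 1) = Im E * (cmod (u m))\<^sup>2" for m
  proof -
    have "cnj (u m) * (u (m + 1) + u (m - 1)) = (E - complex_of_real (V m)) * (u m * cnj (u m))"
      using u(1) unfolding jacobi_sol_def by (simp add: mult_ac)
    then have "Im (cnj (u m) * (u (m + 1) + u (m - 1))) = Im E * (cmod (u m))\<^sup>2"
      by (simp only: complex_norm_square[symmetric]) simp
    then show ?thesis by (simp add: W_def algebra_simps)
  qed
  have "(\<Sum>i<p. W (k + int i) - W (k + int i - 1)) = W (k + int p - 1) - W (k - 1)"
    using sum_lessThan_telescope[of "\<lambda>i. W (k + int i - 1)" p] by (simp add: algebra_simps)
  also have "\<dots> = 0" unfolding W_def using qp[of "k - 1"] by (simp add: algebra_simps)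
  finally have "Im E * (\<Sum>i<p. (cmod (u (k + int i)))\<^sup>2) = 0" by (simp add: W sum_distrib_left)
  moreover have "(\<Sum>i<p. (cmod (u (k + int i)))\<^sup>2) > 0"
    using p u(2) by (intro sum_pos2[of _ 0]) auto
  ultimately show ?thesis by simp
qed

text \<open>The recursion is run over the polynomial ring, with the energy as indeterminate, so that
  degrees, leading coefficients and derivatives in E become algebraic.\<close>

definition pot_poly :: "(int \<Rightarrow> 'a::idom) \<Rightarrow> int \<Rightarrow> 'a poly" where
  "pot_poly V n = [:- V n, 1:]"

lemma poly_continuant: "poly (continuant (pot_poly V) n j) E = continuant (\<lambda>n. E - V n) n j"
  by (induction "pot_poly V" n j rule: continuant.induct) (auto simp: pot_poly_def algebra_simps)

lemma poly_sol: "poly (sol (pot_poly V) n m) E = sol (\<lambda>n. E - V n) n m"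
  by (simp add: sol_def poly_continuant)

lemma poly_disc: "poly (disc (pot_poly V) p) E = disc (\<lambda>n. E - V n) p"
  by (simp add: disc_def poly_sol)

lemma of_real_continuant: "continuant (\<lambda>n. complex_of_real (x n)) n j = complex_of_real (continuant x n j)"
  by (induction x n j rule: continuant.induct) auto

lemma of_real_sol: "sol (\<lambda>n. complex_of_real (x n)) n m = complex_of_real (sol x n m)"
  by (simp add: sol_def of_real_continuant)

lemma of_real_disc: "disc (\<lambda>n. complex_of_real (x n)) p = complex_of_real (disc x p)"
  by (simp add: disc_def of_real_sol)

lemma continuant_degree:
  "degree (continuant (pot_poly V) n (Suc j)) = j \<and> lead_coeff (continuant (pot_poly V) n (Suc j)) = 1"
proof (induction j rule: less_induct)
  case (less j)
  show ?case
  proof (cases j)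
    case (Suc i)
    define X where "X = pot_poly V (n + int i + 1)"
    have X: "degree X = 1" "lead_coeff X = 1" "X \<noteq> 0" by (simp_all add: X_def pot_poly_def)
    let ?c = "continuant (pot_poly V) n"
    have IH: "degree (?c (Suc i)) = i" "lead_coeff (?c (Suc i)) = 1" using less[of i] Suc by blast+
    then have nz: "?c (Suc i) \<noteq> 0" by (metis coeff_0 zero_neq_one)
    have P: "degree (X * ?c (Suc i)) = j" "lead_coeff (X * ?c (Suc i)) = 1"
      using degree_mult_eq[OF X(3) nz] lead_coeff_mult[of X "?c (Suc i)"] IH X Suc by simp_all
    have "degree (- ?c i) < degree (X * ?c (Suc i))"
    proof (cases i)
      case (Suc k)
      then show ?thesis using less[of k] \<open>j = Suc i\<close> P(1) by (simp del: continuant.simps)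
    qed (use Suc P(1) in simp)
    then have "degree (X * ?c (Suc i) + - ?c i) = j \<and> lead_coeff (X * ?c (Suc i) + - ?c i) = 1"
      using P by (metis degree_add_eq_left lead_coeff_add_le add.commute)
    moreover have "?c (Suc j) = X * ?c (Suc i) + - ?c i" using Suc by (simp add: X_def)
    ultimately show ?thesis by metis
  qed simp
qed

text \<open>Derivative of a determinant: deleting the site n + i splits the tridiagonal matrix into
  two blocks. The term i = 0 is zero.\<close>

lemma pderiv_continuant:
  "pderiv (continuant (pot_poly V) n j) = (\<Sum>i<j. continuant (pot_poly V) n i * continuant (pot_poly V) (n + int i) (j - i))"
proof (induction j rule: less_induct)
  case (less j)
  let ?c = "continuant (pot_poly V)"
  consider "j = 0" | "j = 1" | i where "j = Suc (Suc i)" by (metis One_nat_def not0_implies_Suc)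
  then show ?case
  proof cases
    case (3 i)
    let ?x = "pot_poly V (n + int i + 1)"
    have dx: "pderiv ?x = 1" by (simp add: pot_poly_def pderiv_pCons)
    have "pderiv (?c n j) = ?x * pderiv (?c n (Suc i)) + ?c n (Suc i) - pderiv (?c n i)"
      using 3 by (simp add: pderiv_diff pderiv_mult dx)
    also have "pderiv (?c n (Suc i)) = (\<Sum>k<Suc i. ?c n k * ?c (n + int k) (Suc i - k))"
      using less[of "Suc i"] 3 by simp
    also have "pderiv (?c n i) = (\<Sum>k<Suc i. ?c n k * ?c (n + int k) (i - k))"
      using less[of i] 3 by simp
    also have "?x * (\<Sum>k<Suc i. ?c n k * ?c (n + int k) (Suc i - k)) + ?c n (Suc i) - (\<Sum>k<Suc i. ?c n k * ?c (n + int k) (i - k))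
       = (\<Sum>k<Suc i. ?c n k * (?x * ?c (n + int k) (Suc i - k) - ?c (n + int k) (i - k))) + ?c n (Suc i)"
      by (simp add: sum_distrib_left sum_subtractf algebra_simps del: sum.lessThan_Suc)
    also have "(\<Sum>k<Suc i. ?c n k * (?x * ?c (n + int k) (Suc i - k) - ?c (n + int k) (i - k)))
      = (\<Sum>k<Suc i. ?c n k * ?c (n + int k) (j - k))"
    proof (intro sum.cong refl)
      fix k assume "k \<in> {..<Suc i}"
      then have "j - k = Suc (Suc (i - k))" "Suc i - k = Suc (i - k)" "n + int k + int (i - k) + 1 = n + int i + 1"
        using 3 by auto
      then show "?c n k * (?x * ?c (n + int k) (Suc i - k) - ?c (n + int k) (i - k)) = ?c n k * ?c (n + int k) (j - k)"
        by simp
    qed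
    finally show ?thesis using 3 by simp
  qed (auto simp: pderiv_1)
qed

text \<open>In the periodic problem deleting a site cuts the ring open and leaves one continuant
  over the other p - 1 sites. These are half the diagonal entries of the form, so inside a band they
  all have the same sign.\<close>

lemma pderiv_disc:
  assumes p: "p > 0" and per: "\<And>n. V (n + int p) = V n"
  shows "pderiv (disc (pot_poly V) p) = (\<Sum>i<p. sol (pot_poly V) (int i + 1) (int i + 1 + int p))"
proof -
  let ?c = "continuant (pot_poly V)" and ?s = "sol (pot_poly V)"
  interpret periodic_jacobi "pot_poly V" p by standard (simp add: pot_poly_def per)
  obtain r where r: "p = Suc r" using p gr0_implies_Suc by blast
  have 1: "?s 0 (int p + 1) = ?c 0 (Suc p)" using sol_continuant[of "pot_poly V" 0 "Suc p"] by (simp add: add.commute)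
  have 2: "?s 1 (int p) = ?c 1 r" using sol_continuant[of "pot_poly V" 1 r] by (simp add: r)
  have "pderiv (disc (pot_poly V) p) = (\<Sum>i<Suc p. ?c 0 i * ?c (int i) (Suc p - i)) - (\<Sum>i<r. ?c 1 i * ?c (1 + int i) (r - i))"
    unfolding disc_def 1 2 by (simp only: pderiv_diff pderiv_continuant) simp
  also have "(\<Sum>i<Suc p. ?c 0 i * ?c (int i) (Suc p - i)) = (\<Sum>i<p. ?c 0 (Suc i) * ?c (int i + 1) (p - i))"
    by (simp only: sum.lessThan_Suc_shift) (simp add: add.commute)
  also have "(\<Sum>i<r. ?c 1 i * ?c (1 + int i) (r - i)) = (\<Sum>i<p. ?c 1 i * ?c (int i + 1) (r - i))"
    by (simp add: r add.commute)
  also have "(\<Sum>i<p. ?c 0 (Suc i) * ?c (int i + 1) (p - i)) - \<dots> = (\<Sum>i<p. ?s (int i + 1) (int i + 1 + int p))"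
    unfolding sum_subtractf[symmetric]
  proof (intro sum.cong refl)
    fix i assume i: "i \<in> {..<p}"
    let ?j = "int i + 1"
    have e1: "?j + int (p - i) = int p + 1" and e2: "?j + int (r - i) = int p" using i r by auto
    \<comment> \<open>The opened ring is expanded at the seam between p and p + 1, and the part
      beyond it is shifted back by a period; this matches the two determinants in
      \<open>disc\<close>.\<close>
    have "?s ?j (?j + int p) = ?s ?j (int p + 1) * ?s (int p) (?j + int p) - ?s ?j (int p) * ?s (int p + 1) (?j + int p)"
      by (rule sol_expand[OF jacobi_sol_sol])
    also have "?s (int p) (?j + int p) = ?s 0 ?j" using sol_shift[of 0 ?j] by simp
    also have "?s (int p + 1) (?j + int p) = ?s 1 ?j" using sol_shift[of 1 ?j] by (simp add: add.commute)
    also have "?s 0 ?j = ?c 0 (Suc i)" using sol_continuant[of "pot_poly V" 0 "Suc i"] by (simp add: add.commute)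
    also have "?s 1 ?j = ?c 1 i" using sol_continuant[of "pot_poly V" 1 i] by (simp add: add.commute)
    also have "?s ?j (int p + 1) = ?c ?j (p - i)" using sol_continuant[of "pot_poly V" ?j "p - i"] e1 by (simp only:)
    also have "?s ?j (int p) = ?c ?j (r - i)" using sol_continuant[of "pot_poly V" ?j "r - i"] e2 by (simp only:)
    finally show "?c 0 (Suc i) * ?c ?j (p - i) - ?c 1 i * ?c ?j (r - i) = ?s ?j (?j + int p)"
      by (simp add: mult.commute)
  qed
  finally show ?thesis .
qed

section \<open>Bands of a periodic potential\<close>

text \<open>Lagrange interpolation at the roots reproduces P. The unnormalized basis polynomial
  \<open>L r\<close> is monic and has the value f'(r) at r, so the claim is a comparison of
  coefficients of degree p - 1.\<close>

lemma lagrange_sum_lead_coeff: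
  fixes f P :: "'a::field_char_0 poly"
  assumes f: "degree f = p" "lead_coeff f = 1" and R: "finite R" "card R = p" "\<And>r. r \<in> R \<Longrightarrow> poly f r = 0"
    and P: "degree P < p"
  shows "(\<Sum>r\<in>R. poly P r / poly (pderiv f) r) = coeff P (p - 1)"
proof -
  define L where "L r = (\<Prod>w\<in>R - {r}. [:- w, 1:])" for r
  have dL: "degree (L r) = p - 1" "lead_coeff (L r) = 1" if "r \<in> R" for r
    using that R unfolding L_def
    by (subst degree_prod_eq_sum_degree; auto)
       (subst lead_coeff_prod; auto)
  have f_eq: "f = (\<Prod>w\<in>R. [:- w, 1:])"
  proof (rule poly_eqI_degree_lead_coeff[where n=p and A=R])
    have dp: "degree (\<Prod>w\<in>R. [:- w, 1:]) = p" using R by (subst degree_prod_eq_sum_degree) auto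
    have "lead_coeff (\<Prod>w\<in>R. [:- w, 1:]) = 1" by (subst lead_coeff_prod) auto
    then show "coeff f p = coeff (\<Prod>w\<in>R. [:- w, 1:]) p" using f dp by simp
    show "degree (\<Prod>w\<in>R. [:- w, 1:]) \<le> p" using dp by simp
    fix z assume "z \<in> R"
    then show "poly f z = poly (\<Prod>w\<in>R. [:- w, 1:]) z"
      using R by (auto simp: poly_prod prod_zero_iff)
  qed (use f R in auto)
  have Lz: "poly (L r) z = 0" if "r \<in> R" "z \<in> R" "r \<noteq> z" for r z
    using that R unfolding L_def by (auto simp: poly_prod prod_zero_iff)
  have df: "poly (pderiv f) r = poly (L r) r" if r: "r \<in> R" for r
  proof -
    have "poly (pderiv f) r = (\<Sum>a\<in>R. poly (L a) r)"
      unfolding f_eq pderiv_prod L_def by (simp add: poly_sum pderiv_pCons)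
    also have "\<dots> = (\<Sum>a\<in>R. if a = r then poly (L r) r else 0)"
      using Lz r by (intro sum.cong) auto
    also have "\<dots> = poly (L r) r" using R r by simp
    finally show ?thesis .
  qed
  have Lnz: "poly (L r) r \<noteq> 0" for r
    using R unfolding L_def by (auto simp: poly_prod prod_zero_iff)
  define Q where "Q = (\<Sum>r\<in>R. smult (poly P r / poly (pderiv f) r) (L r))"
  have "P = Q"
  proof (rule poly_eqI_degree[where A=R])
    fix z assume z: "z \<in> R"
    have "poly Q z = (\<Sum>r\<in>R. if r = z then poly P z / poly (pderiv f) z * poly (L z) z else 0)"
      unfolding Q_def poly_sum using Lz z by (intro sum.cong) auto
    also have "\<dots> = poly P z" using z R Lnz[of z] by (simp add: df)
    finally show "poly P z = poly Q z" by simp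
  next
    show "degree P < card R" using P R by simp
    have "degree Q \<le> p - 1"
      unfolding Q_def using dL(1) by (intro degree_sum_le R order.trans[OF degree_smult_le]) auto
    then show "degree Q < card R" using P R by simp
  qed
  moreover have "coeff Q (p - 1) = (\<Sum>r\<in>R. poly P r / poly (pderiv f) r * coeff (L r) (p - 1))"
    by (simp add: Q_def coeff_sum)
  ultimately have "coeff P (p - 1) = (\<Sum>r\<in>R. poly P r / poly (pderiv f) r * coeff (L r) (p - 1))"
    by simp
  also have "\<dots> = (\<Sum>r\<in>R. poly P r / poly (pderiv f) r)"
    using dL by (intro sum.cong) auto
  finally show ?thesis by simp
qed

lemma continuant_degree_le: "degree (continuant (pot_poly V) n j) \<le> j - 1"
  using continuant_degree[of V n "j - 1"] by (cases j) (auto simp del: continuant.simps(2-))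

lemma continuant_coeff_0:
  assumes "i \<ge> j" shows "coeff (continuant (pot_poly V) n j) i = 0"
proof (cases j)
  case (Suc k)
  then show ?thesis using continuant_degree_le[of V n j] assms by (intro coeff_eq_0) auto
qed simp

lemma continuant_coeff_1: "coeff (continuant (pot_poly V) n (Suc j)) j = 1"
  using continuant_degree[of V n j] by metis

text \<open>General coefficients, because counting roots requires the same facts for the complex
  copy of a real potential.\<close>

locale periodic_potential =
  fixes V :: "int \<Rightarrow> 'a::{idom, semiring_char_0}" and p :: nat
  assumes p: "p > 0" and per: "V (n + int p) = V n"
begin

sublocale jac: periodic_jacobi "\<lambda>n. E - V n" p for E
  by standard (simp add: per)

lemma disc_poly_continuant: "disc (pot_poly V) p = continuant (pot_poly V) 0 (Suc p) - continuant (pot_poly V) 1 (p - 1)"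
proof -
  have "sol (pot_poly V) 0 (int p + 1) = continuant (pot_poly V) 0 (Suc p)"
    using sol_continuant[of "pot_poly V" 0 "Suc p"] by (simp add: add.commute del: continuant.simps)
  moreover have "sol (pot_poly V) 1 (int p) = continuant (pot_poly V) 1 (p - 1)"
    using sol_continuant[of "pot_poly V" 1 "p - 1"] p by (simp add: of_nat_diff)
  ultimately show ?thesis by (simp add: disc_def)
qed

lemma degree_disc: "degree (disc (pot_poly V) p) = p" and lead_coeff_disc: "lead_coeff (disc (pot_poly V) p) = 1"
proof -
  have c: "coeff (disc (pot_poly V) p) p = 1"
    unfolding disc_poly_continuant coeff_diff by (simp add: continuant_coeff_0 continuant_coeff_1 del: continuant.simps)
  have "degree (disc (pot_poly V) p) \<le> p"
    unfolding disc_poly_continuant using continuant_degree_le[of V 0 "Suc p"] continuant_degree_le[of V 1 "p - 1"]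
    by (intro degree_diff_le) (auto simp del: continuant.simps)
  moreover have "degree (disc (pot_poly V) p) \<ge> p" using c by (intro le_degree) simp
  ultimately show "degree (disc (pot_poly V) p) = p" by simp
  then show "lead_coeff (disc (pot_poly V) p) = 1" using c by simp
qed

lemma poly_pderiv_disc:
  "poly (pderiv (disc (pot_poly V) p)) E = (\<Sum>i<p. sol (\<lambda>n. E - V n) (int i + 1) (int i + 1 + int p))"
  using pderiv_disc[of p V, OF p per] by (simp add: poly_sum poly_sol)

end

locale real_periodic_potential = periodic_potential V p for V :: "int \<Rightarrow> real" and p
begin

abbreviation B where "B E \<equiv> mono_form (\<lambda>n. E - V n) p"

definition D where "D E = disc (\<lambda>n. E - V n) p"

text \<open>A sum of diagonal entries of the form, whose common sign is visible;
  \<open>D'_poly\<close> identifies it with the derivative of D.\<close>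

definition D' where "D' E = (\<Sum>i<p. B E (int i + 1) (int i + 1)) / 2"

text \<open>Points with |D| = 2, closed gaps included, are left out. The set therefore depends on
  the chosen multiple of the period, but only up to finitely many points.\<close>

definition bands where "bands = {E. \<bar>D E\<bar> < 2}"

lemma D_poly: "D E = poly (disc (pot_poly V) p) E"
  by (simp add: D_def poly_disc)

lemma D'_poly: "D' E = poly (pderiv (disc (pot_poly V) p)) E"
  by (simp add: D'_def poly_pderiv_disc mono_form_diag sum_divide_distrib)

lemma DERIV_D: "(D has_field_derivative D' E) (at E)"
  unfolding D'_poly using poly_DERIV[of "disc (pot_poly V) p" E] by (simp add: D_poly[abs_def])

lemma continuous_D: "continuous_on S D"
  unfolding D_poly[abs_def] by (intro continuous_intros)

lemma open_bands: "open bands"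
  unfolding bands_def by (intro open_Collect_less continuous_intros continuous_D)

lemma four_minus_D: "E \<in> bands \<Longrightarrow> 4 - (D E)\<^sup>2 > 0"
  using abs_square_less_1[of "D E / 2"] by (simp add: bands_def power_divide)

text \<open>By the determinant identity the product is at least 4 - D^2. Hence all diagonal entries
  have one sign at each band energy.\<close>

lemma B_next_pos: "E \<in> bands \<Longrightarrow> B E (n + 1) (n + 1) * B E n n > 0"
  using jac.mono_form_gram1[of E n] four_minus_D[of E] by (simp add: D_def) (smt (verit) zero_le_power2)

lemma B_sgn:
  assumes "E \<in> bands" shows "sgn (B E n n) = sgn (B E 0 0)"
proof -
  have step: "sgn (B E (n + 1) (n + 1)) = sgn (B E n n)" for n
    using B_next_pos[OF assms, of n] by (auto simp: sgn_if zero_less_mult_iff)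
  show ?thesis
  proof (induction n rule: int_induct[where k=0])
    case (step1 i)
    then show ?case using step[of i] by simp
  next
    case (step2 i)
    then show ?case using step[of "i - 1"] by simp
  qed simp
qed

lemma B_nonzero: "E \<in> bands \<Longrightarrow> B E n n \<noteq> 0"
  using B_next_pos[of E n] by auto

lemma B_abs: "E \<in> bands \<Longrightarrow> \<bar>B E n n\<bar> = sgn (B E 0 0) * B E n n"
  using B_sgn[of E n] by (simp add: abs_sgn mult.commute)

text \<open>The terms of \<open>D'\<close> have equal signs, so there is no cancellation: D is
  strictly monotone on each band, and \<open>D'\<close> dominates every diagonal entry.\<close>

lemma D'_abs:
  assumes "E \<in> bands" shows "\<bar>D' E\<bar> = sgn (B E 0 0) * D' E" "\<bar>D' E\<bar> = (\<Sum>i<p. \<bar>B E (int i + 1) (int i + 1)\<bar>) / 2"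
proof -
  have eq: "sgn (B E 0 0) * D' E = (\<Sum>i<p. \<bar>B E (int i + 1) (int i + 1)\<bar>) / 2"
    unfolding D'_def by (simp add: B_abs[OF assms] sum_distrib_left)
  have "\<bar>D' E\<bar> = \<bar>sgn (B E 0 0) * D' E\<bar>"
    using B_nonzero[OF assms, of 0] by (simp add: abs_mult abs_sgn_eq)
  also have "\<dots> = sgn (B E 0 0) * D' E" unfolding eq by (simp add: sum_nonneg)
  finally show "\<bar>D' E\<bar> = sgn (B E 0 0) * D' E" .
  then show "\<bar>D' E\<bar> = (\<Sum>i<p. \<bar>B E (int i + 1) (int i + 1)\<bar>) / 2" using eq by simp
qed

lemma D'_nonzero: "E \<in> bands \<Longrightarrow> D' E \<noteq> 0"
proof -
  assume E: "E \<in> bands"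
  have "(\<Sum>i<p. \<bar>B E (int i + 1) (int i + 1)\<bar>) > 0"
    using B_nonzero[OF E] p by (intro sum_pos) auto
  then show ?thesis using D'_abs(2)[OF E] by auto
qed

lemma B_diag_le:
  assumes "E \<in> bands" shows "\<bar>B E n n\<bar> \<le> 2 * \<bar>D' E\<bar>"
proof -
  have per1: "B E (n + int p) (n + int p) = B E n n" for n
    using jac.sol_shift[of E n "n + int p"] by (simp add: mono_form_diag)
  obtain i where i: "i < p" "B E n n = B E (int i + 1) (int i + 1)"
    using periodic_representative[of "\<lambda>n. B E n n" p, OF per1 p] by blast
  note i(2)
  also have "\<bar>\<dots>\<bar> \<le> (\<Sum>i<p. \<bar>B E (int i + 1) (int i + 1)\<bar>)"
    using i by (intro member_le_sum) auto
  finally show ?thesis using D'_abs(2)[OF assms] by simp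
qed

text \<open>The complex roots of D = c are real by \<open>disc_real_energy\<close> and simple
  because \<open>D'\<close> has no zero in the bands; the square-free factorization then counts
  them.\<close>

lemma card_roots:
  assumes c: "\<bar>c\<bar> < 2" shows "finite {E. D E = c}" "card {E. D E = c} = p"
proof -
  define W where "W n = complex_of_real (V n)" for n
  interpret cx: periodic_potential W p by standard (use p per in \<open>auto simp: W_def\<close>)
  define f where "f = disc (pot_poly W) p - [:complex_of_real c:]"
  have ev: "poly f (complex_of_real E) = complex_of_real (D E - c)" for E
    unfolding f_def D_def poly_diff poly_disc W_def of_real_diff[symmetric] of_real_disc by simp
  have real: "Im z = 0" if "poly f z = 0" for z
    using that c disc_real_energy[of p V z c, OF p per] by (simp add: f_def poly_disc W_def)
  have df: "poly (pderiv f) (complex_of_real E) = complex_of_real (D' E)" for E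
    unfolding D'_poly poly_pderiv_disc f_def pderiv_diff pderiv_pCons
    by (simp add: cx.poly_pderiv_disc W_def of_real_sol flip: of_real_diff)
  have deg: "degree f = p"
  proof -
    have "degree (- [:complex_of_real c:]) < degree (disc (pot_poly W) p)" using p cx.degree_disc by simp
    from degree_add_eq_left[OF this] show ?thesis
      unfolding f_def using cx.degree_disc by (simp only: diff_conv_add_uminus)
  qed
  have f0: "f \<noteq> 0" using deg p by auto
  have roots: "{z. poly f z = 0} = complex_of_real ` {E. D E = c}"
  proof (intro equalityI subsetI)
    fix z assume "z \<in> {z. poly f z = 0}"
    then have z: "poly f z = 0" by simp
    then have "z = complex_of_real (Re z)" using real[OF z] by (simp add: complex_eq_iff)
    then show "z \<in> complex_of_real ` {E. D E = c}" using z ev[of "Re z"] by (intro image_eqI[of _ _ "Re z"]) auto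
  qed (auto simp: ev)
  have "rsquarefree f"
    unfolding rsquarefree_roots
  proof (intro allI notI)
    fix z assume "poly f z = 0 \<and> poly (pderiv f) z = 0"
    then obtain E where "D E = c" "z = complex_of_real E" "poly (pderiv f) z = 0" using roots by blast
    then show False using df[of E] D'_nonzero[of E] c by (simp add: bands_def)
  qed
  then have "f = smult (lead_coeff f) (\<Prod>z|poly f z = 0. [:-z, 1:])"
    by (simp only: complex_poly_decompose_rsquarefree)
  then have "degree f = degree (\<Prod>z|poly f z = 0. [:-z, 1:])"
    using f0 by (metis degree_smult_eq leading_coeff_0_iff)
  also have "\<dots> = card {z. poly f z = 0}"
    by (subst degree_prod_eq_sum_degree) auto
  also have "\<dots> = card {E. D E = c}" unfolding roots by (simp add: card_image inj_on_def)
  finally show "card {E. D E = c} = p" using deg by simp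
  then show "finite {E. D E = c}" using p card.infinite by fastforce
qed

lemma finite_level: "finite {E. D E = c}"
proof -
  have "disc (pot_poly V) p - [:c:] \<noteq> 0"
    using degree_disc p by (metis degree_pCons_0 eq_iff_diff_eq_0 less_irrefl)
  from poly_roots_finite[OF this] show ?thesis by (simp add: D_poly)
qed

text \<open>The endpoints are the nearest points outside the bands. There |D| is at least 2, and by
  continuity at most 2; strict monotonicity excludes equal end values, so D runs from one of -2, 2
  to the other.\<close>

lemma bands_interval_endpoints:
  assumes bdd: "bounded bands" and E: "E \<in> bands"
  shows "\<exists>a b. a < E \<and> E < b \<and> {a<..<b} \<subseteq> bands \<and> inj_on D {a..b} \<and> D ` {a<..<b} = {-2<..<2} \<and>
    a \<notin> bands \<and> b \<notin> bands \<and> \<bar>D b - D a\<bar> = 4"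
proof -
  obtain M where M: "\<And>y. y \<in> bands \<Longrightarrow> \<bar>y\<bar> \<le> M" using bdd by (auto simp: bounded_real)
  define a where "a = Sup ({..E} - bands)"
  define b where "b = Inf ({E..} - bands)"
  have A: "a \<in> {..E} - bands"
    unfolding a_def
  proof (rule closed_contains_Sup)
    have "min E (- M - 1) \<in> {..E} - bands" using M[of "min E (-M-1)"] by (auto simp: min_def abs_if split: if_splits)
    then show "{..E} - bands \<noteq> {}" by blast
  qed (auto intro!: closed_Diff open_bands)
  have Bb: "b \<in> {E..} - bands"
    unfolding b_def
  proof (rule closed_contains_Inf)
    have "max E (M + 1) \<in> {E..} - bands" using M[of "max E (M+1)"] by (auto simp: max_def abs_if split: if_splits)
    then show "{E..} - bands \<noteq> {}" by blast
  qed (auto intro!: closed_Diff open_bands)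
  have ab: "a < E" "E < b" using A Bb E by (auto simp: less_le)
  have sub: "{a<..<b} \<subseteq> bands"
  proof
    fix y assume y: "y \<in> {a<..<b}"
    show "y \<in> bands"
    proof (rule ccontr)
      assume n: "y \<notin> bands"
      show False
      proof (cases "y \<le> E")
        case True
        then have "y \<le> a" unfolding a_def using n by (intro cSup_upper) auto
        then show False using y by simp
      next
        case False
        then have "b \<le> y" unfolding b_def using n by (intro cInf_lower) auto
        then show False using y by simp
      qed
    qed
  qed
  have inj: "inj_on D {a..b}"
  proof (rule inj_onI)
    have "False" if xy: "x < y" "a \<le> x" "y \<le> b" "D x = D y" for x y
    proof -
      obtain z where z: "x < z" "z < y" "DERIV D z :> 0"
        using Rolle[OF xy(1,4) continuous_D] DERIV_D by (meson real_differentiable_def)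
      then have "D' z = 0" using DERIV_D DERIV_unique by blast
      moreover have "z \<in> bands" using z xy sub by auto
      ultimately show False using D'_nonzero by blast
    qed
    then show "x = y" if "x \<in> {a..b}" "y \<in> {a..b}" "D x = D y" for x y
      using that by (metis atLeastAtMost_iff linorder_neqE_linordered_idom)
  qed
  have "{a..b} \<subseteq> closure {a<..<b}" using ab by simp
  also have "\<dots> \<subseteq> {x. \<bar>D x\<bar> \<le> 2}"
    using sub by (intro closure_minimal closed_Collect_le continuous_intros continuous_D) (auto simp: bands_def)
  finally have "{a..b} \<subseteq> {x. \<bar>D x\<bar> \<le> 2}" .
  moreover have "a \<in> {a..b}" "b \<in> {a..b}" using ab by auto
  ultimately have "\<bar>D a\<bar> \<le> 2" "\<bar>D b\<bar> \<le> 2" by blast+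
  moreover have "\<bar>D a\<bar> \<ge> 2" "\<bar>D b\<bar> \<ge> 2" using A Bb by (auto simp: bands_def)
  moreover have "D a \<noteq> D b" using inj ab by (auto dest!: inj_onD)
  ultimately have ends: "D a = -2 \<and> D b = 2 \<or> D a = 2 \<and> D b = -2" by linarith
  have "D ` {a<..<b} = {-2<..<2}"
  proof (intro equalityI subsetI)
    fix c assume "c \<in> {-2<..<2 :: real}"
    then have c: "-2 < c" "c < 2" by auto
    have "\<exists>y. a \<le> y \<and> y \<le> b \<and> D y = c"
      using ends
    proof
      assume "D a = - 2 \<and> D b = 2"
      then show ?thesis using c ab by (intro IVT') (auto intro: continuous_D)
    next
      assume "D a = 2 \<and> D b = - 2"
      then show ?thesis using c ab by (intro IVT2') (auto intro: continuous_D)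
    qed
    then obtain y where y: "a \<le> y" "y \<le> b" "D y = c" by blast
    then have "y \<noteq> a" "y \<noteq> b" using ends c by auto
    then show "c \<in> D ` {a<..<b}" using y by auto
  qed (use sub in \<open>auto simp: bands_def\<close>)
  moreover have "\<bar>D b - D a\<bar> = 4" using ends by auto
  ultimately show ?thesis using ab sub inj A Bb by blast
qed

text \<open>On the level set the form is 2 P, where P has degree below p and top coefficient 1 or 0
  according to m = n. The restriction to less than one period controls both the degree and the top
  coefficient.\<close>

lemma band_lagrange:
  assumes mn: "n \<le> m" "m < n + int p" and c: "\<bar>c\<bar> < 2"
  shows "(\<Sum>E | D E = c. B E m n / (2 * D' E)) = (if m = n then 1 else 0)"
proof -
  define k where "k = nat (m - n)"
  have k: "m = n + int k" "k < p" using mn by (auto simp: k_def)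
  define f where "f = disc (pot_poly V) p - [:c:]"
  define Q where "Q = continuant (pot_poly V) n k"
  define R where "R = continuant (pot_poly V) m (p - k)"
  \<comment> \<open>The multiple c / 2 comes from \<open>mono_form_disc\<close>, with D replaced by
    its value c on the level set.\<close>
  define P where "P = R + smult (c / 2) Q"
  have cx: "degree (- [:c:]) < degree (disc (pot_poly V) p)" using p degree_disc by simp
  have deg: "degree f = p" unfolding f_def using degree_add_eq_left[OF cx] degree_disc by (simp only: diff_conv_add_uminus)
  have lc: "lead_coeff f = 1"
    using deg lead_coeff_disc degree_disc p unfolding f_def by (cases p) auto
  have dQ: "degree Q \<le> p - 1" "coeff Q (p - 1) = 0"
    unfolding Q_def using continuant_degree_le[of V n k] continuant_coeff_0[of k "p - 1" V n] k by linarith+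
  have dR: "degree R \<le> p - 1" "coeff R (p - 1) = (if m = n then 1 else 0)"
  proof -
    show "degree R \<le> p - 1" unfolding R_def using continuant_degree_le[of V m "p - k"] by linarith
    show "coeff R (p - 1) = (if m = n then 1 else 0)"
    proof (cases "m = n")
      case True
      then have "p - k = Suc (p - 1)" using k p by simp
      then show ?thesis using True continuant_coeff_1[of V m "p - 1"] by (simp add: R_def del: continuant.simps)
    next
      case False
      then have "p - 1 \<ge> p - k" using k by simp
      then show ?thesis using False continuant_coeff_0[of "p - k" "p - 1" V m] by (simp add: R_def)
    qed
  qed
  have dP: "degree P < p"
    unfolding P_def using dQ dR p by (intro le_less_trans[OF degree_add_le[of _ "p - 1"]]) (auto intro: order.trans[OF degree_smult_le])
  have "(\<Sum>E | D E = c. poly P E / poly (pderiv f) E) = coeff P (p - 1)"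
    using card_roots[OF c] by (intro lagrange_sum_lead_coeff deg lc dP) (auto simp: f_def D_poly)
  also have "\<dots> = (if m = n then 1 else 0)" using dQ dR by (simp add: P_def)
  also have "(\<Sum>E | D E = c. poly P E / poly (pderiv f) E) = (\<Sum>E | D E = c. B E m n / (2 * D' E))"
  proof (intro sum.cong refl)
    fix E assume "E \<in> {E. D E = c}"
    then have "D E = c" by simp
    have "n + int p = m + int (p - k)" using k by simp
    then have "sol (\<lambda>n. E - V n) m (n + int p) = poly R E" "sol (\<lambda>n. E - V n) n m = poly Q E"
      unfolding R_def Q_def poly_continuant k(1) by (metis sol_continuant k(1))+
    then have "B E m n = 2 * poly P E"
      using jac.mono_form_disc[of E m n] \<open>D E = c\<close> by (simp add: P_def D_def)
    moreover have "poly (pderiv f) E = D' E" by (simp add: f_def pderiv_diff pderiv_pCons D'_poly)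
    ultimately show "poly P E / poly (pderiv f) E = B E m n / (2 * D' E)" by simp
  qed
  finally show ?thesis .
qed

text \<open>Multiplied by B_00 the quadratic form is a sum of two squares, by
  \<open>mono_form_gram\<close> with k = 0; replacing B_00 by its sign preserves
  nonnegativity.\<close>

lemma B_positive:
  assumes E: "E \<in> bands" and F: "finite F"
  shows "0 \<le> (\<Sum>m\<in>F. \<Sum>n\<in>F. a m * a n * (sgn (B E 0 0) * B E m n))"
proof -
  let ?X = "\<Sum>m\<in>F. \<Sum>n\<in>F. a m * a n * B E m n" and ?S = "sol (\<lambda>n. E - V n)"
  have g: "B E m n * B E 0 0 = B E m 0 * B E n 0 + (4 - (D E)\<^sup>2) * ?S 0 m * ?S 0 n" for m n
    using jac.mono_form_gram[of E m n 0] by (simp add: D_def)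
  have sq: "(\<Sum>m\<in>F. h m)\<^sup>2 = (\<Sum>m\<in>F. \<Sum>n\<in>F. h m * h n)" for h :: "int \<Rightarrow> real"
    by (simp add: power2_eq_square sum_product)
  have "?X * B E 0 0 = (\<Sum>m\<in>F. \<Sum>n\<in>F. a m * a n * (B E m n * B E 0 0))"
    by (simp add: sum_distrib_left sum_distrib_right mult_ac)
  also have "\<dots> = (\<Sum>m\<in>F. \<Sum>n\<in>F. (a m * B E m 0) * (a n * B E n 0) + (4 - (D E)\<^sup>2) * ((a m * ?S 0 m) * (a n * ?S 0 n)))"
    unfolding g by (simp add: algebra_simps)
  also have "\<dots> = (\<Sum>m\<in>F. a m * B E m 0)\<^sup>2 + (4 - (D E)\<^sup>2) * (\<Sum>m\<in>F. a m * ?S 0 m)\<^sup>2"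
    by (simp only: sum.distrib sq sum_distrib_left)
  also have "\<dots> \<ge> 0" using four_minus_D[OF E] by simp
  finally have "0 \<le> ?X * B E 0 0" .
  then have "0 \<le> ?X * sgn (B E 0 0)" by (auto simp: sgn_if zero_le_mult_iff split: if_splits)
  also have "\<dots> = (\<Sum>m\<in>F. \<Sum>n\<in>F. a m * a n * (sgn (B E 0 0) * B E m n))"
    by (simp add: sum_distrib_left sum_distrib_right mult_ac)
  finally show ?thesis .
qed

end

section \<open>The spectral density of a periodic potential\<close>

text \<open>Under the substitution c = D E the spectral density on each band becomes this arcsine
  law times a Lagrange weight.\<close>

lemma arcsine_density:
  "(\<lambda>c. 1 / (pi * sqrt (4 - c\<^sup>2))) absolutely_integrable_on {-2<..<2::real}"
  "((\<lambda>c. 1 / (pi * sqrt (4 - c\<^sup>2))) has_integral 1) {-2<..<2::real}"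
proof -
  have "((\<lambda>c. 1 / (pi * sqrt (4 - c\<^sup>2))) has_integral (arcsin (2 / 2) / pi - arcsin (- 2 / 2) / pi)) {-2..2::real}"
  proof (rule fundamental_theorem_of_calculus_interior)
    show "continuous_on {- 2..2} (\<lambda>c. arcsin (c / 2) / pi)"
      by (intro continuous_intros) auto
    fix c :: real assume c: "c \<in> {- 2<..<2}"
    have "((\<lambda>c. arcsin (c / 2) / pi) has_real_derivative inverse (sqrt (1 - (c / 2)\<^sup>2)) * (1 / 2) / pi) (at c)"
      by (rule DERIV_cdivide, rule DERIV_chain2[OF DERIV_arcsin])
         (use c in \<open>auto intro!: derivative_eq_intros\<close>)
    also have "inverse (sqrt (1 - (c / 2)\<^sup>2)) * (1 / 2) / pi = 1 / (pi * sqrt (4 - c\<^sup>2))"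
    proof -
      have "sqrt (1 - (c / 2)\<^sup>2) = sqrt ((4 - c\<^sup>2) / 4)" by (simp add: field_simps power2_eq_square)
      also have "\<dots> = sqrt (4 - c\<^sup>2) / 2" by (simp add: real_sqrt_divide)
      finally show ?thesis by (simp add: field_simps)
    qed
    finally show "((\<lambda>c. arcsin (c / 2) / pi) has_vector_derivative 1 / (pi * sqrt (4 - c\<^sup>2))) (at c)"
      by (simp add: has_real_derivative_iff_has_vector_derivative)
  qed simp
  then have "((\<lambda>c. 1 / (pi * sqrt (4 - c\<^sup>2))) has_integral 1) {-2..2::real}"
    by simp
  then show 1: "((\<lambda>c. 1 / (pi * sqrt (4 - c\<^sup>2))) has_integral 1) {-2<..<2::real}"
    using has_integral_Icc_iff_Ioo by blast
  show "(\<lambda>c. 1 / (pi * sqrt (4 - c\<^sup>2))) absolutely_integrable_on {-2<..<2::real}"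
  proof (rule nonnegative_absolutely_integrable_1)
    fix c :: real assume "c \<in> {-2<..<2}"
    then have "c\<^sup>2 \<le> 4" using abs_le_square_iff[of c 2] by auto
    then show "0 \<le> 1 / (pi * sqrt (4 - c\<^sup>2))" by simp
  qed (use 1 in blast)
qed

context real_periodic_potential
begin

text \<open>Density of the spectral measure of the pair delta_m, delta_n, that is, the imaginary
  part of the Green function divided by pi. The sign factor makes the definite form
  positive.\<close>

definition kern where
  "kern m n E = (if E \<in> bands then sgn (B E 0 0) * B E m n / (2 * pi * sqrt (4 - (D E)\<^sup>2)) else 0)"

lemma poly_B: "poly (mono_form (pot_poly V) p m n) E = B E m n"
  by (simp add: mono_form_def poly_sol)

lemma continuous_B: "continuous_on S (\<lambda>E. B E m n)"
  unfolding poly_B[symmetric] by (intro continuous_intros)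

lemma kern_measurable [measurable]: "kern m n \<in> borel_measurable borel"
proof -
  have [measurable]: "(\<lambda>E. B E m n) \<in> borel_measurable borel" for m n
    by (intro borel_measurable_continuous_onI continuous_B)
  have [measurable]: "D \<in> borel_measurable borel"
    by (intro borel_measurable_continuous_onI continuous_D)
  have [measurable]: "bands \<in> sets borel" using open_bands by simp
  show ?thesis unfolding kern_def[abs_def] by measurable
qed

lemma kern_commute: "kern m n E = kern n m E"
  by (simp add: kern_def mono_form_commute[of _ p m n])

lemma bounded_bands: "bounded bands"
proof -
  obtain a P where aP: "disc (pot_poly V) p = pCons a P" by (metis pCons_cases)
  have "P \<noteq> 0" using degree_disc p aP by auto
  then obtain r where r: "\<And>z. r \<le> norm z \<Longrightarrow> 2 \<le> norm (poly (pCons a P) z)" using poly_infinity by blast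
  have "\<bar>E\<bar> \<le> r" if "E \<in> bands" for E
    using r[of E] that unfolding bands_def D_poly aP by (cases "r \<le> \<bar>E\<bar>") auto
  then show ?thesis by (auto simp: bounded_real)
qed

text \<open>Cauchy-Schwarz for a definite form reduces this to the diagonal bound.\<close>

lemma B_abs_le:
  assumes "E \<in> bands" shows "\<bar>B E m n\<bar> \<le> 2 * \<bar>D' E\<bar>"
proof -
  have "B E m m * B E n n - B E m n * B E m n \<ge> 0"
    using jac.mono_form_gram[of E m m n] four_minus_D[OF assms] unfolding D_def[symmetric]
    by (simp add: mult.assoc)
  then have "\<bar>B E m n\<bar>\<^sup>2 \<le> \<bar>B E m m\<bar> * \<bar>B E n n\<bar>"
    by (simp add: power2_eq_square abs_mult[symmetric])
  also have "\<dots> \<le> (2 * \<bar>D' E\<bar>)\<^sup>2"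
    unfolding power2_eq_square by (intro mult_mono B_diag_le assms) auto
  finally show ?thesis by (rule power2_le_imp_le) simp
qed

lemma kern_abs_le:
  assumes "E \<in> bands" shows "\<bar>kern m n E\<bar> \<le> \<bar>D' E\<bar> * (1 / (pi * sqrt (4 - (D E)\<^sup>2)))"
proof -
  have "\<bar>kern m n E\<bar> = \<bar>B E m n\<bar> / (2 * pi * sqrt (4 - (D E)\<^sup>2))"
    using assms B_nonzero[OF assms, of 0] four_minus_D[OF assms] by (simp add: kern_def abs_mult abs_sgn_eq)
  also have "\<dots> \<le> 2 * \<bar>D' E\<bar> / (2 * pi * sqrt (4 - (D E)\<^sup>2))"
    using four_minus_D[OF assms] by (intro divide_right_mono B_abs_le assms) auto
  finally show ?thesis by simp
qed

lemma kern_nonzero_eq: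
  assumes "E \<in> bands"
  shows "kern m n E = \<bar>D' E\<bar> * (B E m n / (2 * D' E) * (1 / (pi * sqrt (4 - (D E)\<^sup>2))))"
proof -
  have "\<bar>D' E\<bar> / D' E = sgn (B E 0 0)"
    using D'_abs(1)[OF assms] D'_nonzero[OF assms] by simp
  moreover have "\<bar>D' E\<bar> * (B E m n / (2 * D' E) * (1 / (pi * sqrt (4 - (D E)\<^sup>2))))
    = (\<bar>D' E\<bar> / D' E) * B E m n / (2 * pi * sqrt (4 - (D E)\<^sup>2))" by simp
  ultimately show ?thesis using assms by (simp add: kern_def)
qed

text \<open>Substitution c = D E on one band, with e the inverse branch. The kernel is dominated by
  the pulled-back arcsine density, which settles integrability.\<close>

lemma kern_band_integral:
  fixes m n :: int and a b :: real
  assumes ab: "{a<..<b} \<subseteq> bands" "inj_on D {a<..<b}" "D ` {a<..<b} = {-2<..<2}"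
    and inv: "\<And>c. c \<in> {-2<..<2} \<Longrightarrow> e c \<in> {a<..<b} \<and> D (e c) = c"
  defines "f \<equiv> \<lambda>c. B (e c) m n / (2 * D' (e c)) * (1 / (pi * sqrt (4 - c\<^sup>2)))"
  shows "kern m n absolutely_integrable_on {a<..<b}" "f absolutely_integrable_on {-2<..<2}"
    "integral {a<..<b} (kern m n) = integral {-2<..<2} f"
proof -
  have der: "(D has_field_derivative D' x) (at x within {a<..<b})" for x
    using DERIV_D by (rule has_field_derivative_at_within)
  have "(\<lambda>x. \<bar>D' x\<bar> * (1 / (pi * sqrt (4 - (D x)\<^sup>2)))) absolutely_integrable_on {a<..<b}"
    using absolutely_integrable_change_of_variables_1'[OF _ der ab(2), of "\<lambda>c. 1 / (pi * sqrt (4 - c\<^sup>2))"]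
      arcsine_density(1) unfolding ab(3) by simp
  then have "(\<lambda>x. \<bar>D' x\<bar> * (1 / (pi * sqrt (4 - (D x)\<^sup>2)))) integrable_on {a<..<b}"
    using set_lebesgue_integral_eq_integral(1) by blast
  then show 1: "kern m n absolutely_integrable_on {a<..<b}"
  proof (rule measurable_bounded_by_integrable_imp_absolutely_integrable[rotated 2])
    show "kern m n \<in> borel_measurable (lebesgue_on {a<..<b})"
      by (intro measurable_restrict_space1 measurable_completion) simp
    show "norm (kern m n x) \<le> \<bar>D' x\<bar> * (1 / (pi * sqrt (4 - (D x)\<^sup>2)))" if "x \<in> {a<..<b}" for x
      using kern_abs_le[of x m n] that ab by auto
  qed simp
  have eD: "e (D x) = x" if "x \<in> {a<..<b}" for x
  proof -
    have "D x \<in> {-2<..<2}" using imageI[OF that, of D] unfolding ab(3) .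
    from inv[OF this] show ?thesis using that by (auto intro: inj_onD[OF ab(2)] simp del: greaterThanLessThan_iff)
  qed
  have eq: "\<bar>D' x\<bar> * f (D x) = kern m n x" if "x \<in> {a<..<b}" for x
  proof -
    have "x \<in> bands" using that ab(1) by blast
    from kern_nonzero_eq[OF this, of m n] show ?thesis unfolding f_def eD[OF that] by (simp only:)
  qed
  have "(\<lambda>x. \<bar>D' x\<bar> * f (D x)) absolutely_integrable_on {a<..<b}"
    using 1 by (subst set_integrable_cong[OF refl refl eq]) auto
  moreover have "integral {a<..<b} (\<lambda>x. \<bar>D' x\<bar> * f (D x)) = integral {a<..<b} (kern m n)"
    by (intro integral_cong eq)
  ultimately have "f absolutely_integrable_on D ` {a<..<b} \<and> integral (D ` {a<..<b}) f = integral {a<..<b} (kern m n)"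
    using has_absolute_integral_change_of_variables_1'[OF _ der ab(2), of f "integral {a<..<b} (kern m n)"]
    by auto
  then show "f absolutely_integrable_on {-2<..<2}" "integral {a<..<b} (kern m n) = integral {-2<..<2} f"
    unfolding ab(3) by auto
qed

text \<open>Each band contains exactly one zero of D, so the zeros \<open>Z\<close> label the bands.
  After substitution on every band, the integrand at level c is a sum over all solutions of D = c,
  which \<open>band_lagrange\<close> evaluates.\<close>

lemma kern_integral_aux:
  assumes mn: "n \<le> m" "m < n + int p"
  shows "integrable lborel (kern m n) \<and> integral\<^sup>L lborel (kern m n) = (if m = n then 1 else 0)"
proof -
  define Z where "Z = {E. D E = 0}"
  have Z: "finite Z" "Z \<subseteq> bands" using card_roots(1)[of 0] by (auto simp: Z_def bands_def)
  define P where "P r u v \<longleftrightarrow> u < r \<and> r < v \<and> {u<..<v} \<subseteq> bands \<and> inj_on D {u..v} \<and> D ` {u<..<v} = {-2<..<2} \<and>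
    u \<notin> bands \<and> v \<notin> bands" for r u v
  have "\<forall>r\<in>Z. \<exists>uv. P r (fst uv) (snd uv)"
    using bands_interval_endpoints[OF bounded_bands] Z unfolding P_def fst_conv snd_conv split_paired_Ex by blast
  then obtain h where h: "\<And>r. r \<in> Z \<Longrightarrow> P r (fst (h r)) (snd (h r))" using bchoice by metis
  define a b where "a r = fst (h r)" and "b r = snd (h r)" for r
  have ab: "\<And>r. r \<in> Z \<Longrightarrow> a r < r" "\<And>r. r \<in> Z \<Longrightarrow> r < b r"
    "\<And>r. r \<in> Z \<Longrightarrow> {a r<..<b r} \<subseteq> bands" "\<And>r. r \<in> Z \<Longrightarrow> inj_on D {a r..b r}"
    "\<And>r. r \<in> Z \<Longrightarrow> D ` {a r<..<b r} = {-2<..<2}" "\<And>r. r \<in> Z \<Longrightarrow> a r \<notin> bands" "\<And>r. r \<in> Z \<Longrightarrow> b r \<notin> bands"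
    using h unfolding P_def a_def b_def by blast+
  define I where "I r = {a r<..<b r}" for r
  have inj: "inj_on D (I r)" if "r \<in> Z" for r
    using ab(4)[OF that] unfolding I_def by (rule inj_on_subset) auto
  \<comment> \<open>Two components with a common point coincide, because the ends of each lie
    outside the bands.\<close>
  have eqI: "u = u' \<and> v = v'" if "u < y" "y < v" "u' < y" "y < v'" "{u<..<v} \<subseteq> bands" "{u'<..<v'} \<subseteq> bands"
    "u \<notin> bands" "v \<notin> bands" "u' \<notin> bands" "v' \<notin> bands" for u v u' v' y
  proof -
    have "\<not> u < u'" "\<not> u' < u" "\<not> v < v'" "\<not> v' < v"
      using that by (auto simp: subset_iff)
    then show ?thesis by auto
  qed
  have disj: "I r \<inter> I s = {}" if rs: "r \<in> Z" "s \<in> Z" "r \<noteq> s" for r s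
  proof (rule ccontr)
    assume "I r \<inter> I s \<noteq> {}"
    then obtain y where "y \<in> I r" "y \<in> I s" by blast
    then have "a r = a s \<and> b r = b s"
      using ab rs unfolding I_def by (intro eqI[where y=y]) auto
    then have "s \<in> I r" "r \<in> I r"
      using ab(1)[of r] ab(2)[of r] ab(1)[of s] ab(2)[of s] rs by (auto simp: I_def)
    then have "r = s" using inj_onD[OF inj[OF rs(1)]] rs by (auto simp: Z_def)
    then show False using rs by simp
  qed
  have cover: "bands = (\<Union>r\<in>Z. I r)"
  proof (intro equalityI subsetI)
    fix E assume "E \<in> bands"
    from bands_interval_endpoints[OF bounded_bands this] obtain u v where uv: "u < E" "E < v" "{u<..<v} \<subseteq> bands"
      "D ` {u<..<v} = {-2<..<2}" "u \<notin> bands" "v \<notin> bands" by blast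
    have "0 \<in> D ` {u<..<v}" using uv(4) by simp
    then obtain r where r: "r \<in> {u<..<v}" "D r = 0" by auto
    then have rZ: "r \<in> Z" by (simp add: Z_def)
    have "u = a r \<and> v = b r"
      using uv r ab[OF rZ] by (intro eqI[where y=r]) auto
    then show "E \<in> (\<Union>r\<in>Z. I r)" using uv rZ by (auto simp: I_def)
  qed (use ab(3) in \<open>auto simp: I_def subset_iff\<close>)
  define e where "e r c = inv_into (I r) D c" for r c
  have e: "e r c \<in> I r \<and> D (e r c) = c" if "r \<in> Z" "c \<in> {-2<..<2}" for r c
    using that ab(5)[of r] unfolding e_def I_def by (metis f_inv_into_f inv_into_into)
  let ?\<phi> = "\<lambda>c. 1 / (pi * sqrt (4 - c\<^sup>2)) :: real"
  define f where "f r c = B (e r c) m n / (2 * D' (e r c)) * ?\<phi> c" for r c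
  have band: "kern m n absolutely_integrable_on I r" "f r absolutely_integrable_on {-2<..<2}"
    "integral (I r) (kern m n) = integral {-2<..<2} (f r)" if r: "r \<in> Z" for r
    using kern_band_integral[of "a r" "b r" "e r" m n] ab(3,5)[OF r] inj[OF r] e[OF r]
    unfolding f_def[abs_def] I_def by auto
  have sumf: "(\<Sum>r\<in>Z. f r c) = (if m = n then 1 else 0) * ?\<phi> c" if c: "c \<in> {-2<..<2}" for c
  proof -
    \<comment> \<open>The inverse branches, one for each band, enumerate the whole level
      set.\<close>
    have bij: "bij_betw (\<lambda>r. e r c) Z {E. D E = c}"
    proof (rule bij_betwI')
      fix r s assume rs: "r \<in> Z" "s \<in> Z"
      show "(e r c = e s c) = (r = s)"
      proof
        assume eq: "e r c = e s c"
        then have "e r c \<in> I r \<inter> I s" using e[OF rs(1) c] e[OF rs(2) c] by auto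
        then show "r = s" using disj[OF rs] by auto
      qed simp
    next
      fix r assume "r \<in> Z" then show "e r c \<in> {E. D E = c}" using e c by blast
    next
      fix E assume "E \<in> {E. D E = c}"
      then have E: "D E = c" "E \<in> bands" using c by (auto simp: bands_def)
      then obtain r where r: "r \<in> Z" "E \<in> I r" using cover by blast
      then have "E = e r c" using e[OF r(1) c] E inj_onD[OF inj[OF r(1)]] by auto
      then show "\<exists>r\<in>Z. E = e r c" using r by blast
    qed
    have "(\<Sum>r\<in>Z. f r c) = (\<Sum>r\<in>Z. B (e r c) m n / (2 * D' (e r c))) * ?\<phi> c"
      by (simp only: f_def sum_distrib_right)
    also have "(\<Sum>r\<in>Z. B (e r c) m n / (2 * D' (e r c))) = (\<Sum>E | D E = c. B E m n / (2 * D' E))"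
      by (rule sum.reindex_bij_betw[OF bij])
    also have "\<dots> = (if m = n then 1 else 0)" using c by (intro band_lagrange mn) auto
    finally show ?thesis .
  qed
  have Isets: "I r \<in> sets lebesgue" for r unfolding I_def by auto
  have ai: "kern m n absolutely_integrable_on bands"
    unfolding cover using Z band(1) Isets by (intro set_integrable_UN) auto
  have zero: "indicat_real bands x *\<^sub>R kern m n x = kern m n x" for x
    by (simp add: kern_def indicator_def)
  have int: "integrable lebesgue (kern m n)"
    using ai unfolding set_integrable_def zero .
  have "(LINT x:bands|lebesgue. kern m n x) = integral\<^sup>L lebesgue (kern m n)"
    unfolding set_lebesgue_integral_def zero by simp
  then have L: "integral\<^sup>L lebesgue (kern m n) = integral bands (kern m n)"
    using set_lebesgue_integral_eq_integral(2)[OF ai] by simp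
  have "(kern m n has_integral (\<Sum>r\<in>Z. integral (I r) (kern m n))) (\<Union>r\<in>Z. I r)"
  proof (rule has_integral_UN[OF Z(1)])
    show "(kern m n has_integral integral (I r) (kern m n)) (I r)" if "r \<in> Z" for r
      using set_lebesgue_integral_eq_integral(1)[OF band(1)[OF that]] by (rule integrable_integral)
    show "pairwise (\<lambda>i i'. negligible (I i \<inter> I i')) Z"
      using disj by (auto simp: pairwise_def)
  qed
  then have "integral bands (kern m n) = (\<Sum>r\<in>Z. integral (I r) (kern m n))"
    unfolding cover by (rule integral_unique)
  also have "\<dots> = (\<Sum>r\<in>Z. integral {-2<..<2} (f r))" using band(3) by simp
  also have "\<dots> = integral {-2<..<2} (\<lambda>c. \<Sum>r\<in>Z. f r c)"
    using set_lebesgue_integral_eq_integral(1)[OF band(2)] Z(1) by (subst integral_sum) auto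
  also have "\<dots> = integral {-2<..<2} (\<lambda>c. (if m = n then 1 else 0) * ?\<phi> c)"
    by (intro integral_cong sumf)
  also have "\<dots> = (if m = n then 1 else 0)" using integral_unique[OF arcsine_density(2)] by simp
  finally have val: "integral\<^sup>L lebesgue (kern m n) = (if m = n then 1 else 0)" using L by simp
  show ?thesis
    using int val integrable_completion[of "kern m n" lborel] integral_completion[of "kern m n" lborel] by simp
qed

lemma kern_sol:
  "kern (m + 1) n E + kern (m - 1) n E + V m * kern m n E = E * kern m n E"
proof (cases "E \<in> bands")
  case True
  have "B E (m + 1) n + B E (m - 1) n = (E - V m) * B E m n"
    using jac.jacobi_sol_mono_form[of E n] unfolding jacobi_sol_def by blast
  then have eq: "B E (m + 1) n = (E - V m) * B E m n - B E (m - 1) n" by simp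
  define k where "k = sgn (B E 0 0) / (2 * pi * sqrt (4 - (D E)\<^sup>2))"
  have "kern m n E = k * B E m n" for m n using True by (simp add: kern_def k_def)
  then show ?thesis by (simp only: eq) (simp add: algebra_simps)
qed (simp add: kern_def)

lemma kern_positive:
  assumes F: "finite F"
  shows "0 \<le> (\<Sum>m\<in>F. \<Sum>n\<in>F. a m * a n * kern m n E)"
proof (cases "E \<in> bands")
  case True
  have "(\<Sum>m\<in>F. \<Sum>n\<in>F. a m * a n * kern m n E)
     = (\<Sum>m\<in>F. \<Sum>n\<in>F. a m * a n * (sgn (B E 0 0) * B E m n)) / (2 * pi * sqrt (4 - (D E)\<^sup>2))"
    using True by (simp add: kern_def sum_divide_distrib)
  then show ?thesis using B_positive[OF True F, of a] four_minus_D[OF True] by simp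
qed (simp add: kern_def)

lemma real_periodic_multi: "real_periodic_potential V (Suc j * p)"
proof
  show "Suc j * p > 0" using p by simp
  show "V (n + int (Suc j * p)) = V n" for n
    using periodic_jacobi.periodic_multi[of V p j] per by (simp add: periodic_jacobi_def)
qed

lemma multi_period:
  fixes j :: nat
  defines "U \<equiv> \<lambda>E. continuant (\<lambda>_. D E) 0 (Suc j)"
  shows "mono_form (\<lambda>n. E - V n) (Suc j * p) m n = U E * B E m n"
    "4 - (real_periodic_potential.D V (Suc j * p) E)\<^sup>2 = (U E)\<^sup>2 * (4 - (D E)\<^sup>2)"
  using jac.mono_form_multi_period[of E j m n] jac.disc_multi_period[of E j]
  unfolding U_def real_periodic_potential.D_def[OF real_periodic_multi] D_def by simp_all

lemma bands_multi_period:
  "real_periodic_potential.bands V (Suc j * p) = {E \<in> bands. \<bar>real_periodic_potential.D V (Suc j * p) E\<bar> \<noteq> 2}"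
proof -
  interpret q: real_periodic_potential V "Suc j * p" by (rule real_periodic_multi)
  have sq: "\<bar>x\<bar> < 2 \<longleftrightarrow> 4 - x\<^sup>2 > 0" "\<bar>x\<bar> = 2 \<longleftrightarrow> 4 - x\<^sup>2 = 0" for x :: real
    using abs_square_less_1[of "x/2"] abs_square_eq_1[of "x / 2"] by (auto simp: power_divide abs_if)
  show ?thesis
    unfolding q.bands_def bands_def sq using multi_period(2)[where j=j]
    by (auto simp: zero_less_mult_iff)
qed

text \<open>The form gains the Chebyshev factor U and the square root gains |U|; the factor
  \<open>sgn (B E 0 0)\<close> absorbs the sign of U.\<close>

lemma kern_multi_period:
  assumes "\<bar>real_periodic_potential.D V (Suc j * p) E\<bar> \<noteq> 2"
  shows "real_periodic_potential.kern V (Suc j * p) m n E = kern m n E"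
proof -
  interpret q: real_periodic_potential V "Suc j * p" by (rule real_periodic_multi)
  have b: "E \<in> q.bands \<longleftrightarrow> E \<in> bands" using bands_multi_period[of j] assms by auto
  show ?thesis
  proof (cases "E \<in> bands")
    case True
    define U where "U = continuant (\<lambda>_. D E) 0 (Suc j)"
    have U: "4 - (q.D E)\<^sup>2 = U\<^sup>2 * (4 - (D E)\<^sup>2)" "q.B E m n = U * B E m n" "q.B E 0 0 = U * B E 0 0"
      unfolding U_def by (rule multi_period)+
    have "U \<noteq> 0" using U(1) q.four_minus_D[of E] b True by auto
    then have "U * sgn U = \<bar>U\<bar>" "\<bar>U\<bar> \<noteq> 0" by (simp add: abs_sgn, simp)
    have "q.kern m n E = (U * sgn U) * (sgn (B E 0 0) * B E m n) / (2 * pi * (\<bar>U\<bar> * sqrt (4 - (D E)\<^sup>2)))"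
      using b True unfolding q.kern_def U by (simp add: sgn_mult real_sqrt_mult mult_ac)
    also have "\<dots> = kern m n E"
      using True \<open>U * sgn U = \<bar>U\<bar>\<close> \<open>\<bar>U\<bar> \<noteq> 0\<close> unfolding kern_def by simp
    finally show ?thesis .
  qed (simp add: q.kern_def kern_def b del: mult_Suc)
qed

lemma finite_edges: "finite {E. \<bar>D E\<bar> = 2}"
proof -
  have "{E. \<bar>D E\<bar> = 2} = {E. D E = 2} \<union> {E. D E = -2}" by auto
  then show ?thesis using finite_level by simp
qed

lemma AE_not_edge: "AE E in lborel. \<bar>D E\<bar> \<noteq> 2"
proof (rule AE_I')
  show "{E. \<bar>D E\<bar> = 2} \<in> null_sets lborel"
    using finite_edges by (intro finite_imp_null_set_lborel)
qed auto

text \<open>Passing to a large multiple of the period removes the restriction |m - n| < p and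
  changes the kernel only on a null set.\<close>

lemma kern_integral:
  "integrable lborel (kern m n) \<and> integral\<^sup>L lborel (kern m n) = (if m = n then 1 else 0)"
proof -
  have 1: "integrable lborel (kern m n) \<and> integral\<^sup>L lborel (kern m n) = (if m = n then 1 else 0)" if "n \<le> m" for m n
  proof -
    define j where "j = nat (m - n)"
    interpret q: real_periodic_potential V "Suc j * p" by (rule real_periodic_multi)
    have "Suc j \<le> Suc j * p" using p by (cases p) auto
    then have "int (Suc j) \<le> int (Suc j * p)" by (simp only: of_nat_le_iff)
    moreover have "int j = m - n" using that by (simp add: j_def)
    ultimately have "m < n + int (Suc j * p)" by linarith
    then have q: "integrable lborel (q.kern m n) \<and> integral\<^sup>L lborel (q.kern m n) = (if m = n then 1 else 0)"
      by (intro q.kern_integral_aux that)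
    have ae: "AE E in lborel. q.kern m n E = kern m n E"
      using q.AE_not_edge by eventually_elim (rule kern_multi_period)
    have [measurable]: "q.kern m n \<in> borel_measurable lborel" "kern m n \<in> borel_measurable lborel" by (simp_all del: mult_Suc)
    show ?thesis using q integrable_cong_AE[OF _ _ ae] integral_cong_AE[OF _ _ ae] by (simp del: mult_Suc)
  qed
  have "kern m n = kern n m" using kern_commute by blast
  then show ?thesis using 1[of n m] 1[of m n] by (cases "n \<le> m") auto
qed

end

section \<open>The Hilbert space as a type, and the spectrum\<close>

lemma l2_sum_le:
  assumes "\<psi> \<in> l2" "finite F"
  shows "(\<Sum>n\<in>F. (cmod (\<psi> n))\<^sup>2) \<le> (\<Sum>\<^sub>\<infinity>n. (cmod (\<psi> n))\<^sup>2)"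
  using assms by (intro finite_sum_le_infsum) (auto simp: l2_def)

lemma l2I:
  assumes "\<And>F. finite F \<Longrightarrow> (\<Sum>n\<in>F. (cmod (\<psi> n))\<^sup>2) \<le> B"
  shows "\<psi> \<in> l2"
  unfolding l2_def mem_Collect_eq
  using assms by (intro nonneg_bdd_above_summable_on bdd_aboveI2[where M=B]) auto

lemma l2_inner_abs_summable:
  assumes "\<phi> \<in> l2" "\<psi> \<in> l2"
  shows "(\<lambda>n. norm (cnj (\<phi> n) * \<psi> n)) summable_on UNIV"
  using assms
  by (intro abs_summable_product[of "\<lambda>n. cnj (\<phi> n)" UNIV \<psi>]) (auto simp: l2_def norm_mult power2_eq_square)

lemma l2_inner_summable:
  assumes "\<phi> \<in> l2" "\<psi> \<in> l2"
  shows "(\<lambda>n. cnj (\<phi> n) * \<psi> n) summable_on UNIV"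
  using abs_summable_summable[OF l2_inner_abs_summable[OF assms]] .

lemma l2_zero: "(\<lambda>n. 0) \<in> l2"
  by (simp add: l2_def)

lemma l2_cmult: "\<psi> \<in> l2 \<Longrightarrow> (\<lambda>n. c * \<psi> n) \<in> l2"
  by (auto simp: l2_def norm_mult power_mult_distrib intro: summable_on_cmult_right)

lemma l2_mono:
  assumes "\<psi> \<in> l2" "\<And>n. cmod (\<phi> n) \<le> cmod (\<psi> n)"
  shows "\<phi> \<in> l2"
proof (rule l2I)
  fix F :: "int set" assume "finite F"
  have "(\<Sum>n\<in>F. (cmod (\<phi> n))\<^sup>2) \<le> (\<Sum>n\<in>F. (cmod (\<psi> n))\<^sup>2)"
    by (intro sum_mono power_mono assms(2)) auto
  also note l2_sum_le[OF assms(1) \<open>finite F\<close>]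
  finally show "(\<Sum>n\<in>F. (cmod (\<phi> n))\<^sup>2) \<le> (\<Sum>\<^sub>\<infinity>n. (cmod (\<psi> n))\<^sup>2)" .
qed

lemma l2_add:
  assumes "\<phi> \<in> l2" "\<psi> \<in> l2" shows "(\<lambda>n. \<phi> n + \<psi> n) \<in> l2"
proof (rule l2I)
  fix F :: "int set" assume F: "finite F"
  have "(cmod (\<phi> n + \<psi> n))\<^sup>2 \<le> 2 * (cmod (\<phi> n))\<^sup>2 + 2 * (cmod (\<psi> n))\<^sup>2" for n
  proof -
    have "(cmod (\<phi> n + \<psi> n))\<^sup>2 \<le> (cmod (\<phi> n) + cmod (\<psi> n))\<^sup>2"
      by (intro power_mono norm_triangle_ineq) auto
    also have "\<dots> \<le> 2 * (cmod (\<phi> n))\<^sup>2 + 2 * (cmod (\<psi> n))\<^sup>2"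
      using sum_squares_ge_zero[of "cmod (\<phi> n) - cmod (\<psi> n)" 0]
      by (simp add: power2_eq_square algebra_simps)
    finally show ?thesis .
  qed
  then have "(\<Sum>n\<in>F. (cmod (\<phi> n + \<psi> n))\<^sup>2) \<le> (\<Sum>n\<in>F. 2 * (cmod (\<phi> n))\<^sup>2 + 2 * (cmod (\<psi> n))\<^sup>2)"
    by (intro sum_mono)
  also have "\<dots> = 2 * (\<Sum>n\<in>F. (cmod (\<phi> n))\<^sup>2) + 2 * (\<Sum>n\<in>F. (cmod (\<psi> n))\<^sup>2)"
    by (simp add: sum.distrib sum_distrib_left)
  also have "\<dots> \<le> 2 * (\<Sum>\<^sub>\<infinity>n. (cmod (\<phi> n))\<^sup>2) + 2 * (\<Sum>\<^sub>\<infinity>n. (cmod (\<psi> n))\<^sup>2)"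
    using l2_sum_le[OF assms(1) F] l2_sum_le[OF assms(2) F] by linarith
  finally show "(\<Sum>n\<in>F. (cmod (\<phi> n + \<psi> n))\<^sup>2) \<le> 2 * (\<Sum>\<^sub>\<infinity>n. (cmod (\<phi> n))\<^sup>2) + 2 * (\<Sum>\<^sub>\<infinity>n. (cmod (\<psi> n))\<^sup>2)" .
qed

lemma l2_finite_support: "finite {n. \<psi> n \<noteq> 0} \<Longrightarrow> \<psi> \<in> l2"
  unfolding l2_def mem_Collect_eq
  by (subst summable_on_cong_neutral[where T="{n. \<psi> n \<noteq> 0}" and g="\<lambda>n. (cmod (\<psi> n))\<^sup>2"]) auto

lemma l2_shift: "\<psi> \<in> l2 \<Longrightarrow> (\<lambda>n. \<psi> (n + k)) \<in> l2"
  unfolding l2_def mem_Collect_eq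
  by (subst summable_on_reindex_bij_betw[where f="\<lambda>n. (cmod (\<psi> n))\<^sup>2"])
     (auto intro!: bij_betwI[where g="\<lambda>n. n - k"])

lemma l2_inner_cnj: "l2_inner \<phi> \<psi> = cnj (l2_inner \<psi> \<phi>)"
  unfolding l2_inner_def by (subst infsum_cnj[symmetric]) (simp add: mult.commute)

lemma l2_inner_self:
  assumes "\<psi> \<in> l2"
  shows "l2_inner \<psi> \<psi> = complex_of_real ((l2_norm \<psi>)\<^sup>2)"
proof -
  have "0 \<le> (\<Sum>\<^sub>\<infinity>n. (cmod (\<psi> n))\<^sup>2)" by (intro infsum_nonneg) auto
  then have "(l2_norm \<psi>)\<^sup>2 = (\<Sum>\<^sub>\<infinity>n. (cmod (\<psi> n))\<^sup>2)" by (simp add: l2_norm_def)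
  moreover have "complex_of_real (\<Sum>\<^sub>\<infinity>n. (cmod (\<psi> n))\<^sup>2) = (\<Sum>\<^sub>\<infinity>n. complex_of_real ((cmod (\<psi> n))\<^sup>2))"
    using assms has_sum_of_real[OF has_sum_infsum, of "\<lambda>n. (cmod (\<psi> n))\<^sup>2" UNIV]
    by (auto simp: l2_def intro!: infsumI[symmetric])
  ultimately show ?thesis
    unfolding l2_inner_def by (simp only: complex_norm_square) (simp add: mult.commute)
qed

lemma schroedinger_l2:
  assumes "\<psi> \<in> l2" shows "schroedinger V \<psi> \<in> l2"
proof -
  have "(\<lambda>n. complex_of_real (norm V) * \<psi> n) \<in> l2" by (rule l2_cmult[OF assms])
  then have "(\<lambda>n. complex_of_real (apply_bcontfun V n) * \<psi> n) \<in> l2"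
    using norm_bounded[of V] by (elim l2_mono) (auto simp: norm_mult intro!: mult_right_mono)
  with l2_shift[OF assms, of "-1"] l2_shift[OF assms, of 1] show ?thesis
    unfolding schroedinger_def by (auto intro!: l2_add)
qed

lemma l2_inner_add_right:
  assumes "\<phi> \<in> l2" "\<psi> \<in> l2" "\<xi> \<in> l2"
  shows "l2_inner \<phi> (\<lambda>n. \<psi> n + \<xi> n) = l2_inner \<phi> \<psi> + l2_inner \<phi> \<xi>"
  unfolding l2_inner_def
  by (subst infsum_add[symmetric]) (auto intro!: l2_inner_summable assms simp: ring_distribs)

lemma l2_inner_cmult_right:
  "l2_inner \<phi> (\<lambda>n. c * \<psi> n) = c * l2_inner \<phi> \<psi>"
  unfolding l2_inner_def
  by (subst infsum_cmult_right'[symmetric]) (auto simp: mult_ac)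

lemma l2_inner_add_left:
  assumes "\<phi> \<in> l2" "\<psi> \<in> l2" "\<xi> \<in> l2"
  shows "l2_inner (\<lambda>n. \<psi> n + \<xi> n) \<phi> = l2_inner \<psi> \<phi> + l2_inner \<xi> \<phi>"
  by (subst (1 2 3) l2_inner_cnj) (simp add: l2_inner_add_right assms)

lemma schroedinger_symmetric:
  assumes "\<phi> \<in> l2" "\<psi> \<in> l2"
  shows "l2_inner (schroedinger V \<phi>) \<psi> = l2_inner \<phi> (schroedinger V \<psi>)"
proof -
  let ?V = "\<lambda>n. complex_of_real (apply_bcontfun V n)"
  have V: "(\<lambda>n. ?V n * \<xi> n) \<in> l2" if "\<xi> \<in> l2" for \<xi>
  proof -
    have "(\<lambda>n. complex_of_real (norm V) * \<xi> n) \<in> l2" by (rule l2_cmult[OF that])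
    then show ?thesis
      using norm_bounded[of V] by (elim l2_mono) (auto simp: norm_mult intro!: mult_right_mono)
  qed
  have s: "(\<lambda>n. \<xi> (n + 1)) \<in> l2" "(\<lambda>n. \<xi> (n - 1)) \<in> l2" if "\<xi> \<in> l2" for \<xi>
    using l2_shift[OF that, of 1] l2_shift[OF that, of "-1"] by auto
  have sh: "l2_inner (\<lambda>n. \<phi> (n - 1)) \<psi> = l2_inner \<phi> (\<lambda>n. \<psi> (n + 1))" for \<phi> \<psi>
    unfolding l2_inner_def
    by (subst infsum_reindex_bij_betw[of "\<lambda>n. n + 1" UNIV UNIV, symmetric])
       (auto intro!: bij_betwI[where g="\<lambda>n. n - 1"])
  have sh2: "l2_inner (\<lambda>n. \<phi> (n + 1)) \<psi> = l2_inner \<phi> (\<lambda>n. \<psi> (n - 1))"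
    by (subst (1 2) l2_inner_cnj) (simp add: sh)
  have v: "l2_inner (\<lambda>n. ?V n * \<phi> n) \<psi> = l2_inner \<phi> (\<lambda>n. ?V n * \<psi> n)"
    unfolding l2_inner_def by (simp add: mult_ac)
  show ?thesis
    unfolding schroedinger_def
    by (simp add: l2_inner_add_left l2_inner_add_right l2_add V s assms sh sh2 v)
qed

section \<open>Square-summable sequences as a complete inner product space\<close>

typedef ell2 = l2 morphisms coord Ell2
  using l2_zero by blast

lemma coord_Ell2 [simp]: "f \<in> l2 \<Longrightarrow> coord (Ell2 f) = f"
  by (rule Ell2_inverse)

lemma coord_l2 [simp, intro]: "coord x \<in> l2"
  by (rule coord)

lemma ell2_eqI: "(\<And>n. coord x n = coord y n) \<Longrightarrow> x = y"
  by (metis coord_inject ext)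

text \<open>The real part of the complex inner product has the same norm, and the energies and
  moments that occur are real, so a real structure is enough. Completeness then makes the Banach
  fixed point theorem available.\<close>

instantiation ell2 :: real_inner
begin

definition "0 = Ell2 (\<lambda>n. 0)"
definition "x + y = Ell2 (\<lambda>n. coord x n + coord y n)"
definition "x - y = Ell2 (\<lambda>n. coord x n + (-1) * coord y n)"
definition "- x = Ell2 (\<lambda>n. (-1) * coord x n)"
definition "scaleR r x = Ell2 (\<lambda>n. complex_of_real r * coord x n)"
definition "inner x y = Re (l2_inner (coord x) (coord y))"
definition "norm (x::ell2) = sqrt (inner x x)"
definition "dist (x::ell2) y = norm (x - y)"
definition "sgn (x::ell2) = scaleR (inverse (norm x)) x"
definition "(uniformity :: (ell2 \<times> ell2) filter) = (INF e\<in>{0 <..}. principal {(x, y). dist x y < e})"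
definition "open (U :: ell2 set) \<longleftrightarrow> (\<forall>x\<in>U. eventually (\<lambda>(x', y). x' = x \<longrightarrow> y \<in> U) uniformity)"

lemma coord_simps [simp]:
  "coord 0 = (\<lambda>n. 0)"
  "coord (x + y) = (\<lambda>n. coord x n + coord y n)"
  "coord (x - y) = (\<lambda>n. coord x n - coord y n)"
  "coord (- x) = (\<lambda>n. - coord x n)"
  "coord (scaleR r x) = (\<lambda>n. complex_of_real r * coord x n)"
proof -
  show "coord 0 = (\<lambda>n. 0)" unfolding zero_ell2_def by (rule coord_Ell2[OF l2_zero])
  show "coord (x + y) = (\<lambda>n. coord x n + coord y n)" unfolding plus_ell2_def by (simp add: l2_add)
  show "coord (x - y) = (\<lambda>n. coord x n - coord y n)" unfolding minus_ell2_def
    by (subst coord_Ell2[OF l2_add[OF coord_l2 l2_cmult[OF coord_l2]]]) simp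
  show "coord (- x) = (\<lambda>n. - coord x n)" unfolding uminus_ell2_def
    by (subst coord_Ell2[OF l2_cmult[OF coord_l2]]) simp
  show "coord (scaleR r x) = (\<lambda>n. complex_of_real r * coord x n)" unfolding scaleR_ell2_def
    by (rule coord_Ell2[OF l2_cmult[OF coord_l2]])
qed

instance
proof
  fix x y z :: ell2 and r s :: real
  show "x + y + z = x + (y + z)" "x + y = y + x" "0 + x = x" "- x + x = 0" "x - y = x + - y"
    "r *\<^sub>R (x + y) = r *\<^sub>R x + r *\<^sub>R y" "(r + s) *\<^sub>R x = r *\<^sub>R x + s *\<^sub>R x"
    "r *\<^sub>R s *\<^sub>R x = (r * s) *\<^sub>R x" "1 *\<^sub>R x = x"
    by (auto intro!: ell2_eqI simp: algebra_simps)
  show "inner x y = inner y x"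
    unfolding inner_ell2_def by (subst l2_inner_cnj) simp
  show "inner (x + y) z = inner x z + inner y z"
    unfolding inner_ell2_def by (simp add: l2_inner_add_left)
  show "inner (r *\<^sub>R x) y = r * inner x y"
    unfolding inner_ell2_def by (subst (1 2) l2_inner_cnj) (simp add: l2_inner_cmult_right)
  show "0 \<le> inner x x" unfolding inner_ell2_def by (simp add: l2_inner_self)
  show "inner x x = 0 \<longleftrightarrow> x = 0"
  proof
    assume "inner x x = 0"
    then have "l2_norm (coord x) = 0" unfolding inner_ell2_def by (simp add: l2_inner_self)
    then have z: "(\<Sum>\<^sub>\<infinity>n. (cmod (coord x n))\<^sup>2) = 0" by (simp add: l2_norm_def)
    have "coord x n = 0" for n
    proof -
      have "(\<Sum>n\<in>{n}. (cmod (coord x n))\<^sup>2) \<le> (\<Sum>\<^sub>\<infinity>n. (cmod (coord x n))\<^sup>2)"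
        using coord_l2[of x] by (intro finite_sum_le_infsum) (auto simp: l2_def)
      then show ?thesis using z by simp
    qed
    then show "x = 0" by (intro ell2_eqI) simp
  next
    assume "x = 0" then show "inner x x = 0" by (simp add: inner_ell2_def l2_inner_def)
  qed
qed (simp_all add: norm_ell2_def dist_ell2_def sgn_ell2_def uniformity_ell2_def open_ell2_def)

end

lemma norm_ell2: "norm x = l2_norm (coord x)"
proof -
  have "0 \<le> l2_norm (coord x)" by (simp add: l2_norm_def infsum_nonneg)
  then show ?thesis by (simp add: norm_ell2_def inner_ell2_def l2_inner_self)
qed

lemma norm_ell2_sq: "(norm x)\<^sup>2 = (\<Sum>\<^sub>\<infinity>n. (cmod (coord x n))\<^sup>2)"
  unfolding norm_ell2 l2_norm_def by (simp add: infsum_nonneg)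

lemma sum_le_norm_ell2:
  assumes "finite F" shows "(\<Sum>n\<in>F. (cmod (coord x n))\<^sup>2) \<le> (norm x)\<^sup>2"
  unfolding norm_ell2_sq using coord_l2[of x] assms
  by (intro finite_sum_le_infsum) (auto simp: l2_def)

lemma norm_ell2_le:
  assumes "\<And>F. finite F \<Longrightarrow> (\<Sum>n\<in>F. (cmod (coord x n))\<^sup>2) \<le> B\<^sup>2" "B \<ge> 0"
  shows "norm x \<le> B"
proof -
  have "(norm x)\<^sup>2 \<le> B\<^sup>2" unfolding norm_ell2_sq
    using coord_l2[of x] assms by (intro infsum_le_finite_sums) (auto simp: l2_def)
  then show ?thesis using assms(2) by (rule power2_le_imp_le)
qed

lemma coord_le_norm: "cmod (coord x n) \<le> norm x"
  using sum_le_norm_ell2[of "{n}" x] by (simp add: power2_le_iff_abs_le)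

instance ell2 :: complete_space
proof
  fix X :: "nat \<Rightarrow> ell2" assume X: "Cauchy X"
  have "Cauchy (\<lambda>k. coord (X k) n)" for n
  proof (rule metric_CauchyI)
    fix e :: real assume "e > 0"
    then obtain M where M: "\<And>i j. i \<ge> M \<Longrightarrow> j \<ge> M \<Longrightarrow> dist (X i) (X j) < e"
      using metric_CauchyD[OF X] by blast
    show "\<exists>M. \<forall>i\<ge>M. \<forall>j\<ge>M. dist (coord (X i) n) (coord (X j) n) < e"
    proof (intro exI allI impI)
      fix i j assume "i \<ge> M" "j \<ge> M"
      then have "norm (X i - X j) < e" using M by (simp add: dist_norm)
      then show "dist (coord (X i) n) (coord (X j) n) < e"
        using coord_le_norm[of "X i - X j" n] by (simp add: dist_norm)
    qed
  qed
  then have "\<forall>n. \<exists>l. (\<lambda>k. coord (X k) n) \<longlonglongrightarrow> l" using Cauchy_convergent convergent_def by blast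
  then obtain f where f: "\<And>n. (\<lambda>k. coord (X k) n) \<longlonglongrightarrow> f n" by metis
  have *: "\<exists>M. \<forall>i\<ge>M. \<forall>F. finite F \<longrightarrow> (\<Sum>n\<in>F. (cmod (coord (X i) n - f n))\<^sup>2) \<le> e\<^sup>2" if "e > 0" for e :: real
  proof -
    obtain M where M: "\<And>i j. i \<ge> M \<Longrightarrow> j \<ge> M \<Longrightarrow> dist (X i) (X j) < e"
      using metric_CauchyD[OF X \<open>e > 0\<close>] by blast
    have "(\<Sum>n\<in>F. (cmod (coord (X i) n - f n))\<^sup>2) \<le> e\<^sup>2" if i: "i \<ge> M" and F: "finite F" for i F
    proof (rule LIMSEQ_le_const2)
      show "(\<lambda>j. \<Sum>n\<in>F. (cmod (coord (X i) n - coord (X j) n))\<^sup>2) \<longlonglongrightarrow> (\<Sum>n\<in>F. (cmod (coord (X i) n - f n))\<^sup>2)"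
        by (intro tendsto_intros f)
      have "(\<Sum>n\<in>F. (cmod (coord (X i) n - coord (X j) n))\<^sup>2) \<le> e\<^sup>2" if "j \<ge> M" for j
      proof -
        have "(\<Sum>n\<in>F. (cmod (coord (X i) n - coord (X j) n))\<^sup>2) \<le> (norm (X i - X j))\<^sup>2"
          using sum_le_norm_ell2[OF F, of "X i - X j"] by simp
        also have "\<dots> \<le> e\<^sup>2"
          using M[OF i that] by (intro power_mono) (auto simp: dist_norm)
        finally show ?thesis .
      qed
      then show "\<exists>N. \<forall>j\<ge>N. (\<Sum>n\<in>F. (cmod (coord (X i) n - coord (X j) n))\<^sup>2) \<le> e\<^sup>2" by blast
    qed
    then show ?thesis by blast
  qed
  obtain M where M: "\<forall>i\<ge>M. \<forall>F. finite F \<longrightarrow> (\<Sum>n\<in>F. (cmod (coord (X i) n - f n))\<^sup>2) \<le> 1\<^sup>2"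
    using *[of 1] by auto
  have "(\<lambda>n. coord (X M) n - f n) \<in> l2" using M by (intro l2I[where B="1\<^sup>2"]) auto
  then have "(\<lambda>n. coord (X M) n + (-1) * (coord (X M) n - f n)) \<in> l2"
    by (intro l2_add l2_cmult) auto
  then have fl: "f \<in> l2" by (simp add: algebra_simps)
  have "X \<longlonglongrightarrow> Ell2 f"
  proof (rule metric_LIMSEQ_I)
    fix e :: real assume "e > 0"
    then obtain N where N: "\<And>i F. i \<ge> N \<Longrightarrow> finite F \<Longrightarrow> (\<Sum>n\<in>F. (cmod (coord (X i) n - f n))\<^sup>2) \<le> (e/2)\<^sup>2"
      using *[of "e/2"] by auto
    have "dist (X i) (Ell2 f) < e" if "i \<ge> N" for i
    proof -
      have "norm (X i - Ell2 f) \<le> e/2"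
        using N[OF that] \<open>e > 0\<close> fl by (intro norm_ell2_le) auto
      then show ?thesis using \<open>e > 0\<close> by (simp add: dist_norm)
    qed
    then show "\<exists>N. \<forall>i\<ge>N. dist (X i) (Ell2 f) < e" by blast
  qed
  then show "convergent X" by (auto simp: convergent_def)
qed

section \<open>The operator on this space, and its spectrum in terms of lower bounds\<close>

definition ham :: "(int \<Rightarrow>\<^sub>C real) \<Rightarrow> ell2 \<Rightarrow> ell2" where
  "ham V x = Ell2 (schroedinger V (coord x))"

lemma coord_ham [simp]: "coord (ham V x) = schroedinger V (coord x)"
  by (simp add: ham_def schroedinger_l2)

lemma norm_shift:
  assumes "\<And>n. coord y n = coord x (n + k)" shows "norm y = norm x"
proof -
  have "(\<Sum>\<^sub>\<infinity>n. (cmod (coord x (n + k)))\<^sup>2) = (\<Sum>\<^sub>\<infinity>n. (cmod (coord x n))\<^sup>2)"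
    by (subst infsum_reindex_bij_betw[where f="\<lambda>n. (cmod (coord x n))\<^sup>2"])
       (auto intro!: bij_betwI[where g="\<lambda>n. n - k"])
  then show ?thesis unfolding norm_ell2 l2_norm_def assms by simp
qed

lemma norm_multiplier:
  assumes "\<And>n. cmod (coord y n) \<le> B * cmod (coord x n)" "B \<ge> 0" shows "norm y \<le> B * norm x"
proof (rule norm_ell2_le)
  fix F :: "int set" assume F: "finite F"
  have "(\<Sum>n\<in>F. (cmod (coord y n))\<^sup>2) \<le> (\<Sum>n\<in>F. (B * cmod (coord x n))\<^sup>2)"
    by (intro sum_mono power_mono assms) auto
  also have "\<dots> = B\<^sup>2 * (\<Sum>n\<in>F. (cmod (coord x n))\<^sup>2)" by (simp add: power_mult_distrib sum_distrib_left)
  also have "\<dots> \<le> B\<^sup>2 * (norm x)\<^sup>2" by (intro mult_left_mono sum_le_norm_ell2 F) auto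
  finally show "(\<Sum>n\<in>F. (cmod (coord y n))\<^sup>2) \<le> (B * norm x)\<^sup>2" by (simp add: power_mult_distrib)
qed (use assms in auto)

lemma ham_add: "ham V (x + y) = ham V x + ham V y"
  and ham_diff: "ham V (x - y) = ham V x - ham V y"
  and ham_scaleR: "ham V (r *\<^sub>R x) = r *\<^sub>R ham V x"
  by (auto intro!: ell2_eqI simp: schroedinger_def algebra_simps)

lemma ham_perturb: "norm (ham V x - ham W x) \<le> dist V W * norm x"
  using dist_bounded[of V _ W]
  by (intro norm_multiplier)
     (auto simp: schroedinger_def dist_norm norm_mult simp flip: left_diff_distrib of_real_diff
           intro!: mult_right_mono)

lemma ham_le: "norm (ham V x) \<le> (2 + norm V) * norm x"
proof -
  define a b c where "a = Ell2 (\<lambda>n. coord x (n + (-1)))" and "b = Ell2 (\<lambda>n. coord x (n + 1))"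
    and "c = ham V x - a - b"
  have a: "coord a = (\<lambda>n. coord x (n + (-1)))" and b: "coord b = (\<lambda>n. coord x (n + 1))"
    unfolding a_def b_def using l2_shift[OF coord_l2, of x "-1"] l2_shift[OF coord_l2, of x 1] by auto
  have "norm a = norm x" by (rule norm_shift[where k="-1"]) (simp add: a)
  moreover have "norm b = norm x" by (rule norm_shift[where k=1]) (simp add: b)
  moreover have "norm c \<le> norm V * norm x"
    using norm_bounded[of V] by (intro norm_multiplier) (auto simp: c_def a b schroedinger_def norm_mult intro!: mult_right_mono)
  moreover have "ham V x = a + b + c" by (simp add: c_def)
  ultimately show ?thesis
    using norm_triangle_ineq[of "a+b" c] norm_triangle_ineq[of a b] by (simp add: algebra_simps)
qed

lemma ham_symmetric: "inner (ham V x) y = inner x (ham V y)"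
  by (simp add: inner_ell2_def schroedinger_symmetric)

text \<open>Since \<open>H - E\<close> is self-adjoint, an a priori lower bound suffices for invertibility.\<close>

definition bounded_below :: "(int \<Rightarrow>\<^sub>C real) \<Rightarrow> real \<Rightarrow> real \<Rightarrow> bool" where
  "bounded_below V E c \<longleftrightarrow> (\<forall>x. c * norm x \<le> norm (ham V x - E *\<^sub>R x))"

text \<open>With T = H - E, the equation T (T x) = y is solved as a fixed point of x - t (T (T x) -
  y), a contraction because T is symmetric and bounded below. Then T x is the preimage of y.\<close>

lemma bounded_below_surj:
  assumes c: "c > 0" and bb: "bounded_below V E c"
  shows "\<exists>x. ham V x - E *\<^sub>R x = y"
proof -
  define T where "T x = ham V x - E *\<^sub>R x" for x
  define A where "A x = T (T x)" for x
  have T_diff: "T (x - z) = T x - T z" for x z by (simp add: T_def ham_diff algebra_simps)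
  have T_sym: "inner (T x) z = inner x (T z)" for x z
    by (simp add: T_def ham_symmetric inner_diff_left inner_diff_right)
  define B where "B = 2 + norm V + \<bar>E\<bar> + c"
  have B: "norm (T x) \<le> B * norm x" for x
  proof -
    have "norm (T x) \<le> norm (ham V x) + \<bar>E\<bar> * norm x"
      unfolding T_def using norm_triangle_ineq4[of "ham V x" "E *\<^sub>R x"] by simp
    also have "\<dots> \<le> (2 + norm V) * norm x + \<bar>E\<bar> * norm x" using ham_le[of V x] by simp
    also have "\<dots> \<le> B * norm x" using c by (simp add: B_def algebra_simps)
    finally show ?thesis .
  qed
  have Bc: "B > 0" "c \<le> B" using c by (auto simp: B_def add_pos_nonneg add_nonneg_pos)
  \<comment> \<open>This t minimizes the bound 1 - 2 t c^2 + t^2 B^4 on the squared contraction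
    factor, and q is the minimum. The summand c in B gives c <= B, hence q >= 0.\<close>
  define t where "t = c\<^sup>2 / B^4"
  define q where "q = 1 - c^4 / B^4"
  have cB: "c^4 \<le> B^4" using Bc c by (intro power_mono) auto
  have q: "0 \<le> q" "q < 1" using cB c Bc by (auto simp: q_def)
  have contr: "(norm (x - t *\<^sub>R A x))\<^sup>2 \<le> q * (norm x)\<^sup>2" for x
  proof -
    have "(norm (x - t *\<^sub>R A x))\<^sup>2 = (norm x)\<^sup>2 - 2 * t * (norm (T x))\<^sup>2 + t\<^sup>2 * (norm (A x))\<^sup>2"
    proof -
      have "inner x (A x) = (norm (T x))\<^sup>2" "inner (A x) x = (norm (T x))\<^sup>2"
        unfolding A_def power2_norm_eq_inner by (simp_all only: T_sym[of x] T_sym[of "T x" x])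
      then show ?thesis
        unfolding power2_norm_eq_inner[of "x - t *\<^sub>R A x"]
        by (simp add: inner_diff_left inner_diff_right power2_norm_eq_inner[of x] power2_norm_eq_inner[of "A x"])
          (simp add: power2_eq_square algebra_simps)
    qed
    moreover have "c\<^sup>2 * (norm x)\<^sup>2 \<le> (norm (T x))\<^sup>2"
      using bb c unfolding bounded_below_def T_def[symmetric]
      by (metis less_eq_real_def mult_nonneg_nonneg norm_ge_zero power_mono power_mult_distrib)
    moreover have "(norm (A x))\<^sup>2 \<le> (B\<^sup>2 * norm x)\<^sup>2"
    proof -
      have "norm (A x) \<le> B * (B * norm x)"
        unfolding A_def using B[of "T x"] B[of x] Bc by (meson mult_left_mono order_trans less_imp_le)
      then show ?thesis by (intro power_mono) (auto simp: power2_eq_square mult_ac)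
    qed
    ultimately have "(norm (x - t *\<^sub>R A x))\<^sup>2 \<le> (norm x)\<^sup>2 - 2 * t * (c\<^sup>2 * (norm x)\<^sup>2) + t\<^sup>2 * (B\<^sup>2 * norm x)\<^sup>2"
      using Bc c unfolding t_def by (smt (verit) divide_nonneg_pos mult_left_mono zero_le_power2 zero_less_power)
    also have "\<dots> = q * (norm x)\<^sup>2"
      using Bc unfolding t_def q_def by (simp add: field_simps power2_eq_square power4_eq_xxxx)
    finally show ?thesis .
  qed
  have contr': "norm (x - t *\<^sub>R A x) \<le> sqrt q * norm x" for x
    using real_sqrt_le_mono[OF contr[of x]] by (simp add: real_sqrt_mult)
  have "\<exists>!x. (\<lambda>x. x - t *\<^sub>R (A x - y)) x = x"
  proof (rule banach_fix_type)
    show "0 \<le> sqrt q" "sqrt q < 1" using q by auto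
    show "\<forall>x z. dist (x - t *\<^sub>R (A x - y)) (z - t *\<^sub>R (A z - y)) \<le> sqrt q * dist x z"
    proof (intro allI)
      fix x z
      have "x - t *\<^sub>R (A x - y) - (z - t *\<^sub>R (A z - y)) = (x - z) - t *\<^sub>R A (x - z)"
        by (simp add: A_def T_diff algebra_simps)
      then show "dist (x - t *\<^sub>R (A x - y)) (z - t *\<^sub>R (A z - y)) \<le> sqrt q * dist x z"
        unfolding dist_norm by (metis contr')
    qed
  qed
  then obtain x where "x - t *\<^sub>R (A x - y) = x" by auto
  then have "t *\<^sub>R (A x - y) = 0" by simp
  moreover have "t \<noteq> 0" using c Bc by (simp add: t_def)
  ultimately have "T (T x) = y" by (simp add: A_def)
  then show ?thesis by (auto simp: T_def)
qed

text \<open>A bound C on the inverse becomes c = 1 / max C 1, the maximum keeping it positive.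
  Conversely a lower bound gives injectivity directly and surjectivity by
  \<open>bounded_below_surj\<close>.\<close>

lemma schroedinger_spectrum_iff:
  "E \<notin> schroedinger_spectrum V \<longleftrightarrow> (\<exists>c>0. bounded_below V E c)"
proof -
  let ?S = "\<lambda>\<psi> n. schroedinger V \<psi> n - complex_of_real E * \<psi> n"
  have co: "coord (ham V x - E *\<^sub>R x) = ?S (coord x)" for x by simp
  have mem: "?S \<psi> \<in> l2" if "\<psi> \<in> l2" for \<psi>
    using coord_l2[of "ham V (Ell2 \<psi>) - E *\<^sub>R (Ell2 \<psi>)"] that unfolding co by simp
  have bbC: "bounded_below V E c \<longleftrightarrow> (\<forall>\<psi>\<in>l2. c * l2_norm \<psi> \<le> l2_norm (?S \<psi>))" for c
  proof
    assume "bounded_below V E c"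
    then show "\<forall>\<psi>\<in>l2. c * l2_norm \<psi> \<le> l2_norm (?S \<psi>)"
      unfolding bounded_below_def norm_ell2 co by (metis coord_Ell2)
  qed (auto simp: bounded_below_def norm_ell2 co)
  have "E \<notin> schroedinger_spectrum V \<longleftrightarrow> bij_betw ?S l2 l2 \<and> (\<exists>C. \<forall>\<psi>\<in>l2. l2_norm \<psi> \<le> C * l2_norm (?S \<psi>))"
    by (simp add: schroedinger_spectrum_def spectrum_def resolvent_set_def)
  also have "\<dots> \<longleftrightarrow> (\<exists>c>0. bounded_below V E c)"
  proof
    assume "bij_betw ?S l2 l2 \<and> (\<exists>C. \<forall>\<psi>\<in>l2. l2_norm \<psi> \<le> C * l2_norm (?S \<psi>))"
    then obtain C where C: "\<And>\<psi>. \<psi>\<in>l2 \<Longrightarrow> l2_norm \<psi> \<le> C * l2_norm (?S \<psi>)" by blast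
    have "1 / max C 1 * l2_norm \<psi> \<le> l2_norm (?S \<psi>)" if "\<psi> \<in> l2" for \<psi>
    proof -
      have "0 \<le> l2_norm (?S \<psi>)" by (simp add: l2_norm_def infsum_nonneg)
      then have "l2_norm \<psi> \<le> max C 1 * l2_norm (?S \<psi>)"
        using C[OF that] mult_right_mono[of C "max C 1" "l2_norm (?S \<psi>)"] by linarith
      then show ?thesis by (simp add: field_simps)
    qed
    then show "\<exists>c>0. bounded_below V E c" unfolding bbC by (intro exI[of _ "1 / max C 1"]) auto
  next
    assume "\<exists>c>0. bounded_below V E c"
    then obtain c where c: "c > 0" "bounded_below V E c" by blast
    have "bij_betw ?S l2 l2"
    proof (rule bij_betwI')
      fix \<phi> \<psi> assume "\<phi> \<in> l2" "\<psi> \<in> l2"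
      define x y where "x = Ell2 \<phi>" and "y = Ell2 \<psi>"
      have xy: "coord x = \<phi>" "coord y = \<psi>" using \<open>\<phi> \<in> l2\<close> \<open>\<psi> \<in> l2\<close> by (auto simp: x_def y_def)
      show "(?S \<phi> = ?S \<psi>) = (\<phi> = \<psi>)"
      proof
        assume "?S \<phi> = ?S \<psi>"
        then have "ham V x - E *\<^sub>R x = ham V y - E *\<^sub>R y"
          by (intro iffD1[OF coord_inject]) (simp only: co xy)
        then have "ham V (x - y) - E *\<^sub>R (x - y) = 0" by (simp add: ham_diff algebra_simps)
        then have "c * norm (x - y) \<le> 0" using c(2) unfolding bounded_below_def by (metis norm_zero)
        then have "norm (x - y) \<le> 0" using c(1) by (simp add: mult_le_0_iff)
        then have "x = y" by simp
        then show "\<phi> = \<psi>" using xy by simp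
      qed simp
    next
      fix \<psi> assume "\<psi> \<in> l2" then show "?S \<psi> \<in> l2" by (rule mem)
    next
      fix \<phi> assume "\<phi> \<in> l2"
      obtain x where "ham V x - E *\<^sub>R x = Ell2 \<phi>" using bounded_below_surj[OF c] by blast
      then have "?S (coord x) = \<phi>" using co[of x] \<open>\<phi> \<in> l2\<close> by simp
      then show "\<exists>\<psi>\<in>l2. \<phi> = ?S \<psi>" using coord_l2 by metis
    qed
    moreover have "\<forall>\<psi>\<in>l2. l2_norm \<psi> \<le> 1 / c * l2_norm (?S \<psi>)"
      using c bbC[of c] by (auto simp: field_simps)
    ultimately show "bij_betw ?S l2 l2 \<and> (\<exists>C. \<forall>\<psi>\<in>l2. l2_norm \<psi> \<le> C * l2_norm (?S \<psi>))" by blast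
  qed
  finally show ?thesis .
qed

text \<open>Stability of the resolvent set in potential and energy at once; all comparisons between
  a stage and the limit go through this.\<close>

lemma bounded_below_perturb:
  assumes "bounded_below V E c" shows "bounded_below W F (c - dist V W - \<bar>E - F\<bar>)"
  unfolding bounded_below_def
proof
  fix x
  have tri: "norm (a + b - c) \<le> norm a + norm b + norm c" for a b c :: ell2
    using norm_triangle_ineq4[of "a + b" c] norm_triangle_ineq[of a b] by linarith
  have "ham V x - E *\<^sub>R x = (ham W x - F *\<^sub>R x) + (ham V x - ham W x) - (E - F) *\<^sub>R x"
    by (simp add: algebra_simps)
  then have "norm (ham V x - E *\<^sub>R x) \<le> norm (ham W x - F *\<^sub>R x) + norm (ham V x - ham W x) + norm ((E - F) *\<^sub>R x)"
    using tri by (simp only:)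
  moreover have "c * norm x \<le> norm (ham V x - E *\<^sub>R x)" using assms by (simp add: bounded_below_def)
  ultimately show "(c - dist V W - \<bar>E - F\<bar>) * norm x \<le> norm (ham W x - F *\<^sub>R x)"
    using ham_perturb[of V x W] by (simp only: left_diff_distrib norm_scaleR)
qed

lemma bounded_below_large: "bounded_below V E (\<bar>E\<bar> - 2 - norm V)"
  unfolding bounded_below_def
proof
  fix x
  have "\<bar>E\<bar> * norm x \<le> norm (ham V x - E *\<^sub>R x) + norm (ham V x)"
    using norm_triangle_ineq4[of "ham V x - E *\<^sub>R x" "ham V x"] by simp
  then show "(\<bar>E\<bar> - 2 - norm V) * norm x \<le> norm (ham V x - E *\<^sub>R x)"
    using ham_le[of V x] by (simp add: algebra_simps)
qed

lemma compact_schroedinger_spectrum: "compact (schroedinger_spectrum V)"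
proof -
  have "schroedinger_spectrum V \<subseteq> cball 0 (2 + norm V)"
  proof
    fix E assume "E \<in> schroedinger_spectrum V"
    then have "\<not> (\<bar>E\<bar> - 2 - norm V > 0)"
      using bounded_below_large[of V E] schroedinger_spectrum_iff by blast
    then show "E \<in> cball 0 (2 + norm V)" by simp
  qed
  then have "bounded (schroedinger_spectrum V)" using bounded_cball bounded_subset by blast
  moreover have "open (- schroedinger_spectrum V)"
    unfolding open_dist
  proof
    fix E assume "E \<in> - schroedinger_spectrum V"
    then obtain c where c: "c > 0" "bounded_below V E c" using schroedinger_spectrum_iff by blast
    have "F \<in> - schroedinger_spectrum V" if "dist F E < c" for F
    proof -
      have "bounded_below V F (c - dist V V - \<bar>E - F\<bar>)" using bounded_below_perturb[OF c(2)] .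
      moreover have "c - dist V V - \<bar>E - F\<bar> > 0" using that by (simp add: dist_real_def)
      ultimately show ?thesis using schroedinger_spectrum_iff by blast
    qed
    then show "\<exists>e>0. \<forall>F. dist F E < e \<longrightarrow> F \<in> - schroedinger_spectrum V" using c(1) by blast
  qed
  ultimately show ?thesis by (simp add: compact_eq_bounded_closed closed_def)
qed

section \<open>Spectral kernels and their limits\<close>

text \<open>Summable increments give almost everywhere convergence besides L^1 convergence. The
  first carries pointwise identities to the limit, the second carries integrals.\<close>

lemma L1_limit:
  fixes f :: "nat \<Rightarrow> 'a \<Rightarrow> real"
  assumes int: "\<And>j. integrable M (f j)" and sum: "summable (\<lambda>j. \<integral>x. \<bar>f (Suc j) x - f j x\<bar> \<partial>M)"
  shows "\<exists>h. integrable M h \<and> (AE x in M. (\<lambda>j. f j x) \<longlonglongrightarrow> h x) \<and> (\<lambda>j. \<integral>x. \<bar>f j x - h x\<bar> \<partial>M) \<longlonglongrightarrow> 0"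
proof -
  define d where "d j x = f (Suc j) x - f j x" for j x
  have d: "integrable M (d j)" for j unfolding d_def using int by auto
  then have [measurable]: "d j \<in> borel_measurable M" for j by auto
  have [measurable]: "f j \<in> borel_measurable M" for j using int by auto
  have "(\<integral>\<^sup>+x. (\<Sum>j. ennreal \<bar>d j x\<bar>) \<partial>M) = (\<Sum>j. \<integral>\<^sup>+x. ennreal \<bar>d j x\<bar> \<partial>M)"
    by (rule nn_integral_suminf) measurable
  also have "\<dots> = (\<Sum>j. ennreal (\<integral>x. \<bar>d j x\<bar> \<partial>M))"
    using d by (subst nn_integral_eq_integral) auto
  also have "\<dots> \<noteq> \<infinity>"
    using sum unfolding d_def[symmetric] by (subst suminf_ennreal2) auto
  finally have "AE x in M. (\<Sum>j. ennreal \<bar>d j x\<bar>) \<noteq> \<infinity>"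
    by (intro nn_integral_PInf_AE) auto
  then have ae: "AE x in M. summable (\<lambda>j. \<bar>d j x\<bar>)"
  proof eventually_elim
    case (elim x)
    then show ?case by (intro summable_suminf_not_top) auto
  qed
  define h where "h x = f 0 x + (\<Sum>j. d j x)" for x
  have sumd: "integrable M (\<lambda>x. \<Sum>j. d j x)"
    using d ae sum by (intro integrable_suminf) (auto simp: d_def[symmetric])
  have dom: "integrable M (\<lambda>x. \<Sum>j. \<bar>d j x\<bar>)"
    using d ae sum by (intro integrable_suminf) (auto simp: d_def[symmetric])
  have h: "integrable M h" unfolding h_def[abs_def] using int sumd by auto
  have [measurable]: "h \<in> borel_measurable M" using h by auto
  have part: "f j x = f 0 x + (\<Sum>i<j. d i x)" for j x
    by (induction j) (auto simp: d_def)
  have lim: "AE x in M. (\<lambda>j. f j x) \<longlonglongrightarrow> h x"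
    using ae
  proof eventually_elim
    case (elim x)
    have "(\<lambda>j. f 0 x + (\<Sum>i<j. d i x)) \<longlonglongrightarrow> h x"
      unfolding h_def by (intro tendsto_add tendsto_const summable_LIMSEQ summable_rabs_cancel[OF elim])
    then show ?case by (subst part)
  qed
  have "(\<lambda>j. \<integral>x. \<bar>f j x - h x\<bar> \<partial>M) \<longlonglongrightarrow> (\<integral>x. 0 \<partial>M)"
  proof (rule integral_dominated_convergence[where w="\<lambda>x. \<Sum>j. \<bar>d j x\<bar>"])
    show "AE x in M. (\<lambda>j. \<bar>f j x - h x\<bar>) \<longlonglongrightarrow> 0"
      using lim
    proof eventually_elim
      case (elim x)
      then have "(\<lambda>j. \<bar>f j x - h x\<bar>) \<longlonglongrightarrow> \<bar>h x - h x\<bar>" by (intro tendsto_intros)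
      then show ?case by simp
    qed
    fix j
    show "AE x in M. norm \<bar>f j x - h x\<bar> \<le> (\<Sum>j. \<bar>d j x\<bar>)"
      using ae
    proof eventually_elim
      case (elim x)
      note sd = summable_rabs_cancel[OF elim]
      have "h x - f j x = (\<Sum>i. d (i + j) x)"
        unfolding h_def by (subst part) (simp add: suminf_minus_initial_segment[OF sd])
      also have "\<bar>\<dots>\<bar> \<le> (\<Sum>i. \<bar>d (i + j) x\<bar>)"
        by (intro summable_rabs) (rule summable_ignore_initial_segment[OF elim])
      also have "\<dots> = (\<Sum>i. \<bar>d i x\<bar>) - (\<Sum>i<j. \<bar>d i x\<bar>)"
        by (rule suminf_minus_initial_segment[OF elim])
      also have "\<dots> \<le> (\<Sum>i. \<bar>d i x\<bar>)" by (simp add: sum_nonneg)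
      finally show ?case by (simp add: abs_minus_commute)
    qed
  qed (use dom in auto)
  then show ?thesis using h lim by auto
qed

lemma L1_limit_integral:
  fixes f :: "nat \<Rightarrow> 'a \<Rightarrow> real"
  assumes int: "\<And>j. integrable M (f j)" "integrable M h" and lim: "(\<lambda>j. \<integral>x. \<bar>f j x - h x\<bar> \<partial>M) \<longlonglongrightarrow> 0"
    and w: "w \<in> borel_measurable M" "\<And>x. \<bar>w x\<bar> \<le> (B::real)"
  shows "(\<lambda>j. \<integral>x. w x * f j x \<partial>M) \<longlonglongrightarrow> (\<integral>x. w x * h x \<partial>M)"
proof (rule LIM_zero_cancel, rule Lim_null_comparison)
  have wi: "integrable M (\<lambda>x. w x * k x)" if "integrable M k" for k
  proof (rule Bochner_Integration.integrable_bound[of M "\<lambda>x. B * k x"])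
    have "\<bar>w x\<bar> \<le> \<bar>B\<bar>" for x using w(2)[of x] by linarith
    then have "\<bar>w x\<bar> * \<bar>k x\<bar> \<le> \<bar>B\<bar> * \<bar>k x\<bar>" for x by (rule mult_right_mono) simp
    then show "AE x in M. norm (w x * k x) \<le> norm (B * k x)" by (simp add: abs_mult)
  qed (use that w(1) in simp_all)
  show "\<forall>\<^sub>F j in sequentially. norm ((\<integral>x. w x * f j x \<partial>M) - (\<integral>x. w x * h x \<partial>M)) \<le> B * (\<integral>x. \<bar>f j x - h x\<bar> \<partial>M)"
  proof (intro always_eventually allI)
    fix j
    have "(\<integral>x. w x * f j x \<partial>M) - (\<integral>x. w x * h x \<partial>M) = (\<integral>x. w x * (f j x - h x) \<partial>M)"
      using wi int by (simp add: right_diff_distrib)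
    also have "norm \<dots> \<le> (\<integral>x. norm (w x * (f j x - h x)) \<partial>M)" by (rule integral_norm_bound)
    also have "\<dots> \<le> (\<integral>x. B * \<bar>f j x - h x\<bar> \<partial>M)"
    proof (rule integral_mono)
      show "integrable M (\<lambda>x. norm (w x * (f j x - h x)))" by (intro integrable_norm wi Bochner_Integration.integrable_diff int)
      show "integrable M (\<lambda>x. B * \<bar>f j x - h x\<bar>)" using int by simp
      show "norm (w x * (f j x - h x)) \<le> B * \<bar>f j x - h x\<bar>" for x
        unfolding real_norm_def abs_mult by (rule mult_right_mono[OF w(2)]) simp
    qed
    finally show "norm ((\<integral>x. w x * f j x \<partial>M) - (\<integral>x. w x * h x \<partial>M)) \<le> B * (\<integral>x. \<bar>f j x - h x\<bar> \<partial>M)" by simp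
  qed
  show "(\<lambda>j. B * (\<integral>x. \<bar>f j x - h x\<bar> \<partial>M)) \<longlonglongrightarrow> 0" using tendsto_mult_left[OF lim, of B] by simp
qed

text \<open>The conditions concern a single energy and are closed under pointwise limits of V and g,
  so they survive almost everywhere convergence.\<close>

definition kernel_at :: "(int \<Rightarrow>\<^sub>C real) \<Rightarrow> (int \<Rightarrow> int \<Rightarrow> real \<Rightarrow> real) \<Rightarrow> real \<Rightarrow> bool" where
  "kernel_at V g E \<longleftrightarrow> (\<forall>m n. g m n E = g n m E) \<and>
     (\<forall>m n. g (m + 1) n E + g (m - 1) n E + apply_bcontfun V m * g m n E = E * g m n E) \<and>
     (\<forall>F a. finite F \<longrightarrow> 0 \<le> (\<Sum>m\<in>F. \<Sum>n\<in>F. a m * a n * g m n E))"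

text \<open>\<open>g m n\<close> is the density of the spectral measure of the pair \<open>\<delta>\<^sub>m, \<delta>\<^sub>n\<close>. The eigenvalue
  equation reduces all moments to the normalization of the total mass.\<close>

definition spectral_kernel :: "(int \<Rightarrow>\<^sub>C real) \<Rightarrow> real set \<Rightarrow> (int \<Rightarrow> int \<Rightarrow> real \<Rightarrow> real) \<Rightarrow> bool" where
  "spectral_kernel V S g \<longleftrightarrow>
     (\<forall>m n. integrable lborel (g m n) \<and> integral\<^sup>L lborel (g m n) = (if m = n then 1 else 0)) \<and>
     (AE E in lborel. kernel_at V g E \<and> (E \<notin> S \<longrightarrow> (\<forall>m n. g m n E = 0)))"

text \<open>Masses pass to the limit in L^1, the kernel conditions almost everywhere. The support
  condition is pointwise too: each energy outside T has to leave the sets \<open>S k\<close>, at a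
  stage that may depend on the energy.\<close>

lemma spectral_kernel_limit:
  assumes sk: "\<And>k. spectral_kernel (V k) (S k) (g k)" and V: "V \<longlonglongrightarrow> W"
    and sum: "\<And>m n. summable (\<lambda>k. \<integral>E. \<bar>g (Suc k) m n E - g k m n E\<bar> \<partial>lborel)"
    and S: "\<And>E. E \<notin> T \<Longrightarrow> eventually (\<lambda>k. E \<notin> S k) sequentially"
  shows "\<exists>h. spectral_kernel W T h"
proof -
  have int: "integrable lborel (g k m n)" "integral\<^sup>L lborel (g k m n) = (if m = n then 1 else 0)" for k m n
    using sk unfolding spectral_kernel_def by auto
  have "\<forall>m n. \<exists>h. integrable lborel h \<and> (AE x in lborel. (\<lambda>k. g k m n x) \<longlonglongrightarrow> h x) \<and> (\<lambda>k. \<integral>x. \<bar>g k m n x - h x\<bar> \<partial>lborel) \<longlonglongrightarrow> 0"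
    by (intro allI L1_limit int sum)
  then obtain h where h: "\<And>m n. integrable lborel (h m n)" "\<And>m n. AE x in lborel. (\<lambda>k. g k m n x) \<longlonglongrightarrow> h m n x"
    "\<And>m n. (\<lambda>k. \<integral>x. \<bar>g k m n x - h m n x\<bar> \<partial>lborel) \<longlonglongrightarrow> 0"
    unfolding choice_iff by blast
  have lim: "AE x in lborel. \<forall>m n. (\<lambda>k. g k m n x) \<longlonglongrightarrow> h m n x"
    using h(2) by (simp add: AE_all_countable)
  have props: "AE x in lborel. \<forall>k. kernel_at (V k) (g k) x \<and> (x \<notin> S k \<longrightarrow> (\<forall>m n. g k m n x = 0))"
    using sk unfolding spectral_kernel_def by (simp add: AE_all_countable)
  have Vn: "(\<lambda>k. apply_bcontfun (V k) n) \<longlonglongrightarrow> apply_bcontfun W n" for n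
  proof (rule metric_LIMSEQ_I)
    fix e :: real assume "e > 0"
    then obtain K where K: "\<forall>k\<ge>K. dist (V k) W < e" using metric_LIMSEQ_D[OF V] by blast
    have "dist (apply_bcontfun (V k) n) (apply_bcontfun W n) < e" if "k \<ge> K" for k
      by (rule le_less_trans[OF dist_bounded]) (use K that in simp)
    then show "\<exists>K. \<forall>k\<ge>K. dist (apply_bcontfun (V k) n) (apply_bcontfun W n) < e" by blast
  qed
  have "AE x in lborel. kernel_at W h x \<and> (x \<notin> T \<longrightarrow> (\<forall>m n. h m n x = 0))"
    using lim props
  proof eventually_elim
    case (elim x)
    then have l: "\<And>m n. (\<lambda>k. g k m n x) \<longlonglongrightarrow> h m n x" by blast
    have k: "\<And>k. kernel_at (V k) (g k) x" using elim by blast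
    have "h m n x = h n m x" for m n
    proof -
      have "(\<lambda>k. g k m n x) = (\<lambda>k. g k n m x)" using k unfolding kernel_at_def by blast
      then show ?thesis using LIMSEQ_unique[OF l[of m n]] l[of n m] by simp
    qed
    moreover have "h (m + 1) n x + h (m - 1) n x + apply_bcontfun W m * h m n x = x * h m n x" for m n
    proof -
      have "(\<lambda>k. g k (m + 1) n x + g k (m - 1) n x + apply_bcontfun (V k) m * g k m n x) \<longlonglongrightarrow>
          h (m + 1) n x + h (m - 1) n x + apply_bcontfun W m * h m n x"
        by (intro tendsto_intros l Vn)
      moreover have "(\<lambda>k. g k (m + 1) n x + g k (m - 1) n x + apply_bcontfun (V k) m * g k m n x) = (\<lambda>k. x * g k m n x)"
        using k unfolding kernel_at_def by blast
      moreover have "(\<lambda>k. x * g k m n x) \<longlonglongrightarrow> x * h m n x" by (intro tendsto_intros l)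
      ultimately show ?thesis using LIMSEQ_unique by metis
    qed
    moreover have "0 \<le> (\<Sum>m\<in>F. \<Sum>n\<in>F. a m * a n * h m n x)" if "finite F" for F a
    proof (rule LIMSEQ_le_const)
      show "(\<lambda>k. \<Sum>m\<in>F. \<Sum>n\<in>F. a m * a n * g k m n x) \<longlonglongrightarrow> (\<Sum>m\<in>F. \<Sum>n\<in>F. a m * a n * h m n x)"
        by (intro tendsto_intros l)
      show "\<exists>N. \<forall>k\<ge>N. 0 \<le> (\<Sum>m\<in>F. \<Sum>n\<in>F. a m * a n * g k m n x)"
        using k that unfolding kernel_at_def by blast
    qed
    moreover have "h m n x = 0" if "x \<notin> T" for m n
    proof -
      have "eventually (\<lambda>k. g k m n x = 0) sequentially"
        using S[OF that] by eventually_elim (use elim in blast)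
      then have "(\<lambda>k. g k m n x) \<longlonglongrightarrow> 0" by (rule tendsto_eventually)
      then show ?thesis using l LIMSEQ_unique by blast
    qed
    ultimately show ?case unfolding kernel_at_def by blast
  qed
  moreover have "integral\<^sup>L lborel (h m n) = (if m = n then 1 else 0)" for m n
  proof -
    have "(\<lambda>k. integral\<^sup>L lborel (g k m n)) \<longlonglongrightarrow> integral\<^sup>L lborel (h m n)"
      using L1_limit_integral[of lborel "\<lambda>k. g k m n" "h m n" "\<lambda>_. 1" 1] int(1) h(1,3) by simp
    then show ?thesis unfolding int(2) by (simp add: LIMSEQ_const_iff)
  qed
  ultimately show ?thesis using h(1) unfolding spectral_kernel_def by blast
qed

section \<open>Densities and moments of finitely supported vectors\<close>

definition qform :: "(int \<Rightarrow> int \<Rightarrow> real \<Rightarrow> real) \<Rightarrow> int set \<Rightarrow> (int \<Rightarrow> complex) \<Rightarrow> real \<Rightarrow> real" where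
  "qform g F \<psi> E = (\<Sum>m\<in>F. \<Sum>n\<in>F. Re (cnj (\<psi> m) * \<psi> n) * g m n E)"

lemma qform_nonneg:
  assumes "kernel_at V g E" "finite F" shows "0 \<le> qform g F \<psi> E"
proof -
  have "qform g F \<psi> E = (\<Sum>m\<in>F. \<Sum>n\<in>F. Re (\<psi> m) * Re (\<psi> n) * g m n E) + (\<Sum>m\<in>F. \<Sum>n\<in>F. Im (\<psi> m) * Im (\<psi> n) * g m n E)"
    unfolding qform_def by (simp add: sum.distrib[symmetric] algebra_simps)
  then show ?thesis using assms unfolding kernel_at_def by simp
qed

text \<open>The difference is the real part of the form at the pair a - b, a + b. Positivity at r (a
  - b) + s (a + b) / r, with s = 1 and s = -1, bounds it from both sides; the weight r balances a
  small difference against a bounded sum.\<close>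

lemma qform_diff_le:
  assumes k: "kernel_at V g E" and F: "finite F" and r: "r > 0"
  shows "\<bar>qform g F a E - qform g F b E\<bar> \<le> (r\<^sup>2 * qform g F (\<lambda>n. a n - b n) E + qform g F (\<lambda>n. a n + b n) E / r\<^sup>2) / 2"
proof -
  have id: "qform g F (\<lambda>n. complex_of_real r * (a n - b n) + complex_of_real s * (a n + b n) / complex_of_real r) E
     = r\<^sup>2 * qform g F (\<lambda>n. a n - b n) E + s\<^sup>2 * (qform g F (\<lambda>n. a n + b n) E / r\<^sup>2) + 2 * s * (qform g F a E - qform g F b E)" for s
  proof -
    have trm: "Re (cnj (complex_of_real r * (u - u') + complex_of_real s * (u + u') / complex_of_real r) *
        (complex_of_real r * (v - v') + complex_of_real s * (v + v') / complex_of_real r)) =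
        r\<^sup>2 * Re (cnj (u - u') * (v - v')) + s\<^sup>2 * (Re (cnj (u + u') * (v + v')) / r\<^sup>2)
         + 2 * s * (Re (cnj u * v) - Re (cnj u' * v'))" for u u' v v'
      using r by (simp add: field_simps power2_eq_square)
    have "(\<Sum>m\<in>F. \<Sum>n\<in>F. (r\<^sup>2 * P m n + s\<^sup>2 * (Q m n / r\<^sup>2) + 2 * s * (A m n - B m n)) * g m n E)
        = r\<^sup>2 * (\<Sum>m\<in>F. \<Sum>n\<in>F. P m n * g m n E) + s\<^sup>2 * ((\<Sum>m\<in>F. \<Sum>n\<in>F. Q m n * g m n E) / r\<^sup>2)
          + 2 * s * ((\<Sum>m\<in>F. \<Sum>n\<in>F. A m n * g m n E) - (\<Sum>m\<in>F. \<Sum>n\<in>F. B m n * g m n E))" for P Q A B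
      by (simp add: sum.distrib sum_subtractf sum_distrib_left sum_divide_distrib algebra_simps)
    then show ?thesis unfolding qform_def trm .
  qed
  have "0 \<le> r\<^sup>2 * qform g F (\<lambda>n. a n - b n) E + qform g F (\<lambda>n. a n + b n) E / r\<^sup>2 + 2 * s * (qform g F a E - qform g F b E)" if "s\<^sup>2 = 1" for s
    using id[of s] that qform_nonneg[OF k F, of "\<lambda>n. complex_of_real r * (a n - b n) + complex_of_real s * (a n + b n) / complex_of_real r"]
    by simp
  from this[of 1] this[of "-1"] show ?thesis by (simp add: abs_if)
qed

lemma qform_restrict:
  assumes "finite G" "F \<subseteq> G" shows "qform g G (\<lambda>n. if n \<in> F then \<psi> n else 0) = qform g F \<psi>"
proof
  fix E
  have "qform g G (\<lambda>n. if n \<in> F then \<psi> n else 0) E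
    = (\<Sum>m\<in>G. if m \<in> F then (\<Sum>n\<in>G. if n \<in> F then Re (cnj (\<psi> m) * \<psi> n) * g m n E else 0) else 0)"
    unfolding qform_def by (intro sum.cong refl) (auto intro!: sum.neutral sum.cong)
  also have "\<dots> = qform g F \<psi> E"
    using assms by (simp add: qform_def sum.inter_restrict[symmetric] Int_absorb1)
  finally show "qform g G (\<lambda>n. if n \<in> F then \<psi> n else 0) E = qform g F \<psi> E" .
qed

definition delta :: "int \<Rightarrow> int \<Rightarrow> complex" where
  "delta n m = (if m = n then 1 else 0)"

definition trunc :: "int set \<Rightarrow> ell2 \<Rightarrow> ell2" where
  "trunc F x = Ell2 (\<lambda>n. if n \<in> F then coord x n else 0)"

lemma coord_trunc [simp]: "coord (trunc F x) = (\<lambda>n. if n \<in> F then coord x n else 0)"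
  unfolding trunc_def by (intro coord_Ell2 l2_mono[OF coord_l2[of x]]) auto

lemma norm_trunc_le: "norm (trunc F x) \<le> norm x"
  using norm_multiplier[of "trunc F x" 1 x] by simp

lemma trunc_approx:
  assumes "e > 0" shows "\<exists>F. finite F \<and> norm (x - trunc F x) \<le> e"
proof -
  have "(\<lambda>n. (cmod (coord x n))\<^sup>2) summable_on UNIV" using coord_l2[of x] by (simp add: l2_def)
  from infsum_finite_approximation[OF this, of "e\<^sup>2"] assms obtain F where F: "finite F"
    "dist (\<Sum>n\<in>F. (cmod (coord x n))\<^sup>2) ((norm x)\<^sup>2) \<le> e\<^sup>2" by (auto simp: norm_ell2_sq)
  have "norm (x - trunc F x) \<le> e"
  proof (rule norm_ell2_le)
    fix G :: "int set" assume G: "finite G"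
    have "(\<Sum>n\<in>G. (cmod (coord (x - trunc F x) n))\<^sup>2) = (\<Sum>n\<in>G - F. (cmod (coord x n))\<^sup>2)"
      using G by (intro sum.mono_neutral_cong_right) auto
    also have "\<dots> = (\<Sum>n\<in>G \<union> F. (cmod (coord x n))\<^sup>2) - (\<Sum>n\<in>F. (cmod (coord x n))\<^sup>2)"
      using G F(1) by (subst sum_diff[symmetric]) (auto intro!: sum.cong)
    also have "\<dots> \<le> (norm x)\<^sup>2 - (\<Sum>n\<in>F. (cmod (coord x n))\<^sup>2)"
      using sum_le_norm_ell2[of "G \<union> F" x] G F(1) by simp
    also have "\<dots> \<le> e\<^sup>2" using F(2) by (simp add: dist_real_def)
    finally show "(\<Sum>n\<in>G. (cmod (coord (x - trunc F x) n))\<^sup>2) \<le> e\<^sup>2" .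
  qed (use assms in simp)
  then show ?thesis using F(1) by blast
qed

lemma ham_bounded_linear: "bounded_linear (ham V)"
  by (rule bounded_linear_intro[where K="2 + norm V"])
     (use ham_le in \<open>auto simp: ham_add ham_scaleR mult.commute\<close>)

lemma tendsto_ham: "(X \<longlongrightarrow> x) F \<Longrightarrow> ((\<lambda>j. ham V (X j)) \<longlongrightarrow> ham V x) F"
  by (rule bounded_linear.tendsto[OF ham_bounded_linear])

lemma tendsto_ham_pow: "(X \<longlongrightarrow> x) F \<Longrightarrow> ((\<lambda>j. (ham V ^^ k) (X j)) \<longlongrightarrow> (ham V ^^ k) x) F"
  by (induction k) (auto intro: tendsto_ham)

lemma coord_ham_pow: "coord ((ham V ^^ k) x) = (schroedinger V ^^ k) (coord x)"
  by (induction k) auto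

lemma schroedinger_sum:
  "schroedinger V (\<lambda>m. \<Sum>n\<in>F. c n * \<phi> n m) = (\<lambda>m. \<Sum>n\<in>F. c n * schroedinger V (\<phi> n) m)"
  unfolding schroedinger_def by (simp add: sum.distrib[symmetric] sum_distrib_left algebra_simps)

lemma schroedinger_pow_sum:
  "(schroedinger V ^^ k) (\<lambda>m. \<Sum>n\<in>F. c n * \<phi> n m) = (\<lambda>m. \<Sum>n\<in>F. c n * (schroedinger V ^^ k) (\<phi> n) m)"
  by (induction k) (auto simp: schroedinger_sum)

lemma spectral_kernel_moment:
  assumes sk: "spectral_kernel V S g" and S: "\<And>E. E \<in> S \<Longrightarrow> \<bar>E\<bar> \<le> R"
  shows "integrable lborel (\<lambda>E. E ^ k * g m n E)"
    "(schroedinger V ^^ k) (delta n) m = complex_of_real (\<integral>E. E ^ k * g m n E \<partial>lborel)"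
proof -
  have g: "integrable lborel (g m n)" "integral\<^sup>L lborel (g m n) = (if m = n then 1 else 0)" for m n
    using sk unfolding spectral_kernel_def by auto
  have int: "integrable lborel (\<lambda>E. E ^ k * g m n E)" for k m n
  proof (rule Bochner_Integration.integrable_bound)
    show "integrable lborel (\<lambda>E. \<bar>R\<bar> ^ k * g m n E)" using g(1) by simp
    have [measurable]: "g m n \<in> borel_measurable lborel" using g(1) by auto
    show "(\<lambda>E. E ^ k * g m n E) \<in> borel_measurable lborel" by measurable
    have "AE E in lborel. E \<notin> S \<longrightarrow> g m n E = 0" using sk unfolding spectral_kernel_def by auto
    then show "AE E in lborel. norm (E ^ k * g m n E) \<le> norm (\<bar>R\<bar> ^ k * g m n E)"
    proof eventually_elim
      case (elim E)
      show ?case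
      proof (cases "E \<in> S")
        case True
        then have "\<bar>E\<bar> ^ k \<le> \<bar>R\<bar> ^ k" using S[OF True] by (intro power_mono) auto
        then show ?thesis by (simp add: abs_mult power_abs mult_right_mono)
      qed (use elim in simp)
    qed
  qed
  then show "integrable lborel (\<lambda>E. E ^ k * g m n E)" .
  show "(schroedinger V ^^ k) (delta n) m = complex_of_real (\<integral>E. E ^ k * g m n E \<partial>lborel)"
  proof (induction k arbitrary: m)
    case 0
    then show ?case using g(2)[of m n] by (simp add: delta_def)
  next
    case (Suc k)
    have "AE E in lborel. g (m + 1) n E + g (m - 1) n E + apply_bcontfun V m * g m n E = E * g m n E"
      using sk unfolding spectral_kernel_def kernel_at_def by auto
    then have ae: "AE E in lborel. E ^ Suc k * g m n E = E ^ k * g (m - 1) n E + E ^ k * g (m + 1) n E + apply_bcontfun V m * (E ^ k * g m n E)"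
    proof eventually_elim
      case (elim E)
      have "E ^ Suc k * g m n E = E ^ k * (E * g m n E)" by simp
      then show ?case unfolding elim[symmetric] by (simp add: algebra_simps)
    qed
    have "(\<integral>E. E ^ Suc k * g m n E \<partial>lborel) = (\<integral>E. E ^ k * g (m - 1) n E + E ^ k * g (m + 1) n E + apply_bcontfun V m * (E ^ k * g m n E) \<partial>lborel)"
      by (intro integral_cong_AE[OF _ _ ae] borel_measurable_integrable Bochner_Integration.integrable_add integrable_mult_right int)
    also have "\<dots> = (\<integral>E. E ^ k * g (m - 1) n E \<partial>lborel) + (\<integral>E. E ^ k * g (m + 1) n E \<partial>lborel) + apply_bcontfun V m * (\<integral>E. E ^ k * g m n E \<partial>lborel)"
      by (simp add: int)
    finally show ?case using Suc by (simp add: schroedinger_def)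
  qed
qed

lemma qform_moment:
  assumes sk: "spectral_kernel V S g" and S: "\<And>E. E \<in> S \<Longrightarrow> \<bar>E\<bar> \<le> R" and F: "finite F"
  shows "integrable lborel (\<lambda>E. E ^ k * qform g F (coord x) E)"
    "inner (trunc F x) ((ham V ^^ k) (trunc F x)) = (\<integral>E. E ^ k * qform g F (coord x) E \<partial>lborel)"
proof -
  note mom = spectral_kernel_moment[OF sk S]
  have eq: "E ^ k * qform g F (coord x) E = (\<Sum>m\<in>F. \<Sum>n\<in>F. Re (cnj (coord x m) * coord x n) * (E ^ k * g m n E))" for E
    unfolding qform_def by (simp add: sum_distrib_left mult_ac)
  show "integrable lborel (\<lambda>E. E ^ k * qform g F (coord x) E)"
    unfolding eq using mom(1) by auto
  have "coord (trunc F x) = (\<lambda>m. \<Sum>n\<in>F. coord x n * delta n m)"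
  proof
    fix m
    have "(\<Sum>n\<in>F. coord x n * delta n m) = (\<Sum>n\<in>F. if m = n then coord x m else 0)"
      by (intro sum.cong) (auto simp: delta_def)
    then show "coord (trunc F x) m = (\<Sum>n\<in>F. coord x n * delta n m)" using F by simp
  qed
  then have "(schroedinger V ^^ k) (coord (trunc F x)) m = (\<Sum>n\<in>F. coord x n * complex_of_real (\<integral>E. E ^ k * g m n E \<partial>lborel))" for m
    by (simp only: schroedinger_pow_sum mom(2))
  then have "l2_inner (coord (trunc F x)) (coord ((ham V ^^ k) (trunc F x))) =
      (\<Sum>\<^sub>\<infinity>m. cnj (if m \<in> F then coord x m else 0) * (\<Sum>n\<in>F. coord x n * complex_of_real (\<integral>E. E ^ k * g m n E \<partial>lborel)))"
    unfolding l2_inner_def coord_ham_pow by (simp only: coord_trunc)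
  also have "\<dots> = (\<Sum>m\<in>F. cnj (coord x m) * (\<Sum>n\<in>F. coord x n * complex_of_real (\<integral>E. E ^ k * g m n E \<partial>lborel)))"
    using F by (subst infsum_cong_neutral[where T=F and
      g="\<lambda>m. cnj (coord x m) * (\<Sum>n\<in>F. coord x n * complex_of_real (\<integral>E. E ^ k * g m n E \<partial>lborel))"]) auto
  moreover have re: "Re (z * complex_of_real r) = Re z * r" for z r by simp
  ultimately have "inner (trunc F x) ((ham V ^^ k) (trunc F x)) =
    (\<Sum>m\<in>F. \<Sum>n\<in>F. Re (cnj (coord x m) * coord x n) * (\<integral>E. E ^ k * g m n E \<partial>lborel))"
    unfolding inner_ell2_def by (simp only: Re_sum sum_distrib_left mult.assoc[symmetric] re)
  also have "\<dots> = (\<integral>E. E ^ k * qform g F (coord x) E \<partial>lborel)"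
    unfolding eq using mom(1) by simp
  finally show "inner (trunc F x) ((ham V ^^ k) (trunc F x)) = (\<integral>E. E ^ k * qform g F (coord x) E \<partial>lborel)" .
qed

text \<open>For a finitely supported x the squared norm of (H - y) x is the integral of (E - y)^2
  against the density of x, which lives at distance at least c from y. Truncation extends the bound
  to all x.\<close>

lemma spectral_kernel_bounded_below:
  assumes sk: "spectral_kernel V S g" and S: "\<And>E. E \<in> S \<Longrightarrow> \<bar>E\<bar> \<le> R"
    and c: "c \<ge> 0" "\<And>E. E \<in> S \<Longrightarrow> c \<le> \<bar>E - y\<bar>"
  shows "bounded_below V y c"
proof -
  have tr: "c * norm (trunc F x) \<le> norm (ham V (trunc F x) - y *\<^sub>R trunc F x)" if F: "finite F" for F x
  proof -
    let ?t = "trunc F x" and ?q = "qform g F (coord x)"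
    note mom = qform_moment[OF sk S F]
    have h0: "integrable lborel ?q" "inner ?t ?t = integral\<^sup>L lborel ?q" using mom[where k=0 and x=x] by simp_all
    have h1: "integrable lborel (\<lambda>E. E * ?q E)" "inner ?t (ham V ?t) = (\<integral>E. E * ?q E \<partial>lborel)" using mom[where k=1 and x=x] by simp_all
    have h2: "integrable lborel (\<lambda>E. E\<^sup>2 * ?q E)" "inner ?t (ham V (ham V ?t)) = (\<integral>E. E\<^sup>2 * ?q E \<partial>lborel)"
      using mom[where k=2 and x=x] by (simp_all add: numeral_2_eq_2)
    have "(norm (ham V ?t - y *\<^sub>R ?t))\<^sup>2 = inner ?t (ham V (ham V ?t)) - 2 * y * inner ?t (ham V ?t) + y\<^sup>2 * inner ?t ?t"
      using ham_symmetric[of V ?t "ham V ?t"] ham_symmetric[of V ?t ?t]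
      unfolding power2_norm_eq_inner by (simp add: inner_diff_left inner_diff_right power2_eq_square algebra_simps)
    also have "\<dots> = (\<integral>E. E\<^sup>2 * ?q E - 2 * y * (E * ?q E) + y\<^sup>2 * ?q E \<partial>lborel)"
      unfolding h0 h1 h2 using h0(1) h1(1) h2(1) by simp
    also have "\<dots> \<ge> (\<integral>E. c\<^sup>2 * ?q E \<partial>lborel)"
    proof (rule integral_mono_AE)
      have "AE E in lborel. kernel_at V g E \<and> (E \<notin> S \<longrightarrow> (\<forall>m n. g m n E = 0))"
        using sk unfolding spectral_kernel_def by blast
      then show "AE E in lborel. c\<^sup>2 * ?q E \<le> E\<^sup>2 * ?q E - 2 * y * (E * ?q E) + y\<^sup>2 * ?q E"
      proof eventually_elim
        case (elim E)
        have q: "0 \<le> ?q E" using elim qform_nonneg F by blast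
        have e: "E\<^sup>2 * ?q E - 2 * y * (E * ?q E) + y\<^sup>2 * ?q E = (E - y)\<^sup>2 * ?q E"
          by (simp add: power2_eq_square algebra_simps)
        show ?case
        proof (cases "E \<in> S")
          case True
          then have "c\<^sup>2 \<le> \<bar>E - y\<bar>\<^sup>2" using c by (intro power_mono) auto
          then show ?thesis unfolding e using q by (intro mult_right_mono) auto
        next
          case False
          then have "?q E = 0" using elim by (simp add: qform_def)
          then show ?thesis by simp
        qed
      qed
    qed (use h0(1) h1(1) h2(1) in auto)
    also have "(\<integral>E. c\<^sup>2 * ?q E \<partial>lborel) = (c * norm ?t)\<^sup>2"
      using h0 by (simp add: power_mult_distrib power2_norm_eq_inner)
    finally show ?thesis using power2_le_imp_le by (metis norm_ge_zero)
  qed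
  show ?thesis
    unfolding bounded_below_def
  proof
    fix x
    have "\<forall>j. \<exists>F. finite F \<and> norm (x - trunc F x) \<le> 1 / real (Suc j)" by (intro allI trunc_approx) simp
    then obtain F where F: "\<And>j. finite (F j)" "\<And>j. norm (x - trunc (F j) x) \<le> 1 / real (Suc j)" by metis
    have lim: "(\<lambda>j. trunc (F j) x) \<longlonglongrightarrow> x"
    proof (rule LIM_zero_cancel, rule Lim_null_comparison)
      show "\<forall>\<^sub>F j in sequentially. norm (trunc (F j) x - x) \<le> 1 / real (Suc j)"
        using F(2) by (simp add: norm_minus_commute)
      show "(\<lambda>j. 1 / real (Suc j)) \<longlonglongrightarrow> 0" using LIMSEQ_inverse_real_of_nat by (simp add: inverse_eq_divide)
    qed
    show "c * norm x \<le> norm (ham V x - y *\<^sub>R x)"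
    proof (rule LIMSEQ_le)
      show "(\<lambda>j. c * norm (trunc (F j) x)) \<longlonglongrightarrow> c * norm x" by (intro tendsto_intros lim)
      show "(\<lambda>j. norm (ham V (trunc (F j) x) - y *\<^sub>R trunc (F j) x)) \<longlonglongrightarrow> norm (ham V x - y *\<^sub>R x)"
        by (intro tendsto_intros tendsto_ham lim)
    qed (use tr F(1) in blast)
  qed
qed

section \<open>Absolute continuity\<close>

lemma schroedinger_pow_l2: "\<psi> \<in> l2 \<Longrightarrow> (schroedinger V ^^ k) \<psi> \<in> l2"
  by (induction k) (auto intro: schroedinger_l2)

lemma schroedinger_pow_symmetric:
  assumes "\<phi> \<in> l2" "\<psi> \<in> l2"
  shows "l2_inner ((schroedinger V ^^ k) \<phi>) \<psi> = l2_inner \<phi> ((schroedinger V ^^ k) \<psi>)"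
  using assms(2)
proof (induction k arbitrary: \<psi>)
  case (Suc k)
  have "l2_inner ((schroedinger V ^^ Suc k) \<phi>) \<psi> = l2_inner ((schroedinger V ^^ k) \<phi>) (schroedinger V \<psi>)"
    using schroedinger_symmetric[OF schroedinger_pow_l2[OF assms(1)] Suc.prems] by simp
  also have "\<dots> = l2_inner \<phi> ((schroedinger V ^^ k) (schroedinger V \<psi>))"
    by (rule Suc.IH[OF schroedinger_l2[OF Suc.prems]])
  finally show ?case by (simp add: funpow_swap1)
qed simp

lemma l2_inner_pow_real:
  assumes "\<psi> \<in> l2"
  shows "l2_inner \<psi> ((schroedinger V ^^ k) \<psi>) = complex_of_real (inner (Ell2 \<psi>) ((ham V ^^ k) (Ell2 \<psi>)))"
proof -
  have "l2_inner \<psi> ((schroedinger V ^^ k) \<psi>) = cnj (l2_inner \<psi> ((schroedinger V ^^ k) \<psi>))"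
    by (subst l2_inner_cnj) (simp add: schroedinger_pow_symmetric[OF assms assms])
  then have "Im (l2_inner \<psi> ((schroedinger V ^^ k) \<psi>)) = 0" by (simp add: complex_eq_iff)
  then show ?thesis using assms by (simp add: inner_ell2_def coord_ham_pow complex_eq_iff)
qed

lemma l2_inner_sum_right:
  assumes "\<phi> \<in> l2" "\<And>k. \<psi> k \<in> l2" "finite A"
  shows "(\<lambda>n. \<Sum>k\<in>A. c k * \<psi> k n) \<in> l2 \<and> l2_inner \<phi> (\<lambda>n. \<Sum>k\<in>A. c k * \<psi> k n) = (\<Sum>k\<in>A. c k * l2_inner \<phi> (\<psi> k))"
  using assms(3)
proof induction
  case empty
  then show ?case by (simp add: l2_zero l2_inner_def)
next
  case (insert a A)
  then show ?case
    using assms l2_add[OF l2_cmult[OF assms(2)]] l2_inner_add_right[OF assms(1) l2_cmult[OF assms(2)]]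
    by (simp add: l2_inner_cmult_right)
qed

text \<open>Integrated form of \<open>qform_diff_le\<close>; the masses of the two forms on the
  right are at most the squared norms.\<close>

lemma spectral_kernel_L1_Cauchy:
  assumes sk: "spectral_kernel V S g" and S: "\<And>E. E \<in> S \<Longrightarrow> \<bar>E\<bar> \<le> R"
    and F: "finite F" "finite F'" and r: "r > 0"
  shows "(\<integral>E. \<bar>qform g F' (coord x) E - qform g F (coord x) E\<bar> \<partial>lborel)
     \<le> (r\<^sup>2 * (norm (trunc F' x - trunc F x))\<^sup>2 + (norm (trunc F' x + trunc F x))\<^sup>2 / r\<^sup>2) / 2"
proof -
  define G where "G = F \<union> F'"
  have G: "finite G" using F by (simp add: G_def)
  define y y' where "y = trunc F x" and "y' = trunc F' x"
  have q: "qform g F (coord x) = qform g G (coord y)" "qform g F' (coord x) = qform g G (coord y')"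
    unfolding y_def y'_def coord_trunc using qform_restrict[OF G] by (auto simp: G_def)
  note mom = qform_moment[OF sk S G, where k=0, simplified]
  have tr: "(norm (trunc G z))\<^sup>2 \<le> (norm z)\<^sup>2" for z by (intro power_mono norm_trunc_le) auto
  have int: "integral\<^sup>L lborel (qform g G (coord z)) \<le> (norm z)\<^sup>2" for z
    using mom(2)[of z] tr[of z] by (simp add: power2_norm_eq_inner)
  have d: "integrable lborel (qform g G (\<lambda>n. coord y' n - coord y n))" "integrable lborel (qform g G (\<lambda>n. coord y' n + coord y n))"
    using mom(1)[of "y' - y"] mom(1)[of "y' + y"] by simp_all
  have "(\<integral>E. \<bar>qform g G (coord y') E - qform g G (coord y) E\<bar> \<partial>lborel)
    \<le> (\<integral>E. (r\<^sup>2 * qform g G (\<lambda>n. coord y' n - coord y n) E + qform g G (\<lambda>n. coord y' n + coord y n) E / r\<^sup>2) / 2 \<partial>lborel)"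
  proof (rule integral_mono_AE)
    have "AE E in lborel. kernel_at V g E" using sk unfolding spectral_kernel_def by auto
    then show "AE E in lborel. \<bar>qform g G (coord y') E - qform g G (coord y) E\<bar>
       \<le> (r\<^sup>2 * qform g G (\<lambda>n. coord y' n - coord y n) E + qform g G (\<lambda>n. coord y' n + coord y n) E / r\<^sup>2) / 2"
      by eventually_elim (rule qform_diff_le[OF _ G r])
  qed (use mom(1) d in auto)
  also have "\<dots> = (r\<^sup>2 * integral\<^sup>L lborel (qform g G (coord (y' - y))) + integral\<^sup>L lborel (qform g G (coord (y' + y))) / r\<^sup>2) / 2"
    using d by simp
  also have "\<dots> \<le> (r\<^sup>2 * (norm (y' - y))\<^sup>2 + (norm (y' + y))\<^sup>2 / r\<^sup>2) / 2"
    by (intro divide_right_mono add_mono mult_left_mono int) auto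
  finally show ?thesis unfolding q y_def y'_def .
qed

lemma spectral_kernel_density:
  assumes sk: "spectral_kernel V S g" and S: "\<And>E. E \<in> S \<Longrightarrow> \<bar>E\<bar> \<le> R"
  shows "\<exists>h. integrable lborel h \<and> (AE E in lborel. 0 \<le> h E \<and> (E \<notin> S \<longrightarrow> h E = 0)) \<and>
    (\<forall>k. integrable lborel (\<lambda>E. h E * E ^ k) \<and> (\<integral>E. h E * E ^ k \<partial>lborel) = inner x ((ham V ^^ k) x))"
proof -
  \<comment> \<open>Truncation errors of order 4^-j, combined with the weight r = 2^j, make both
    terms of the Cauchy bound of order 4^-j.\<close>
  have "\<forall>j. \<exists>F. finite F \<and> norm (x - trunc F x) \<le> (1 / 4) ^ j" by (intro allI trunc_approx) simp
  then obtain F where F: "\<And>j. finite (F j)" "\<And>j. norm (x - trunc (F j) x) \<le> (1 / 4) ^ j" by metis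
  define y where "y j = trunc (F j) x" for j
  have ylim: "y \<longlonglongrightarrow> x"
  proof (rule LIM_zero_cancel, rule Lim_null_comparison)
    show "\<forall>\<^sub>F j in sequentially. norm (y j - x) \<le> (1 / 4) ^ j"
      using F(2) by (simp add: norm_minus_commute y_def)
    show "(\<lambda>j. (1 / 4) ^ j :: real) \<longlonglongrightarrow> 0" by (rule LIMSEQ_power_zero) simp
  qed
  define f where "f j = qform g (F j) (coord x)" for j
  have mom: "integrable lborel (\<lambda>E. E ^ k * f j E)" "inner (y j) ((ham V ^^ k) (y j)) = (\<integral>E. E ^ k * f j E \<partial>lborel)" for k j
    unfolding f_def y_def using qform_moment[OF sk S F(1)[of j], where k=k and x=x] by simp_all
  have fi: "integrable lborel (f j)" for j using mom(1)[of 0 j] by simp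
  have bound: "(\<integral>E. \<bar>f (Suc j) E - f j E\<bar> \<partial>lborel) \<le> (2 + 2 * (norm x)\<^sup>2) * (1 / 4) ^ j" for j
  proof -
    have "norm (y (Suc j) - y j) \<le> norm (x - y j) + norm (x - y (Suc j))"
      using norm_triangle_ineq4[of "x - y j" "x - y (Suc j)"] by simp
    also have "\<dots> \<le> (1 / 4) ^ j + (1 / 4) ^ Suc j" using F(2)[of j] F(2)[of "Suc j"] unfolding y_def by linarith
    also have "\<dots> \<le> 2 * (1 / 4) ^ j" by simp
    finally have "(norm (y (Suc j) - y j))\<^sup>2 \<le> (2 * (1 / 4) ^ j)\<^sup>2" by (intro power_mono) auto
    moreover have "norm (y (Suc j) + y j) \<le> 2 * norm x"
      using norm_triangle_ineq[of "y (Suc j)" "y j"] norm_trunc_le[of "F j" x] norm_trunc_le[of "F (Suc j)" x]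
      unfolding y_def by linarith
    then have "(norm (y (Suc j) + y j))\<^sup>2 \<le> (2 * norm x)\<^sup>2" by (intro power_mono) auto
    ultimately have "(((2::real) ^ j)\<^sup>2 * (norm (y (Suc j) - y j))\<^sup>2 + (norm (y (Suc j) + y j))\<^sup>2 / (2 ^ j)\<^sup>2) / 2
       \<le> ((2 ^ j)\<^sup>2 * (2 * (1 / 4) ^ j)\<^sup>2 + (2 * norm x)\<^sup>2 / (2 ^ j)\<^sup>2) / 2"
      by (intro divide_right_mono add_mono mult_left_mono) auto
    also have "\<dots> = (2 + 2 * (norm x)\<^sup>2) * (1 / 4) ^ j"
    proof -
      have "((2::real) ^ j)\<^sup>2 = 4 ^ j" by (simp add: power2_eq_square power_mult_distrib[symmetric])
      then show ?thesis by (simp add: power_divide power2_eq_square field_simps)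
    qed
    finally show ?thesis
      using spectral_kernel_L1_Cauchy[OF sk S F(1)[of j] F(1)[of "Suc j"], of "2 ^ j" x]
      unfolding f_def y_def by simp
  qed
  have "summable (\<lambda>j. \<integral>E. \<bar>f (Suc j) E - f j E\<bar> \<partial>lborel)"
  proof (rule summable_comparison_test')
    show "summable (\<lambda>j. (2 + 2 * (norm x)\<^sup>2) * (1 / 4) ^ j)" by (intro summable_mult summable_geometric) simp
    show "norm (\<integral>E. \<bar>f (Suc j) E - f j E\<bar> \<partial>lborel) \<le> (2 + 2 * (norm x)\<^sup>2) * (1 / 4) ^ j" if "j \<ge> 0" for j
      using bound[of j] by simp
  qed
  from L1_limit[OF fi this] obtain h where h: "integrable lborel h" "AE E in lborel. (\<lambda>j. f j E) \<longlonglongrightarrow> h E"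
    "(\<lambda>j. \<integral>E. \<bar>f j E - h E\<bar> \<partial>lborel) \<longlonglongrightarrow> 0" by blast
  have "AE E in lborel. kernel_at V g E \<and> (E \<notin> S \<longrightarrow> (\<forall>m n. g m n E = 0))"
    using sk unfolding spectral_kernel_def by blast
  then have fS: "AE E in lborel. \<forall>j. 0 \<le> f j E \<and> (E \<notin> S \<longrightarrow> f j E = 0)"
  proof eventually_elim
    case (elim E)
    then show ?case unfolding f_def using qform_nonneg F(1) by (auto simp: qform_def)
  qed
  have hS: "AE E in lborel. 0 \<le> h E \<and> (E \<notin> S \<longrightarrow> h E = 0)"
    using h(2) fS
  proof eventually_elim
    case (elim E)
    have "0 \<le> h E" using elim by (intro LIMSEQ_le_const[OF elim(1)]) auto
    moreover have "h E = 0" if "E \<notin> S"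
    proof -
      have "(\<lambda>j. f j E) = (\<lambda>j. 0)" using elim(2) that by auto
      then show ?thesis using elim(1) by (simp add: LIMSEQ_const_iff)
    qed
    ultimately show ?case by blast
  qed
  have "integrable lborel (\<lambda>E. h E * E ^ k) \<and> (\<integral>E. h E * E ^ k \<partial>lborel) = inner x ((ham V ^^ k) x)" for k
  proof -
    \<comment> \<open>A bounded function that agrees with E^k on S, so that L^1 convergence gives
      convergence of the moments.\<close>
    define w where "w E = (if \<bar>E\<bar> \<le> \<bar>R\<bar> then E ^ k else 0)" for E :: real
    have [measurable]: "w \<in> borel_measurable borel" unfolding w_def by measurable
    have wB: "\<bar>w E\<bar> \<le> \<bar>R\<bar> ^ k" for E by (auto simp: w_def power_abs intro: power_mono)
    have wS: "w E = E ^ k" if "E \<in> S" for E using S[OF that] by (auto simp: w_def)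
    have [measurable]: "h \<in> borel_measurable lborel" "\<And>j. f j \<in> borel_measurable lborel" using h(1) fi by auto
    have wf: "(\<integral>E. w E * f j E \<partial>lborel) = (\<integral>E. E ^ k * f j E \<partial>lborel)" for j
    proof (rule integral_cong_AE)
      show "AE E in lborel. w E * f j E = E ^ k * f j E"
        using fS by eventually_elim (use wS in fastforce)
    qed measurable
    have wh: "AE E in lborel. w E * h E = h E * E ^ k"
      using hS by eventually_elim (use wS in fastforce)
    have "integrable lborel (\<lambda>E. w E * h E)"
    proof (rule Bochner_Integration.integrable_bound)
      show "integrable lborel (\<lambda>E. \<bar>R\<bar> ^ k * h E)" using h(1) by simp
      show "AE E in lborel. norm (w E * h E) \<le> norm (\<bar>R\<bar> ^ k * h E)"
        using wB by (auto simp: abs_mult intro!: AE_I2 mult_right_mono)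
    qed measurable
    then have i: "integrable lborel (\<lambda>E. h E * E ^ k)"
      using integrable_cong_AE[OF _ _ wh] by simp
    have "(\<lambda>j. \<integral>E. w E * f j E \<partial>lborel) \<longlonglongrightarrow> (\<integral>E. w E * h E \<partial>lborel)"
      using L1_limit_integral[OF fi h(1,3) _ wB] by simp
    then have "(\<lambda>j. inner (y j) ((ham V ^^ k) (y j))) \<longlonglongrightarrow> (\<integral>E. w E * h E \<partial>lborel)"
      unfolding wf mom(2) .
    moreover have "(\<lambda>j. inner (y j) ((ham V ^^ k) (y j))) \<longlonglongrightarrow> inner x ((ham V ^^ k) x)"
      by (intro tendsto_inner tendsto_ham_pow ylim)
    ultimately have "(\<integral>E. w E * h E \<partial>lborel) = inner x ((ham V ^^ k) x)" using LIMSEQ_unique by blast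
    moreover have "(\<integral>E. w E * h E \<partial>lborel) = (\<integral>E. h E * E ^ k \<partial>lborel)"
      by (rule integral_cong_AE[OF _ _ wh]) measurable
    ultimately show ?thesis using i by simp
  qed
  then show ?thesis using h(1) hS by blast
qed

text \<open>The density h of \<open>spectral_kernel_density\<close> already carries all moments of
  the vector, which leaves no room for a singular part.\<close>

lemma spectral_kernel_purely_ac:
  assumes sk: "spectral_kernel V (schroedinger_spectrum V) g"
  shows "purely_ac_spectrum V"
  unfolding purely_ac_spectrum_def
proof
  fix \<psi> assume \<psi>: "\<psi> \<in> l2"
  obtain R where R: "\<And>E. E \<in> schroedinger_spectrum V \<Longrightarrow> \<bar>E\<bar> \<le> R"
    using compact_imp_bounded[OF compact_schroedinger_spectrum, of V] by (auto simp: bounded_real)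
  obtain h where h: "integrable lborel h" "AE E in lborel. 0 \<le> h E \<and> (E \<notin> schroedinger_spectrum V \<longrightarrow> h E = 0)"
    "\<And>k. integrable lborel (\<lambda>E. h E * E ^ k)"
    "\<And>k. (\<integral>E. h E * E ^ k \<partial>lborel) = inner (Ell2 \<psi>) ((ham V ^^ k) (Ell2 \<psi>))"
    using spectral_kernel_density[OF sk R, of "Ell2 \<psi>"] by blast
  have [measurable]: "h \<in> borel_measurable lborel" using h(1) by auto
  have h0: "AE E in lborel. 0 \<le> h E" using h(2) by auto
  define M where "M = density lborel (\<lambda>E. ennreal (h E))"
  have moment: "integrable M (\<lambda>E. E ^ k)" "(\<integral>E. E ^ k \<partial>M) = inner (Ell2 \<psi>) ((ham V ^^ k) (Ell2 \<psi>))" for k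
    unfolding M_def using h(3,4)[of k] h0
    by (simp_all add: integrable_real_density integral_real_density)
  have "is_spectral_measure V \<psi> M"
    unfolding is_spectral_measure_def
  proof (intro conjI allI)
    show "finite_measure M"
    proof
      have "emeasure M (space M) = (\<integral>\<^sup>+E. ennreal (h E) \<partial>lborel)"
        unfolding M_def by (simp add: emeasure_density)
      also have "\<dots> = ennreal (integral\<^sup>L lborel h)" by (rule nn_integral_eq_integral[OF h(1) h0])
      finally show "emeasure M (space M) \<noteq> \<infinity>" by simp
    qed
    show "sets M = sets borel" by (simp add: M_def)
    show "AE E in M. E \<in> schroedinger_spectrum V"
      unfolding M_def by (subst AE_density, simp) (use h(2) in eventually_elim, auto)
    fix p :: "real poly"
    have T: "(schroedinger V ^^ k) \<psi> \<in> l2" for k using schroedinger_pow_l2[OF \<psi>] .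
    have "l2_inner \<psi> (poly_op p (schroedinger V) \<psi>) = (\<Sum>k\<le>degree p. complex_of_real (coeff p k) * l2_inner \<psi> ((schroedinger V ^^ k) \<psi>))"
      unfolding poly_op_def
      using l2_inner_sum_right[OF \<psi> T finite_atMost, of "\<lambda>k. complex_of_real (coeff p k)" "\<lambda>k. k" "degree p"] by simp
    also have "\<dots> = complex_of_real (\<Sum>k\<le>degree p. coeff p k * (\<integral>E. E ^ k \<partial>M))"
      unfolding l2_inner_pow_real[OF \<psi>] moment(2) by simp
    also have "(\<Sum>k\<le>degree p. coeff p k * (\<integral>E. E ^ k \<partial>M)) = (\<integral>E. poly p E \<partial>M)"
      unfolding poly_altdef using moment(1) by simp
    finally show "l2_inner \<psi> (poly_op p (schroedinger V) \<psi>) = complex_of_real (\<integral>E. poly p E \<partial>M)" .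
  qed
  moreover have "absolutely_continuous lborel M"
    unfolding M_def by (rule absolutely_continuousI_density) simp
  ultimately show "\<exists>M. is_spectral_measure V \<psi> M \<and> absolutely_continuous lborel M" by blast
qed

section \<open>Periodic operators and closed gaps\<close>

abbreviation periodic_pair :: "(int \<Rightarrow>\<^sub>C real) \<Rightarrow> nat \<Rightarrow> bool" where
  "periodic_pair V p \<equiv> real_periodic_potential (apply_bcontfun V) p"

abbreviation band_set :: "(int \<Rightarrow>\<^sub>C real) \<Rightarrow> nat \<Rightarrow> real set" where
  "band_set V p \<equiv> real_periodic_potential.bands (apply_bcontfun V) p"

abbreviation band_kernel :: "(int \<Rightarrow>\<^sub>C real) \<Rightarrow> nat \<Rightarrow> int \<Rightarrow> int \<Rightarrow> real \<Rightarrow> real" where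
  "band_kernel V p \<equiv> real_periodic_potential.kern (apply_bcontfun V) p"

lemma spectral_kernel_periodic:
  assumes "periodic_pair V p" shows "spectral_kernel V (band_set V p) (band_kernel V p)"
proof -
  interpret real_periodic_potential "apply_bcontfun V" p by fact
  have "kernel_at V kern E" for E
    unfolding kernel_at_def using kern_commute kern_sol kern_positive by auto
  then show ?thesis unfolding spectral_kernel_def using kern_integral by (auto simp: kern_def)
qed

text \<open>Weyl sequence: a Bloch solution cut off to N periods fails the equation at most at the
  four sites next to the cuts, with an error independent of N, while its squared norm is at least N
  s.\<close>

lemma band_not_bounded_below:
  assumes per: "periodic_pair V p" and E: "E \<in> band_set V p" and c: "c > 0"
  shows "\<not> bounded_below V E c"
proof
  assume bb: "bounded_below V E c"
  interpret real_periodic_potential "apply_bcontfun V" p by fact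
  let ?V = "apply_bcontfun V"
  have pj: "periodic_jacobi (\<lambda>n. complex_of_real (E - ?V n)) p" by standard (simp add: per)
  have "disc (\<lambda>n. complex_of_real (E - ?V n)) p = complex_of_real (D E)" unfolding of_real_disc D_def ..
  moreover have "\<bar>D E\<bar> \<le> 2" using E by (simp add: bands_def)
  ultimately obtain u k where u: "jacobi_sol (\<lambda>n. complex_of_real (E - ?V n)) u" "u k \<noteq> 0"
    and per1: "\<And>m. cmod (u (m + int p)) = cmod (u m)"
    using bloch_solution[OF pj] by blast
  have per2: "cmod (u (m + int i * int p)) = cmod (u m)" for m i
    by (rule periodic_multiple[of "\<lambda>m. cmod (u m)" p, OF per1])
  define C where "C = (\<Sum>i<p. cmod (u (int i)))"
  have C: "cmod (u m) \<le> C" for m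
  proof -
    obtain i where i: "i < p" "cmod (u m) = cmod (u (int i + 0))"
      using periodic_representative[of "\<lambda>m. cmod (u m)" p, OF per1 p] by blast
    then show ?thesis unfolding C_def by (auto intro!: member_le_sum)
  qed
  have C0: "C \<ge> 0" unfolding C_def by (intro sum_nonneg) auto
  define K where "K = C * (2 + \<bar>E\<bar> + norm V)"
  define s where "s = (cmod (u k))\<^sup>2"
  have s: "s > 0" using u by (simp add: s_def)
  have main: "c\<^sup>2 * (real N * s) \<le> 4 * K\<^sup>2" for N
  proof -
    define b where "b = k + int N * int p"
    have kb: "k \<le> b" by (simp add: b_def)
    define \<psi> where "\<psi> n = (if n \<in> {k..b} then u n else 0)" for n
    have "{n. \<psi> n \<noteq> 0} \<subseteq> {k..b}" by (auto simp: \<psi>_def)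
    then have "\<psi> \<in> l2" by (intro l2_finite_support) (rule finite_subset, auto)
    define y where "y = Ell2 \<psi>"
    have y: "coord y = \<psi>" using \<open>\<psi> \<in> l2\<close> by (simp add: y_def)
    define z where "z = ham V y - E *\<^sub>R y"
    have z: "coord z n = \<psi> (n - 1) + \<psi> (n + 1) - complex_of_real (E - ?V n) * \<psi> n" for n
      by (simp add: z_def y schroedinger_def algebra_simps)
    have z0: "coord z n = 0" if "n \<notin> {k - 1, k, b, b + 1}" for n
    proof -
      have "u (n + 1) + u (n - 1) = complex_of_real (E - ?V n) * u n"
        using u(1) unfolding jacobi_sol_def by blast
      then have "u (n - 1) + u (n + 1) - complex_of_real (E - ?V n) * u n = 0" by (simp add: add.commute)
      moreover have "(n \<in> {k..b} \<and> n - 1 \<in> {k..b} \<and> n + 1 \<in> {k..b}) \<or> (n \<notin> {k..b} \<and> n - 1 \<notin> {k..b} \<and> n + 1 \<notin> {k..b})"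
        using that by auto
      ultimately show ?thesis unfolding z \<psi>_def by auto
    qed
    have psiC: "cmod (\<psi> n) \<le> C" for n using C[of n] C0 by (auto simp: \<psi>_def)
    have zK: "cmod (coord z n) \<le> K" for n
    proof -
      have "cmod (coord z n) \<le> cmod (\<psi> (n - 1)) + cmod (\<psi> (n + 1)) + cmod (complex_of_real (E - ?V n) * \<psi> n)"
        unfolding z using norm_triangle_ineq4 norm_triangle_ineq by (meson add_right_mono order_trans)
      also have "cmod (complex_of_real (E - ?V n) * \<psi> n) = \<bar>E - ?V n\<bar> * cmod (\<psi> n)"
        by (simp only: norm_mult norm_of_real)
      also have "\<dots> \<le> (\<bar>E\<bar> + norm V) * C"
        using norm_bounded[of V n] psiC[of n] by (intro mult_mono) auto
      finally show ?thesis using psiC[of "n - 1"] psiC[of "n + 1"] by (simp add: K_def algebra_simps)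
    qed
    have "(norm z)\<^sup>2 = (\<Sum>n\<in>{k - 1, k, b, b + 1}. (cmod (coord z n))\<^sup>2)"
      unfolding norm_ell2_sq using z0
      by (subst infsum_cong_neutral[where T="{k - 1, k, b, b + 1}" and g="\<lambda>n. (cmod (coord z n))\<^sup>2"]) auto
    also have "\<dots> \<le> (\<Sum>n\<in>{k - 1, k, b, b + 1}. K\<^sup>2)"
      by (intro sum_mono power_mono zK) auto
    also have "\<dots> \<le> 4 * K\<^sup>2"
      using card_insert_le_m1[of 4 "{k, b, b + 1}" "k - 1"] card_insert_le_m1[of 3 "{b, b + 1}" k] card_insert_le_m1[of 2 "{b + 1}" b]
      by (simp add: mult_right_mono)
    finally have "(norm z)\<^sup>2 \<le> 4 * K\<^sup>2" .
    moreover have "real N * s \<le> (norm y)\<^sup>2"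
    proof -
      have "real N * s = (\<Sum>i<N. (cmod (u (k + int i * int p)))\<^sup>2)" by (simp add: per2 s_def)
      also have "\<dots> = (\<Sum>n\<in>(\<lambda>i. k + int i * int p) ` {..<N}. (cmod (u n))\<^sup>2)"
        using p by (subst sum.reindex) (auto simp: inj_on_def)
      also have "\<dots> = (\<Sum>n\<in>(\<lambda>i. k + int i * int p) ` {..<N}. (cmod (coord y n))\<^sup>2)"
      proof (intro sum.cong refl)
        fix n assume "n \<in> (\<lambda>i. k + int i * int p) ` {..<N}"
        then obtain i where i: "i < N" "n = k + int i * int p" by auto
        have "int i * int p \<le> int N * int p" using i by (intro mult_right_mono) auto
        then show "(cmod (u n))\<^sup>2 = (cmod (coord y n))\<^sup>2" using i by (simp add: y \<psi>_def b_def)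
      qed
      also have "\<dots> \<le> (norm y)\<^sup>2" by (intro sum_le_norm_ell2) auto
      finally show ?thesis .
    qed
    moreover have "c\<^sup>2 * (norm y)\<^sup>2 \<le> (norm z)\<^sup>2"
    proof -
      have "c * norm y \<le> norm z" using bb unfolding bounded_below_def z_def by blast
      then have "(c * norm y)\<^sup>2 \<le> (norm z)\<^sup>2" using c by (intro power_mono) auto
      then show ?thesis by (simp add: power_mult_distrib)
    qed
    ultimately show ?thesis
      by (meson mult_left_mono order_trans zero_le_power2)
  qed
  obtain N where "real N > 4 * K\<^sup>2 / (c\<^sup>2 * s)" using reals_Archimedean2 by blast
  then have "4 * K\<^sup>2 < c\<^sup>2 * (real N * s)" using c s by (simp add: field_simps)
  then show False using main[of N] by simp
qed

lemma band_set_bounded: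
  assumes per: "periodic_pair V p" and E: "E \<in> band_set V p" shows "\<bar>E\<bar> \<le> 2 + norm V"
  using band_not_bounded_below[OF assms, of "\<bar>E\<bar> - 2 - norm V"] bounded_below_large[of V E] by force

text \<open>Trigonometric form of the Chebyshev polynomial of the second kind: its zeros are at the
  rational multiples of pi with denominator N.\<close>

lemma continuant_trig: "continuant (\<lambda>_. 2 * cos t) 0 N * sin t = sin (real N * t)" for t :: real
proof (induction N rule: less_induct)
  case (less N)
  consider "N = 0" | "N = 1" | i where "N = Suc (Suc i)" by (metis One_nat_def not0_implies_Suc)
  then show ?case
  proof cases
    case (3 i)
    have "continuant (\<lambda>_. 2 * cos t) 0 N * sin t = 2 * cos t * sin (real (Suc i) * t) - sin (real i * t)"
      using 3 less[of "Suc i"] less[of i] by (simp add: algebra_simps)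
    also have "\<dots> = sin (real N * t)"
    proof -
      have "sin (real N * t) = sin (real (Suc i) * t + t)" "sin (real i * t) = sin (real (Suc i) * t - t)"
        using 3 by (simp_all add: algebra_simps)
      moreover have "2 * c * s - (s * c - d * e) = s * c + d * e" for c d e s :: real by simp
      ultimately show ?thesis by (simp only: sin_add sin_diff)
    qed
    finally show ?thesis .
  qed simp_all
qed

context real_periodic_potential
begin

text \<open>If D = 2 cos (pi r) with r = i / n, the Chebyshev factor for 3 n periods is sin (3 n pi
  r) / sin (pi r) = 0. The factor 3 guarantees the three sites required by
  \<open>disc_gap_opening\<close>.\<close>

lemma closed_gap_exists:
  assumes ab: "E0 \<in> bands" "a < E0" "E0 < b"
  shows "\<exists>E j. a < E \<and> E < b \<and> Suc j \<ge> 3 \<and> continuant (\<lambda>_. D E) 0 (Suc j) = 0"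
proof -
  from bands_interval_endpoints[OF bounded_bands ab(1)] obtain u v where uv: "u < E0" "E0 < v"
    "{u<..<v} \<subseteq> bands" "inj_on D {u..v}" by blast
  \<comment> \<open>A second point of the same band, still below b. D differs at the two points, so
    the rotation numbers between them fill an interval and some are rational.\<close>
  define y0 y1 where "y0 = E0" and "y1 = (E0 + min v b) / 2"
  have y: "y0 < y1" "a < y0" "y1 < b" "u < y0" "y1 < v" using ab uv by (auto simp: y0_def y1_def min_def)
  have yb: "y0 \<in> bands" "y1 \<in> bands" using y uv by auto
  define t0 t1 where "t0 = arccos (D y0 / 2)" and "t1 = arccos (D y1 / 2)"
  have t: "0 < t0" "t0 < pi" "cos t0 = D y0 / 2" "0 < t1" "t1 < pi" "cos t1 = D y1 / 2"
    using yb arccos_lt_bounded[of "D y0 / 2"] arccos_lt_bounded[of "D y1 / 2"]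
    by (auto simp: t0_def t1_def bands_def abs_less_iff cos_arccos)
  have "D y0 \<noteq> D y1" using uv y by (auto dest: inj_onD)
  then have "t0 \<noteq> t1" using t by auto
  then have "min t0 t1 / pi < max t0 t1 / pi" by (intro divide_strict_right_mono) auto
  then obtain r where r: "r \<in> \<rat>" "min t0 t1 / pi < r" "r < max t0 t1 / pi" using Rats_dense_in_real by blast
  then obtain i n where q: "r = real_of_int i / real n" "n > 0" using Rats_cases' by (metis of_int_of_nat_eq zero_less_imp_eq_int)
  have th: "min t0 t1 < pi * r" "pi * r < max t0 t1" using r by (auto simp: field_simps)
  moreover have "0 < min t0 t1" "max t0 t1 < pi" using t by auto
  ultimately have th0: "0 < pi * r" "pi * r < pi" by linarith+
  have between: "min (D y0) (D y1) < 2 * cos (pi * r)" "2 * cos (pi * r) < max (D y0) (D y1)"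
  proof -
    have "cos (max t0 t1) < cos (pi * r)" "cos (pi * r) < cos (min t0 t1)"
      using th th0 t by (intro cos_monotone_0_pi; simp add: min_def max_def)+
    then show "min (D y0) (D y1) < 2 * cos (pi * r)" "2 * cos (pi * r) < max (D y0) (D y1)"
      using t by (auto simp: min_def max_def split: if_splits)
  qed
  have "\<exists>E. y0 \<le> E \<and> E \<le> y1 \<and> D E = 2 * cos (pi * r)"
  proof (cases "D y0 \<le> D y1")
    case True
    then show ?thesis using between y by (intro IVT') (auto intro: continuous_D)
  next
    case False
    then show ?thesis using between y by (intro IVT2') (auto intro: continuous_D)
  qed
  then obtain E where E: "y0 \<le> E" "E \<le> y1" "D E = 2 * cos (pi * r)" by blast
  define j where "j = 3 * n - 1"
  have j: "Suc j = 3 * n" using q by (simp add: j_def)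
  have "real (3 * n) * (pi * r) = pi * real_of_int (3 * i)" using q by simp
  then have "sin (real (3 * n) * (pi * r)) = 0" by (simp only: sin_npi_int mult.commute[of pi]) (metis mult.commute sin_npi_int)
  then have "continuant (\<lambda>_. 2 * cos (pi * r)) 0 (3 * n) * sin (pi * r) = 0"
    using continuant_trig[of "pi * r" "3 * n"] by simp
  moreover have "sin (pi * r) > 0" using th0 by (intro sin_gt_zero)
  ultimately have "continuant (\<lambda>_. D E) 0 (Suc j) = 0" unfolding E(3) j by simp
  then show ?thesis using E y j q(2) by (intro exI[of _ E] exI[of _ j]) auto
qed

end

section \<open>Continuity in parameters and L^1 convergence of kernels\<close>

lemma continuous_on_continuant:
  fixes x :: "'b::topological_space \<Rightarrow> int \<Rightarrow> real"
  assumes "\<And>n. continuous_on S (\<lambda>s. x s n)"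
  shows "continuous_on S (\<lambda>s. continuant (x s) n j)"
proof (induction j rule: less_induct)
  case (less j)
  consider "j = 0" | "j = 1" | i where "j = Suc (Suc i)" by (metis One_nat_def not0_implies_Suc)
  then show ?case
  proof cases
    case (3 i)
    then show ?thesis using less[of i] less[of "Suc i"] by (auto intro!: continuous_intros assms)
  qed simp_all
qed

lemma continuous_on_sol:
  fixes x :: "'b::topological_space \<Rightarrow> int \<Rightarrow> real"
  assumes "\<And>n. continuous_on S (\<lambda>s. x s n)"
  shows "continuous_on S (\<lambda>s. sol (x s) m n)"
  unfolding sol_def by (cases "m \<le> n") (auto intro!: continuous_intros continuous_on_continuant assms)

lemma continuous_on_disc:
  fixes x :: "'b::topological_space \<Rightarrow> int \<Rightarrow> real"
  assumes "\<And>n. continuous_on S (\<lambda>s. x s n)"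
  shows "continuous_on S (\<lambda>s. disc (x s) p)"
  unfolding disc_def by (intro continuous_intros continuous_on_sol assms)

lemma continuous_on_mono_form:
  fixes x :: "'b::topological_space \<Rightarrow> int \<Rightarrow> real"
  assumes "\<And>n. continuous_on S (\<lambda>s. x s n)"
  shows "continuous_on S (\<lambda>s. mono_form (x s) p m n)"
  unfolding mono_form_def by (intro continuous_intros continuous_on_sol assms)

lemma L1_Scheffe:
  fixes f :: "nat \<Rightarrow> 'a \<Rightarrow> real"
  assumes f: "\<And>i. integrable M (f i)" "\<And>i. AE x in M. 0 \<le> f i x" and h: "integrable M h" "AE x in M. 0 \<le> h x"
    and eq: "\<And>i. integral\<^sup>L M (f i) = integral\<^sup>L M h" and lim: "AE x in M. (\<lambda>i. f i x) \<longlonglongrightarrow> h x"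
  shows "(\<lambda>i. \<integral>x. \<bar>f i x - h x\<bar> \<partial>M) \<longlonglongrightarrow> 0"
proof -
  have nn: "(\<integral>\<^sup>+x. norm (k x) \<partial>M) = ennreal (integral\<^sup>L M k)" if "integrable M k" "AE x in M. 0 \<le> k x" for k :: "'a \<Rightarrow> real"
  proof -
    have "(\<integral>\<^sup>+x. norm (k x) \<partial>M) = (\<integral>\<^sup>+x. k x \<partial>M)"
      by (intro nn_integral_cong_AE) (use that(2) in eventually_elim, simp)
    then show ?thesis using nn_integral_eq_integral[OF that] by simp
  qed
  have "(\<lambda>i. \<integral>\<^sup>+x. norm (f i x - h x) \<partial>M) \<longlonglongrightarrow> 0"
    using f(1) h(1) lim nn[OF f] nn[OF h] eq by (intro Scheffe_lemma2) auto
  moreover have "(\<integral>\<^sup>+x. norm (f i x - h x) \<partial>M) = ennreal (\<integral>x. \<bar>f i x - h x\<bar> \<partial>M)" for i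
    using f(1) h(1) by (subst nn_integral_eq_integral) auto
  ultimately have "(\<lambda>i. ennreal (\<integral>x. \<bar>f i x - h x\<bar> \<partial>M)) \<longlonglongrightarrow> ennreal 0" by simp
  then show ?thesis by (subst (asm) tendsto_ennreal_iff) auto
qed

text \<open>Scheffe's lemma asks for nonnegative functions of fixed mass, but off-diagonal kernels
  change sign. It is applied to the form at delta_m + delta_n, from which the off-diagonal entry is
  recovered by polarization.\<close>

lemma kernel_L1_convergence:
  assumes sk: "\<And>i. spectral_kernel (V i) (S i) (g i)" "spectral_kernel W T h"
    and lim: "AE E in lborel. \<forall>m n. (\<lambda>i. g i m n E) \<longlonglongrightarrow> h m n E"
  shows "(\<lambda>i. \<integral>E. \<bar>g i m n E - h m n E\<bar> \<partial>lborel) \<longlonglongrightarrow> 0"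
proof -
  have int: "integrable lborel (g i m n)" "integral\<^sup>L lborel (g i m n) = (if m = n then 1 else 0)"
    "integrable lborel (h m n)" "integral\<^sup>L lborel (h m n) = (if m = n then 1 else 0)" for i m n
    using sk unfolding spectral_kernel_def by auto
  \<comment> \<open>For m = n this is 4 times the diagonal kernel, so the same family also controls
    the diagonal terms to be subtracted.\<close>
  define q where "q g m n E = g m m E + g n n E + 2 * g m n E" for g :: "int \<Rightarrow> int \<Rightarrow> real \<Rightarrow> real" and m n E
  have qpos: "AE E in lborel. 0 \<le> q k m n E" if "spectral_kernel U Z k" for U Z k m n
  proof -
    have "AE E in lborel. kernel_at U k E" using that unfolding spectral_kernel_def by auto
    then show ?thesis
    proof eventually_elim
      case (elim E)
      have sym: "k n m E = k m n E" using elim unfolding kernel_at_def by blast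
      have "finite F \<longrightarrow> 0 \<le> (\<Sum>m\<in>F. \<Sum>n\<in>F. a m * a n * k m n E)" for F a
        using elim unfolding kernel_at_def by blast
      from this[of "{m, n}" "\<lambda>_. 1"] show ?case by (cases "m = n") (auto simp: q_def sym)
    qed
  qed
  have L: "(\<lambda>i. \<integral>E. \<bar>q (g i) m n E - q h m n E\<bar> \<partial>lborel) \<longlonglongrightarrow> 0" for m n
  proof (rule L1_Scheffe)
    show "AE E in lborel. (\<lambda>i. q (g i) m n E) \<longlonglongrightarrow> q h m n E"
      using lim unfolding q_def by eventually_elim (intro tendsto_intros, auto)
    show "integral\<^sup>L lborel (q (g i) m n) = integral\<^sup>L lborel (q h m n)" for i
      unfolding q_def[abs_def] using int by simp
  qed (use int qpos[OF sk(1)] qpos[OF sk(2)] in \<open>auto simp: q_def[abs_def]\<close>)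
  have qi: "integrable lborel (\<lambda>E. q (g i) m n E - q h m n E)" for i m n
    unfolding q_def using int by auto
  show ?thesis
  proof (rule Lim_null_comparison)
    let ?I = "\<lambda>i m n. \<integral>E. \<bar>q (g i) m n E - q h m n E\<bar> \<partial>lborel"
    show "\<forall>\<^sub>F i in sequentially. norm (\<integral>E. \<bar>g i m n E - h m n E\<bar> \<partial>lborel) \<le> ?I i m n + ?I i m m + ?I i n n"
    proof (intro always_eventually allI)
      fix i
      have "(\<integral>E. \<bar>g i m n E - h m n E\<bar> \<partial>lborel) \<le> (\<integral>E. \<bar>q (g i) m n E - q h m n E\<bar> + \<bar>q (g i) m m E - q h m m E\<bar> + \<bar>q (g i) n n E - q h n n E\<bar> \<partial>lborel)"
      proof (rule integral_mono)
        show "\<bar>g i m n E - h m n E\<bar> \<le> \<bar>q (g i) m n E - q h m n E\<bar> + \<bar>q (g i) m m E - q h m m E\<bar> + \<bar>q (g i) n n E - q h n n E\<bar>" for E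
          unfolding q_def by linarith
      qed (use int qi in auto)
      also have "\<dots> = ?I i m n + ?I i m m + ?I i n n" using qi by simp
      finally show "norm (\<integral>E. \<bar>g i m n E - h m n E\<bar> \<partial>lborel) \<le> ?I i m n + ?I i m m + ?I i n n" by simp
    qed
    show "(\<lambda>i. ?I i m n + ?I i m m + ?I i n n) \<longlonglongrightarrow> 0"
      using tendsto_add[OF tendsto_add[OF L[of m n] L[of m m]] L[of n n]] by simp
  qed
qed

section \<open>Opening a gap\<close>

text \<open>The pattern 1, -1 at sites 1 and 2 modulo q appears in E - V with opposite sign, as
  \<open>disc_gap_opening\<close> expects. For q >= 3 the two residues are distinct and site q stays
  unchanged.\<close>

definition bump :: "nat \<Rightarrow> int \<Rightarrow>\<^sub>C real" where
  "bump q = Bcontfun (\<lambda>n. if n mod int q = 1 then 1 else if n mod int q = 2 then -1 else 0)"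

lemma apply_bump: "apply_bcontfun (bump q) n = (if n mod int q = 1 then 1 else if n mod int q = 2 then -1 else 0)"
proof -
  have "(\<lambda>n. if n mod int q = 1 then 1 else if n mod int q = 2 then -1 else 0 :: real) \<in> bcontfun"
    unfolding bcontfun_def by (auto intro!: boundedI[where B=1] split: if_splits)
  then show ?thesis unfolding bump_def by (subst Bcontfun_inverse) auto
qed

lemma periodic_pair_bump:
  assumes "periodic_pair V q" shows "periodic_pair (V + t *\<^sub>R bump q) q"
proof -
  interpret real_periodic_potential "apply_bcontfun V" q by fact
  show ?thesis by standard (auto simp: p per apply_bump)
qed

text \<open>Attached to the points of the band set rather than to an enumeration of bands: the
  homogeneity estimate starts from a point y of the bands.\<close>

definition band_length_ge :: "(int \<Rightarrow>\<^sub>C real) \<Rightarrow> nat \<Rightarrow> real \<Rightarrow> bool" where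
  "band_length_ge V p m \<longleftrightarrow>
     (\<forall>x\<in>band_set V p. \<exists>u v. u < x \<and> x < v \<and> {u<..<v} \<subseteq> band_set V p \<and> m \<le> v - u)"

text \<open>D changes by 4 across a band, so the mean value theorem gives the length 4 / L.\<close>

lemma band_length_ge_derivative:
  assumes pp: "periodic_pair V p" and L: "L > 0" and R: "2 + norm V \<le> R"
    and D': "\<And>E. \<bar>E\<bar> \<le> R \<Longrightarrow> \<bar>real_periodic_potential.D' (apply_bcontfun V) p E\<bar> \<le> L"
  shows "band_length_ge V p (4 / L)"
  unfolding band_length_ge_def
proof
  interpret real_periodic_potential "apply_bcontfun V" p by fact
  fix x assume x: "x \<in> bands"
  from bands_interval_endpoints[OF bounded_bands x] obtain u v where uv: "u < x" "x < v" "{u<..<v} \<subseteq> bands" "\<bar>D v - D u\<bar> = 4"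
    by blast
  obtain z where z: "u < z" "z < v" "D v - D u = (v - u) * D' z"
    using MVT2[of u v D D'] uv DERIV_D by auto
  then have "z \<in> bands" using uv by auto
  then have "\<bar>D' z\<bar> \<le> L" using D' band_set_bounded[OF pp] R by (meson order_trans)
  have "4 = (v - u) * \<bar>D' z\<bar>" using uv z by (simp add: abs_mult)
  also have "\<dots> \<le> (v - u) * L" using \<open>\<bar>D' z\<bar> \<le> L\<close> uv by (intro mult_left_mono) auto
  finally have "4 / L \<le> v - u" using L by (simp add: field_simps)
  then show "\<exists>u v. u < x \<and> x < v \<and> {u<..<v} \<subseteq> bands \<and> 4 / L \<le> v - u" using uv by blast
qed

text \<open>\<open>D'\<close> is continuous in (t, E) and hence bounded on the compact set of
  parameters and energies that can occur; R exceeds the modulus of every band energy of the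
  family.\<close>

lemma bump_family_band_length:
  assumes per: "periodic_pair V q"
  shows "\<exists>m>0. \<forall>t\<in>{0..1}. band_length_ge (V + t *\<^sub>R bump q) q m"
proof -
  define R where "R = 2 + norm V + norm (bump q)"
  define f where "f s = (\<Sum>i<q. mono_form (\<lambda>n. snd s - apply_bcontfun (V + fst s *\<^sub>R bump q) n) q (int i + 1) (int i + 1)) / 2"
    for s :: "real \<times> real"
  have "continuous_on ({0..1} \<times> {-R..R}) f"
    unfolding f_def by (intro continuous_intros continuous_on_mono_form) (auto intro!: continuous_intros)
  moreover have "compact ({0..1} \<times> {-R..R} :: (real \<times> real) set)" by (intro compact_Times compact_Icc)
  ultimately have "bounded (f ` ({0..1} \<times> {-R..R}))" using compact_continuous_image compact_imp_bounded by blast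
  then obtain B where B: "\<And>s. s \<in> {0..1} \<times> {-R..R} \<Longrightarrow> \<bar>f s\<bar> \<le> B" unfolding bounded_iff by auto
  define L where "L = \<bar>B\<bar> + 1"
  have "band_length_ge (V + t *\<^sub>R bump q) q (4 / L)" if t: "t \<in> {0..1}" for t
  proof (rule band_length_ge_derivative[OF periodic_pair_bump[OF per], where R=R])
    interpret real_periodic_potential "apply_bcontfun (V + t *\<^sub>R bump q)" q by (rule periodic_pair_bump[OF per])
    show "\<bar>D' E\<bar> \<le> L" if "\<bar>E\<bar> \<le> R" for E
    proof -
      have "(t, E) \<in> {0..1} \<times> {-R..R}" using t that by auto
      from B[OF this] show ?thesis unfolding D'_def f_def L_def fst_conv snd_conv by linarith
    qed
    have "norm (V + t *\<^sub>R bump q) \<le> norm V + \<bar>t\<bar> * norm (bump q)" by (metis norm_scaleR norm_triangle_ineq)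
    also have "\<bar>t\<bar> * norm (bump q) \<le> 1 * norm (bump q)" using t by (intro mult_right_mono) auto
    finally show "2 + norm (V + t *\<^sub>R bump q) \<le> R" by (simp add: R_def)
  qed (simp add: L_def)
  moreover have "4 / L > 0" by (simp add: L_def)
  ultimately show ?thesis by blast
qed

text \<open>D and the form depend continuously on t, and both |D| < 2 and |D| > 2 are open
  conditions. Only the finitely many edges are excluded, so this is convergence almost
  everywhere.\<close>

lemma bump_kernel_tendsto:
  assumes per: "periodic_pair V q" and E: "\<bar>real_periodic_potential.D (apply_bcontfun V) q E\<bar> \<noteq> 2"
    and t: "t \<longlonglongrightarrow> (0::real)"
  shows "(\<lambda>i. band_kernel (V + t i *\<^sub>R bump q) q m n E) \<longlonglongrightarrow> band_kernel V q m n E"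
    "E \<in> band_set V q \<Longrightarrow> eventually (\<lambda>i. E \<in> band_set (V + t i *\<^sub>R bump q) q) sequentially"
proof -
  let ?W = "\<lambda>i. V + t i *\<^sub>R bump q"
  let ?D = "\<lambda>i. real_periodic_potential.D (apply_bcontfun (?W i)) q E" and ?B = "\<lambda>i. mono_form (\<lambda>n. E - apply_bcontfun (?W i) n) q"
  interpret V: real_periodic_potential "apply_bcontfun V" q by fact
  have per': "periodic_pair (?W i) q" for i by (rule periodic_pair_bump[OF per])
  note D_def' = real_periodic_potential.D_def[OF per'] and b_def' = real_periodic_potential.bands_def[OF per']
    and k_def' = real_periodic_potential.kern_def[OF per']
  have con: "continuous_on UNIV (\<lambda>s. disc (\<lambda>n. E - apply_bcontfun (V + s *\<^sub>R bump q) n) q)"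
    "continuous_on UNIV (\<lambda>s. mono_form (\<lambda>n. E - apply_bcontfun (V + s *\<^sub>R bump q) n) q m n)" for m n
    by (intro continuous_on_disc continuous_on_mono_form; auto intro!: continuous_intros)+
  have Dl: "(\<lambda>i. ?D i) \<longlonglongrightarrow> V.D E"
    using continuous_on_tendsto_compose[OF con(1) t] unfolding D_def' V.D_def by simp
  have Bl: "(\<lambda>i. ?B i m n) \<longlonglongrightarrow> V.B E m n" for m n
    using continuous_on_tendsto_compose[OF con(2) t] by simp
  have abs: "(\<lambda>i. \<bar>?D i\<bar>) \<longlonglongrightarrow> \<bar>V.D E\<bar>"
    by (intro tendsto_intros Dl)
  show ev: "eventually (\<lambda>i. E \<in> band_set (?W i) q) sequentially" if "E \<in> band_set V q"
    using order_tendstoD(2)[OF abs, of 2] that unfolding b_def' V.bands_def by simp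
  show "(\<lambda>i. band_kernel (?W i) q m n E) \<longlonglongrightarrow> V.kern m n E"
  proof (cases "E \<in> V.bands")
    case True
    have "(\<lambda>i. sgn (?B i 0 0) * ?B i m n
        / (2 * pi * sqrt (4 - (?D i)\<^sup>2)))
       \<longlonglongrightarrow> sgn (V.B E 0 0) * V.B E m n / (2 * pi * sqrt (4 - (V.D E)\<^sup>2))"
      using V.four_minus_D[OF True] V.B_nonzero[OF True, of 0] by (intro tendsto_intros Dl Bl) auto
    moreover have "eventually (\<lambda>i. sgn (?B i 0 0) * ?B i m n
        / (2 * pi * sqrt (4 - (?D i)\<^sup>2))
       = band_kernel (?W i) q m n E) sequentially"
      using ev[OF True] by eventually_elim (simp only: k_def' if_True)
    ultimately show ?thesis using True unfolding V.kern_def by (simp add: tendsto_cong)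
  next
    case False
    then have "\<bar>V.D E\<bar> > 2" using E by (simp add: V.bands_def)
    then have "eventually (\<lambda>i. \<bar>?D i\<bar> > 2) sequentially"
      by (intro order_tendstoD(1)[OF abs])
    then have "eventually (\<lambda>i. band_kernel (?W i) q m n E = 0) sequentially"
      by eventually_elim (subst k_def', subst b_def', simp)
    then show ?thesis using False by (simp add: V.kern_def tendsto_eventually)
  qed
qed

text \<open>A finite index window K keeps the requirement finite at each step. With K growing along
  the sequence, every fixed kernel entry is controlled from some step on.\<close>

definition close_pair :: "(int \<Rightarrow>\<^sub>C real) \<Rightarrow> nat \<Rightarrow> (int \<Rightarrow>\<^sub>C real) \<Rightarrow> nat \<Rightarrow> int \<Rightarrow> real \<Rightarrow> bool" where
  "close_pair V p V' p' K e \<longleftrightarrow> dist V' V \<le> e \<and> measure lborel (band_set V p - band_set V' p') \<le> e \<and>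
     (\<forall>i\<in>{-K..K}. \<forall>j\<in>{-K..K}. (\<integral>E. \<bar>band_kernel V' p' i j E - band_kernel V p i j E\<bar> \<partial>lborel) \<le> e)"

text \<open>The order of quantifiers matters: m precedes e, so that e can later be a fraction of m.
  An interval that misses the bands needs no change; otherwise a closed gap inside it is
  opened.\<close>

lemma gap_step:
  assumes per: "periodic_pair V p" and ab: "a < b" and len: "band_length_ge V p M" and M: "M > 0"
  shows "\<exists>m>0. m \<le> M \<and> (\<forall>e>0. \<exists>V' p'. periodic_pair V' p' \<and> band_length_ge V' p' m \<and>
    close_pair V p V' p' K e \<and>
    (\<exists>E \<gamma>. a < E \<and> E < b \<and> \<gamma> > 0 \<and> (\<forall>y\<in>band_set V' p'. \<gamma> \<le> \<bar>y - E\<bar>)))"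
proof (cases "band_set V p \<inter> {a<..<b} = {}")
  case True
  show ?thesis
  proof (rule exI[of _ M], intro conjI allI impI)
    fix e :: real assume e: "e > 0"
    have "\<forall>y\<in>band_set V p. (b - a) / 2 \<le> \<bar>y - (a + b) / 2\<bar>"
    proof
      fix y assume "y \<in> band_set V p"
      then have "y \<le> a \<or> b \<le> y" using True by (meson disjoint_iff greaterThanLessThan_iff not_less)
      then show "(b - a) / 2 \<le> \<bar>y - (a + b) / 2\<bar>" by (auto simp: abs_if field_simps)
    qed
    then have "\<exists>E \<gamma>. a < E \<and> E < b \<and> \<gamma> > 0 \<and> (\<forall>y\<in>band_set V p. \<gamma> \<le> \<bar>y - E\<bar>)"
      using ab by (intro exI[of _ "(a + b) / 2"] exI[of _ "(b - a) / 2"]) auto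
    then show "\<exists>V' p'. periodic_pair V' p' \<and> band_length_ge V' p' M \<and>
        close_pair V p V' p' K e \<and>
        (\<exists>E \<gamma>. a < E \<and> E < b \<and> \<gamma> > 0 \<and> (\<forall>y\<in>band_set V' p'. \<gamma> \<le> \<bar>y - E\<bar>))"
      using per len e by (intro exI[of _ V] exI[of _ p]) (auto simp: close_pair_def)
  qed (use M in auto)
next
  case False
  interpret p: real_periodic_potential "apply_bcontfun V" p by fact
  from False obtain E0 where "E0 \<in> p.bands" "a < E0" "E0 < b" by auto
  from p.closed_gap_exists[OF this] obtain E j where E: "a < E" "E < b" "Suc j \<ge> 3"
    "continuant (\<lambda>_. p.D E) 0 (Suc j) = 0" by blast
  \<comment> \<open>Regarded with this longer period, the unchanged potential has a vanishing form
    at E.\<close>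
  define q where "q = Suc j * p"
  have perq: "periodic_pair V q" unfolding q_def by (rule p.real_periodic_multi)
  interpret q: real_periodic_potential "apply_bcontfun V" q by (rule perq)
  have q3: "q \<ge> 3" using E(3) p.p unfolding q_def by (metis One_nat_def Suc_leI le_trans mult.right_neutral mult_le_mono2)
  have zero: "mono_form (\<lambda>n. E - apply_bcontfun V n) q m n = 0" for m n
    unfolding q_def p.multi_period(1) E(4) by simp
  have D2: "\<bar>q.D E\<bar> = 2"
  proof -
    have "4 - (q.D E)\<^sup>2 = 0" using p.multi_period(2)[of j E] E(4) unfolding q_def by simp
    then have "(\<bar>q.D E\<bar>)\<^sup>2 = 2\<^sup>2" by simp
    then show ?thesis by (subst (asm) power2_eq_iff_nonneg) auto
  qed
  obtain m0 where m0: "m0 > 0" "\<And>t. t \<in> {0..1} \<Longrightarrow> band_length_ge (V + t *\<^sub>R bump q) q m0"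
    using bump_family_band_length[OF perq] by blast
  define t where "t i = 1 / real (Suc i)" for i
  have t: "t i \<in> {0..1}" "t i > 0" for i by (auto simp: t_def)
  have t0: "t \<longlonglongrightarrow> 0" unfolding t_def using LIMSEQ_inverse_real_of_nat by (simp add: inverse_eq_divide)
  define W where "W i = V + t i *\<^sub>R bump q" for i
  have perW: "periodic_pair (W i) q" for i unfolding W_def by (rule periodic_pair_bump[OF perq])
  have kq: "AE E in lborel. \<forall>m n. q.kern m n E = p.kern m n E"
    using q.AE_not_edge by eventually_elim (use p.kern_multi_period[of j] in \<open>auto simp: q_def\<close>)
  have lim1: "(\<lambda>i. dist (W i) V) \<longlonglongrightarrow> 0"
  proof -
    have "dist (W i) V = t i * norm (bump q)" for i using t(2)[of i] by (simp add: W_def dist_norm)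
    moreover have "(\<lambda>i. t i * norm (bump q)) \<longlonglongrightarrow> 0 * norm (bump q)" by (intro tendsto_intros t0)
    ultimately show ?thesis by simp
  qed
  have sets: "p.bands \<in> sets borel" "band_set (W i) q \<in> sets borel" for i
    using p.open_bands real_periodic_potential.open_bands[OF perW] by auto
  have emp: "emeasure lborel p.bands < \<infinity>"
    using p.bounded_bands by (intro emeasure_bounded_finite)
  \<comment> \<open>Every band energy off the edges remains a band energy for small t; dominated
    convergence does the rest.\<close>
  have lim2: "(\<lambda>i. measure lborel (p.bands - band_set (W i) q)) \<longlonglongrightarrow> 0"
  proof -
    have "(\<lambda>i. \<integral>E. indicator (p.bands - band_set (W i) q) E \<partial>lborel) \<longlonglongrightarrow> (\<integral>E. 0 \<partial>(lborel :: real measure) :: real)"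
    proof (rule integral_dominated_convergence[where w="indicator p.bands"])
      show "AE E in lborel. (\<lambda>i. indicat_real (p.bands - band_set (W i) q) E) \<longlonglongrightarrow> 0"
        using q.AE_not_edge
      proof eventually_elim
        case (elim E)
        show ?case
        proof (cases "E \<in> p.bands")
          case True
          then have "E \<in> q.bands" using p.bands_multi_period[of j] elim by (auto simp: q_def)
          then have "eventually (\<lambda>i. E \<in> band_set (W i) q) sequentially"
            unfolding W_def by (rule bump_kernel_tendsto(2)[OF perq elim t0])
          then have "eventually (\<lambda>i. indicat_real (p.bands - band_set (W i) q) E = 0) sequentially"
            by eventually_elim simp
          then show ?thesis by (rule tendsto_eventually)
        qed simp
      qed
    qed (use sets emp in \<open>auto simp: indicator_def\<close>)
    then show ?thesis using sets by simp
  qed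
  have lim3: "(\<lambda>i. \<integral>E. \<bar>band_kernel (W i) q m n E - p.kern m n E\<bar> \<partial>lborel) \<longlonglongrightarrow> 0" for m n
  proof (rule kernel_L1_convergence[OF spectral_kernel_periodic[OF perW] spectral_kernel_periodic[OF per]])
    show "AE E in lborel. \<forall>m n. (\<lambda>i. band_kernel (W i) q m n E) \<longlonglongrightarrow> p.kern m n E"
      using q.AE_not_edge kq
    proof eventually_elim
      case (elim E)
      then show ?case using bump_kernel_tendsto(1)[OF perq elim(1) t0] unfolding W_def by simp
    qed
  qed
  have gap: "\<exists>\<gamma>>0. \<forall>y\<in>band_set (W i) q. \<gamma> \<le> \<bar>y - E\<bar>" for i
  proof -
    interpret W: real_periodic_potential "apply_bcontfun (W i)" q by (rule perW)
    have "W.D E = q.D E * (1 + (t i)\<^sup>2 / 2)"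
      unfolding W.D_def q.D_def
    proof (rule disc_gap_opening[OF q3 _ zero])
      show "E - apply_bcontfun V (n + int q) = E - apply_bcontfun V n" for n by (simp add: q.per)
      show "E - apply_bcontfun (W i) 1 = E - apply_bcontfun V 1 - t i" "E - apply_bcontfun (W i) 2 = E - apply_bcontfun V 2 + t i"
        using q3 by (simp_all add: W_def apply_bump)
      fix m assume m: "2 < m" "m \<le> int q"
      then have "m mod int q \<noteq> 1" "m mod int q \<noteq> 2" by (cases "m = int q"; simp)+
      then show "E - apply_bcontfun (W i) m = E - apply_bcontfun V m" by (simp add: W_def apply_bump)
    qed
    then have "\<bar>W.D E\<bar> = 2 * (1 + (t i)\<^sup>2 / 2)" using D2 by (simp add: abs_mult)
    then have "\<bar>W.D E\<bar> > 2" using t(2)[of i] by simp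
    moreover have "open {x. \<bar>W.D x\<bar> > 2}" by (intro open_Collect_less continuous_intros W.continuous_D)
    ultimately obtain \<gamma> where \<gamma>: "\<gamma> > 0" "\<And>y. dist y E < \<gamma> \<Longrightarrow> \<bar>W.D y\<bar> > 2" unfolding open_dist by blast
    have "\<gamma> \<le> \<bar>y - E\<bar>" if "y \<in> W.bands" for y
      using \<gamma>(2)[of y] that by (force simp: W.bands_def dist_real_def)
    then show ?thesis using \<gamma>(1) by blast
  qed
  show ?thesis
  proof (rule exI[of _ "min M m0"], intro conjI allI impI)
    fix e :: real assume e: "e > 0"
    have "eventually (\<lambda>i. dist (W i) V < e \<and> measure lborel (p.bands - band_set (W i) q) < e \<and>
       (\<forall>m\<in>{-K..K}. \<forall>n\<in>{-K..K}. (\<integral>E. \<bar>band_kernel (W i) q m n E - p.kern m n E\<bar> \<partial>lborel) < e)) sequentially"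
      by (intro eventually_conj eventually_ball_finite ballI order_tendstoD(2)[OF lim1 e] order_tendstoD(2)[OF lim2 e]
          order_tendstoD(2)[OF lim3 e]) auto
    then obtain i where i: "dist (W i) V < e" "measure lborel (p.bands - band_set (W i) q) < e"
       "\<forall>m\<in>{-K..K}. \<forall>n\<in>{-K..K}. (\<integral>E. \<bar>band_kernel (W i) q m n E - p.kern m n E\<bar> \<partial>lborel) < e"
      using eventually_happens by force
    have "band_length_ge (W i) q (min M m0)"
      using m0(2)[OF t(1)[of i]] unfolding band_length_ge_def W_def by (meson min.coboundedI2)
    moreover have "close_pair V p (W i) q K e"
      unfolding close_pair_def using i less_imp_le by blast
    moreover obtain \<gamma> where "\<gamma> > 0" "\<forall>y\<in>band_set (W i) q. \<gamma> \<le> \<bar>y - E\<bar>" using gap[of i] by blast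
    ultimately show "\<exists>V' p'. periodic_pair V' p' \<and> band_length_ge V' p' (min M m0) \<and>
        close_pair V p V' p' K e \<and>
        (\<exists>E \<gamma>. a < E \<and> E < b \<and> \<gamma> > 0 \<and> (\<forall>y\<in>band_set V' p'. \<gamma> \<le> \<bar>y - E\<bar>))"
      using perW[of i] E(1,2) by (intro exI[of _ "W i"] exI[of _ q]) blast
  qed (use M m0 in auto)
qed

section \<open>The limit potential\<close>

text \<open>Enumeration of the rational intervals. Codes of pairs with r >= s fall back to (0,1), so
  that every index names a nonempty interval.\<close>

definition rat_interval :: "nat \<Rightarrow> real \<times> real" where
  "rat_interval k = (let (r, s) = from_nat k in if r < s then (of_rat r, of_rat s) else (0, 1))"

lemma rat_interval_less: "fst (rat_interval k) < snd (rat_interval k)"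
  by (auto simp: rat_interval_def of_rat_less split: prod.splits)

lemma rat_interval_dense:
  assumes "a < b" shows "\<exists>k. a < fst (rat_interval k) \<and> snd (rat_interval k) < b"
proof -
  obtain r where r: "a < of_rat r" "of_rat r < b" using of_rat_dense[OF assms] by blast
  obtain s where s: "of_rat r < (of_rat s :: real)" "of_rat s < b" using of_rat_dense[OF r(2)] by blast
  have "rat_interval (to_nat (r, s)) = (of_rat r, of_rat s)" using s(1) by (simp add: rat_interval_def of_rat_less)
  then show ?thesis using r s by (intro exI[of _ "to_nat (r, s)"]) simp
qed

lemma periodic_seq_iff: "periodic_seq (apply_bcontfun V) \<longleftrightarrow> (\<exists>p. periodic_pair V p)"
proof
  assume "periodic_seq (apply_bcontfun V)"
  then obtain p where p: "p > 0" "\<And>n. apply_bcontfun V (n + p) = apply_bcontfun V n" unfolding periodic_seq_def by blast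
  have "periodic_pair V (nat p)" by standard (use p in auto)
  then show "\<exists>p. periodic_pair V p" ..
next
  assume "\<exists>p. periodic_pair V p"
  then obtain p where "periodic_pair V p" ..
  then interpret real_periodic_potential "apply_bcontfun V" p .
  show "periodic_seq (apply_bcontfun V)" unfolding periodic_seq_def using p per by (intro exI[of _ "int p"]) auto
qed

text \<open>\<open>b k\<close> bounds the total size of all later perturbations. The length \<open>m (Suc k)\<close> is chosen
  before the perturbation of \<open>V k\<close>, so that the perturbation can be small compared to it.\<close>

locale gap_sequence =
  fixes V :: "nat \<Rightarrow> int \<Rightarrow>\<^sub>C real" and p :: "nat \<Rightarrow> nat" and m b :: "nat \<Rightarrow> real" and \<kappa> :: real
  assumes per: "periodic_pair (V k) (p k)" and len: "band_length_ge (V k) (p k) (m k)"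
    and m_pos: "m k > 0" and b_pos: "b k > 0" and \<kappa>: "\<kappa> > 0" "\<kappa> < 1 / 6"
    and m_half: "m (Suc k) \<le> m k / 2" and b_half: "b (Suc k) \<le> b k / 2" and b_m: "b (Suc k) \<le> \<kappa> * m (Suc k)"
    and close: "close_pair (V k) (p k) (V (Suc k)) (p (Suc k)) (int k) (min (b k / 2) (\<kappa> * m (Suc k)))"
    and gap: "\<exists>E. fst (rat_interval k) < E \<and> E < snd (rat_interval k) \<and> (\<forall>y\<in>band_set (V (Suc k)) (p (Suc k)). 2 * b (Suc k) \<le> \<bar>y - E\<bar>)"
begin

abbreviation U where "U k \<equiv> band_set (V k) (p k)"

lemma V_dist: "dist (V (Suc k)) (V k) \<le> min (b k / 2) (\<kappa> * m (Suc k))"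
  and loss: "measure lborel (U k - U (Suc k)) \<le> min (b k / 2) (\<kappa> * m (Suc k))"
  and L1: "i \<in> {- int k..int k} \<Longrightarrow> j \<in> {- int k..int k} \<Longrightarrow>
     (\<integral>E. \<bar>band_kernel (V (Suc k)) (p (Suc k)) i j E - band_kernel (V k) (p k) i j E\<bar> \<partial>lborel) \<le> b k / 2"
  using close[of k] unfolding close_pair_def by auto

lemma geometric_bound:
  fixes a :: "nat \<Rightarrow> real"
  assumes "\<And>k. a (Suc k) \<le> a k / 2" shows "a (k + j) \<le> a k / 2 ^ j"
proof (induction j)
  case (Suc j)
  have "a (k + Suc j) \<le> a (k + j) / 2" using assms[of "k + j"] by simp
  also have "\<dots> \<le> a k / 2 ^ j / 2" using Suc by simp
  finally show ?case by simp
qed simp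

lemmas b_geo = geometric_bound[of b, OF b_half] and m_geo = geometric_bound[of m, OF m_half]

lemma geometric_tendsto:
  fixes a :: "nat \<Rightarrow> real"
  assumes "\<And>k. a (Suc k) \<le> a k / 2" "\<And>k. a k > 0" shows "a \<longlonglongrightarrow> 0"
proof (rule Lim_null_comparison)
  show "\<forall>\<^sub>F k in sequentially. norm (a k) \<le> a 0 * (1 / 2) ^ k"
    using geometric_bound[of a 0, OF assms(1)] assms(2) by (simp add: power_divide less_imp_le)
  show "(\<lambda>k. a 0 * (1 / 2) ^ k) \<longlonglongrightarrow> 0" by (intro tendsto_mult_right_zero LIMSEQ_power_zero) simp
qed

lemma b_tendsto: "b \<longlonglongrightarrow> 0" and m_tendsto: "m \<longlonglongrightarrow> 0"
  using geometric_tendsto b_half b_pos m_half m_pos by blast+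

lemma V_dist_total: "dist (V (k + j)) (V k) \<le> b k"
proof -
  \<comment> \<open>The induction carries this stronger bound: a step of size b / 2 is paid for by
    the decrease of b, which is at least as large.\<close>
  have "dist (V (k + j)) (V k) \<le> b k - b (k + j)"
  proof (induction j)
    case (Suc j)
    have "dist (V (k + Suc j)) (V k) \<le> dist (V (Suc (k + j))) (V (k + j)) + dist (V (k + j)) (V k)"
      using dist_triangle[of "V (k + Suc j)" "V k" "V (k + j)"] by simp
    also have "\<dots> \<le> b (k + j) / 2 + (b k - b (k + j))" using V_dist[of "k + j"] Suc by simp
    also have "\<dots> \<le> b k - b (Suc (k + j))" using b_half[of "k + j"] by linarith
    finally show ?case by simp
  qed simp
  then show ?thesis using b_pos[of "k + j"] by linarith
qed

lemma limit_exists: "\<exists>W. \<forall>k. dist W (V k) \<le> b k"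
proof -
  have le: "\<bar>apply_bcontfun (V i) n - apply_bcontfun (V k) n\<bar> \<le> b k" if "i \<ge> k" for i k n
    using dist_bounded[of "V i" n "V k"] V_dist_total[of k "i - k"] that by (simp add: dist_real_def)
  have "convergent (\<lambda>k. apply_bcontfun (V k) n)" for n
  proof (rule real_Cauchy_convergent, rule metric_CauchyI)
    fix e :: real assume "e > 0"
    then have "eventually (\<lambda>k. b k < e / 2) sequentially" by (intro order_tendstoD(2)[OF b_tendsto]) simp
    then obtain N where N: "b N < e / 2" using eventually_happens by force
    have "dist (apply_bcontfun (V i) n) (apply_bcontfun (V j) n) < e" if "i \<ge> N" "j \<ge> N" for i j
      using le[OF that(1), of n] le[OF that(2), of n] N unfolding dist_real_def by linarith
    then show "\<exists>N. \<forall>i\<ge>N. \<forall>j\<ge>N. dist (apply_bcontfun (V i) n) (apply_bcontfun (V j) n) < e" by blast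
  qed
  then have "\<forall>n. \<exists>l. (\<lambda>k. apply_bcontfun (V k) n) \<longlonglongrightarrow> l" by (simp add: convergent_def)
  then obtain l where l: "\<And>n. (\<lambda>k. apply_bcontfun (V k) n) \<longlonglongrightarrow> l n" by metis
  have lb: "\<bar>l n - apply_bcontfun (V k) n\<bar> \<le> b k" for n k
  proof (rule LIMSEQ_le_const2)
    show "(\<lambda>i. \<bar>apply_bcontfun (V i) n - apply_bcontfun (V k) n\<bar>) \<longlonglongrightarrow> \<bar>l n - apply_bcontfun (V k) n\<bar>"
      by (intro tendsto_intros l)
  qed (use le in blast)
  have "\<bar>l n\<bar> \<le> norm (V 0) + b 0" for n
    using lb[of n 0] norm_bounded[of "V 0" n] by simp
  then have "l \<in> bcontfun" unfolding bcontfun_def by (auto intro!: boundedI[where B="norm (V 0) + b 0"])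
  then have "apply_bcontfun (Bcontfun l) = l" by (rule Bcontfun_inverse)
  then have "dist (Bcontfun l) (V k) \<le> b k" for k
    using lb by (intro dist_bound) (simp add: dist_real_def)
  then show ?thesis by blast
qed

definition W where "W = (SOME W. \<forall>k. dist W (V k) \<le> b k)"

lemma W_dist: "dist W (V k) \<le> b k"
  using someI_ex[OF limit_exists] unfolding W_def by blast

lemma V_tendsto: "V \<longlonglongrightarrow> W"
proof (rule metric_LIMSEQ_I)
  fix e :: real assume "e > 0"
  then have "eventually (\<lambda>k. b k < e) sequentially" by (intro order_tendstoD(2)[OF b_tendsto])
  then show "\<exists>N. \<forall>k\<ge>N. dist (V k) W < e"
    unfolding eventually_sequentially using W_dist by (metis dist_commute le_less_trans)
qed

text \<open>One step of size at most kappa m (k+1), and all later steps together at most b (k+1) <=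
  kappa m (k+1).\<close>

lemma W_dist': "dist W (V k) \<le> 2 * \<kappa> * m (Suc k)"
  using dist_triangle[of W "V k" "V (Suc k)"] W_dist[of "Suc k"] V_dist[of k] b_m[of k] by simp

section \<open>The spectrum of the limit potential\<close>

abbreviation \<Sigma> where "\<Sigma> \<equiv> schroedinger_spectrum W"

lemma W_limit_periodic: "W \<in> limit_periodic"
  unfolding limit_periodic_def closure_sequential
  using V_tendsto per periodic_seq_iff by (intro exI[of _ V]) auto

text \<open>A lower bound c for the limit at E passes to \<open>V k\<close> once b k < c, and band
  energies admit none.\<close>

lemma eventually_not_band:
  assumes "E \<notin> \<Sigma>" shows "eventually (\<lambda>k. E \<notin> U k) sequentially"
proof -
  obtain c where c: "c > 0" "bounded_below W E c" using assms schroedinger_spectrum_iff by blast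
  have "eventually (\<lambda>k. b k < c) sequentially" by (rule order_tendstoD(2)[OF b_tendsto c(1)])
  then show ?thesis
  proof eventually_elim
    case (elim k)
    have "bounded_below (V k) E (c - dist W (V k) - \<bar>E - E\<bar>)" by (rule bounded_below_perturb[OF c(2)])
    moreover have "c - dist W (V k) - \<bar>E - E\<bar> > 0" using elim W_dist[of k] by simp
    ultimately show ?case using band_not_bounded_below[OF per] by blast
  qed
qed

lemma kernel_exists: "\<exists>h. spectral_kernel W \<Sigma> h"
proof (rule spectral_kernel_limit[OF spectral_kernel_periodic[OF per] V_tendsto])
  show "\<And>E. E \<notin> \<Sigma> \<Longrightarrow> \<forall>\<^sub>F k in sequentially. E \<notin> U k" by (rule eventually_not_band)
  fix i j :: int
  show "summable (\<lambda>k. \<integral>E. \<bar>band_kernel (V (Suc k)) (p (Suc k)) i j E - band_kernel (V k) (p k) i j E\<bar> \<partial>lborel)"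
  proof (rule summable_comparison_test')
    show "summable (\<lambda>k. b 0 * (1 / 2) ^ k)" by (intro summable_mult summable_geometric) simp
    fix k assume "k \<ge> nat (max \<bar>i\<bar> \<bar>j\<bar>)"
    then have "i \<in> {- int k..int k}" "j \<in> {- int k..int k}" by auto
    from L1[OF this] b_geo[of 0 k] b_pos[of k]
    show "norm (\<integral>E. \<bar>band_kernel (V (Suc k)) (p (Suc k)) i j E - band_kernel (V k) (p k) i j E\<bar> \<partial>lborel) \<le> b 0 * (1 / 2) ^ k"
      by (simp add: power_divide)
  qed
qed

lemma W_purely_ac: "purely_ac_spectrum W"
  using kernel_exists spectral_kernel_purely_ac by blast

lemma spectrum_nonempty: "\<Sigma> \<noteq> {}"
proof
  assume "\<Sigma> = {}"
  obtain h where h: "spectral_kernel W \<Sigma> h" using kernel_exists by blast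
  then have "AE E in lborel. h 0 0 E = 0" unfolding spectral_kernel_def \<open>\<Sigma> = {}\<close> by auto
  then have "integral\<^sup>L lborel (h 0 0) = 0" by (rule integral_eq_zero_AE)
  then show False using h unfolding spectral_kernel_def by auto
qed

text \<open>Otherwise \<open>V k\<close> has the lower bound 4 kappa m (k+1) at x, of which at most
  half is lost in passing to W.\<close>

lemma band_near_spectrum:
  assumes "x \<in> \<Sigma>" shows "\<exists>y\<in>U k. \<bar>y - x\<bar> < 4 * \<kappa> * m (Suc k)"
proof (rule ccontr)
  assume "\<not> ?thesis"
  then have far: "4 * \<kappa> * m (Suc k) \<le> \<bar>y - x\<bar>" if "y \<in> U k" for y using that by force
  have pos: "\<kappa> * m (Suc k) > 0" using \<kappa> m_pos by simp
  have "bounded_below (V k) x (4 * \<kappa> * m (Suc k))"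
    using spectral_kernel_bounded_below[OF spectral_kernel_periodic[OF per] band_set_bounded[OF per] _ far] pos by simp
  then have "bounded_below W x (4 * \<kappa> * m (Suc k) - dist (V k) W - \<bar>x - x\<bar>)" by (rule bounded_below_perturb)
  moreover have "4 * \<kappa> * m (Suc k) - dist (V k) W - \<bar>x - x\<bar> > 0" using W_dist'[of k] pos by (simp add: dist_commute)
  ultimately show False using assms schroedinger_spectrum_iff by blast
qed

lemma open_U: "open (U k)"
  using real_periodic_potential.open_bands[OF per] .

lemma U_sets [measurable]: "U k \<in> sets borel"
  using open_U by simp

lemma spectrum_sets [measurable]: "\<Sigma> \<in> sets borel"
  by (intro borel_closed compact_imp_closed compact_schroedinger_spectrum)

lemma finite_U: "emeasure lborel (U k) < \<infinity>"
  using real_periodic_potential.bounded_bands[OF per] by (intro emeasure_bounded_finite)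

text \<open>A point of \<open>U k\<close> outside the spectrum leaves the bands at some first later
  step, so it lies in the loss of one single step; these losses are summable.\<close>

lemma band_loss: "emeasure lborel (U k - \<Sigma>) \<le> ennreal (2 * \<kappa> * m (Suc k))"
proof -
  define A where "A j = U (k + j) - U (Suc (k + j))" for j
  have A: "A j \<in> sets borel" for j unfolding A_def by (intro sets.Diff U_sets)
  then have UA: "(\<Union>j. A j) \<in> sets lborel" by auto
  \<comment> \<open>c 0 = kappa m (k+1) bounds the loss at step k, and c j = b (k+1) / 2^j the loss
    j steps later. The correction at j = 0 turns the remainder into a full geometric series.\<close>
  define c where "c j = (if j = 0 then \<kappa> * m (Suc k) - b (Suc k) else 0) + b (Suc k) * (1 / 2) ^ j" for j :: nat
  have "U k - \<Sigma> \<subseteq> (\<Union>j. A j)"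
  proof
    fix E assume E: "E \<in> U k - \<Sigma>"
    then obtain N where N: "\<And>n. n \<ge> N \<Longrightarrow> E \<notin> U n" using eventually_not_band[of E] by (auto simp: eventually_sequentially)
    define n where "n = (LEAST j. E \<notin> U (k + j))"
    have n: "E \<notin> U (k + n)" unfolding n_def by (rule LeastI[of _ N]) (simp add: N)
    then have "n \<noteq> 0" using E by (intro notI) simp
    then obtain j where j: "n = Suc j" using not0_implies_Suc by blast
    then have "E \<in> U (k + j)" using not_less_Least[of j "\<lambda>j. E \<notin> U (k + j)"] unfolding n_def by auto
    then show "E \<in> (\<Union>j. A j)" using n j unfolding A_def by auto
  qed
  then have "emeasure lborel (U k - \<Sigma>) \<le> emeasure lborel (\<Union>j. A j)"
    by (rule emeasure_mono[OF _ UA])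
  also have "\<dots> \<le> (\<Sum>j. emeasure lborel (A j))" using A by (intro emeasure_subadditive_countably) auto
  also have "\<dots> \<le> (\<Sum>j. ennreal (c j))"
  proof (intro suminf_le)
    fix j
    have "emeasure lborel (A j) \<le> emeasure lborel (U (k + j))" by (intro emeasure_mono) (auto simp: A_def)
    then have "emeasure lborel (A j) < \<infinity>" using finite_U[of "k + j"] le_less_trans by blast
    then have "emeasure lborel (A j) = ennreal (measure lborel (A j))" by (intro emeasure_eq_ennreal_measure) auto
    also have "\<dots> \<le> ennreal (c j)"
    proof (rule ennreal_leI)
      show "measure lborel (A j) \<le> c j"
      proof (cases j)
        case 0
        then show ?thesis using loss[of k] by (simp add: A_def c_def)
      next
        case (Suc i)
        have "measure lborel (A j) \<le> b (Suc k + i) / 2" using loss[of "k + j"] Suc by (simp add: A_def)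
        also have "\<dots> \<le> b (Suc k) / 2 ^ i / 2" using b_geo[of "Suc k" i] by simp
        finally show ?thesis using Suc by (simp add: c_def power_divide)
      qed
    qed
    finally show "emeasure lborel (A j) \<le> ennreal (c j)" .
  qed auto
  also have "\<dots> = ennreal (\<kappa> * m (Suc k) + b (Suc k))"
  proof -
    have "c sums ((\<kappa> * m (Suc k) - b (Suc k)) + b (Suc k) * (1 / (1 - 1 / 2)))"
      unfolding c_def by (intro sums_add sums_mult geometric_sums sums_single) auto
    then have "c sums (\<kappa> * m (Suc k) + b (Suc k))" by (simp add: add.commute)
    moreover have "0 \<le> c j" for j using b_m[of k] b_pos[of "Suc k"] by (auto simp: c_def)
    ultimately show ?thesis by (intro suminf_ennreal_eq)
  qed
  also have "\<dots> \<le> ennreal (2 * \<kappa> * m (Suc k))" using b_m[of k] by (intro ennreal_leI) simp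
  finally show ?thesis .
qed

lemma homogeneous_estimate:
  assumes x: "x \<in> \<Sigma>" and \<delta>: "0 < \<delta>" "\<delta> \<le> m 0"
  shows "(1 - 6 * \<kappa>) * \<delta> \<le> measure lborel ({x - \<delta><..<x + \<delta>} \<inter> \<Sigma>)"
proof -
  \<comment> \<open>n = k + 1 is the first index with m n < delta: bands of stage k have length at
    least delta, while all errors are fractions of m n.\<close>
  define n where "n = (LEAST k. m k < \<delta>)"
  have "\<exists>k. m k < \<delta>" using order_tendstoD(2)[OF m_tendsto \<delta>(1)] eventually_happens by force
  then have n: "m n < \<delta>" unfolding n_def by (rule LeastI_ex)
  then have "n \<noteq> 0" using \<delta> by (intro notI) simp
  then obtain k where k: "n = Suc k" using not0_implies_Suc by blast
  then have mk: "\<delta> \<le> m k" using not_less_Least[of k "\<lambda>k. m k < \<delta>"] unfolding n_def by auto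
  obtain y where y: "y \<in> U k" "\<bar>y - x\<bar> < 4 * \<kappa> * m n" using band_near_spectrum[OF x, of k] k by auto
  obtain u v where uv: "u < y" "y < v" "{u<..<v} \<subseteq> U k" "m k \<le> v - u"
    using len[of k] y(1) unfolding band_length_ge_def by blast
  define r where "r = \<delta> - \<bar>y - x\<bar>"
  have "4 * \<kappa> * m n < 1 * \<delta>" using \<kappa> n m_pos[of n] by (intro mult_strict_mono) auto
  then have r: "r > 0" "r \<le> \<delta>" using y(2) by (auto simp: r_def)
  \<comment> \<open>Where the band ends near y on one side, it reaches far enough on the other, so
    clipping it to distance r from y leaves length at least r.\<close>
  define l h where "l = max u (y - r)" and "h = min v (y + r)"
  have lh: "r \<le> h - l" "l < h" "{l<..<h} \<subseteq> U k" "{l<..<h} \<subseteq> {x - \<delta><..<x + \<delta>}"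
    using uv mk r by (auto simp: l_def h_def r_def)
  have "ennreal (h - l) = emeasure lborel {l<..<h}" using lh by simp
  also have "\<dots> \<le> emeasure lborel (({x - \<delta><..<x + \<delta>} \<inter> \<Sigma>) \<union> (U k - \<Sigma>))"
    using lh by (intro emeasure_mono) auto
  also have "\<dots> \<le> emeasure lborel ({x - \<delta><..<x + \<delta>} \<inter> \<Sigma>) + emeasure lborel (U k - \<Sigma>)"
    by (intro emeasure_subadditive) auto
  also have "\<dots> \<le> emeasure lborel ({x - \<delta><..<x + \<delta>} \<inter> \<Sigma>) + ennreal (2 * \<kappa> * m n)"
    using band_loss[of k] k by (intro add_left_mono) simp
  also have "emeasure lborel ({x - \<delta><..<x + \<delta>} \<inter> \<Sigma>) = ennreal (measure lborel ({x - \<delta><..<x + \<delta>} \<inter> \<Sigma>))"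
  proof (intro emeasure_eq_ennreal_measure)
    have "emeasure lborel ({x - \<delta><..<x + \<delta>} \<inter> \<Sigma>) \<le> emeasure lborel {x - \<delta><..<x + \<delta>}" by (intro emeasure_mono) auto
    then show "emeasure lborel ({x - \<delta><..<x + \<delta>} \<inter> \<Sigma>) \<noteq> top" using \<delta> by (auto simp: top_unique)
  qed
  finally have "ennreal (h - l) \<le> ennreal (measure lborel ({x - \<delta><..<x + \<delta>} \<inter> \<Sigma>) + 2 * \<kappa> * m n)"
    using \<kappa> m_pos[of n] by (subst ennreal_plus) auto
  then have "h - l \<le> measure lborel ({x - \<delta><..<x + \<delta>} \<inter> \<Sigma>) + 2 * \<kappa> * m n"
    using \<kappa> m_pos[of n] by (subst (asm) ennreal_le_iff) (auto intro!: add_nonneg_nonneg)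
  moreover have "6 * (\<kappa> * m n) \<le> 6 * (\<kappa> * \<delta>)" using n \<kappa> by (intro mult_left_mono) auto
  ultimately show ?thesis using lh(1) y(2) unfolding r_def by (simp add: algebra_simps)
qed

text \<open>The point E opened at stage k + 1 keeps distance 2 b (k+1) from the bands, twice the
  size of all later perturbations, and so remains in the resolvent set.\<close>

lemma gap_in_interval:
  assumes "a < c" shows "\<exists>E. a < E \<and> E < c \<and> E \<notin> \<Sigma>"
proof -
  obtain k where k: "a < fst (rat_interval k)" "snd (rat_interval k) < c" using rat_interval_dense[OF assms] by blast
  obtain E where E: "fst (rat_interval k) < E" "E < snd (rat_interval k)"
    "\<And>y. y \<in> U (Suc k) \<Longrightarrow> 2 * b (Suc k) \<le> \<bar>y - E\<bar>" using gap[of k] by blast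
  have "bounded_below (V (Suc k)) E (2 * b (Suc k))"
    using spectral_kernel_bounded_below[OF spectral_kernel_periodic[OF per] band_set_bounded[OF per] _ E(3)] b_pos[of "Suc k"] by simp
  then have "bounded_below W E (2 * b (Suc k) - dist (V (Suc k)) W - \<bar>E - E\<bar>)" by (rule bounded_below_perturb)
  moreover have "2 * b (Suc k) - dist (V (Suc k)) W - \<bar>E - E\<bar> > 0"
    using W_dist[of "Suc k"] b_pos[of "Suc k"] by (simp add: dist_commute)
  ultimately have "E \<notin> \<Sigma>" using schroedinger_spectrum_iff by blast
  then show ?thesis using E k by (intro exI[of _ E]) auto
qed

lemma homogeneous_spectrum:
  assumes "\<tau> \<le> 1 - 6 * \<kappa>" shows "homogeneous_set \<tau> \<Sigma>"
  unfolding homogeneous_set_def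
proof (intro conjI exI[of _ "m 0"] ballI allI impI)
  fix x \<delta> :: real assume "x \<in> \<Sigma>" and \<delta>: "0 < \<delta> \<and> \<delta> \<le> m 0"
  then have "(1 - 6 * \<kappa>) * \<delta> \<le> measure lborel ({x - \<delta><..<x + \<delta>} \<inter> \<Sigma>)" using homogeneous_estimate by blast
  moreover have "\<tau> * \<delta> \<le> (1 - 6 * \<kappa>) * \<delta>" using assms \<delta> by (intro mult_right_mono) auto
  ultimately show "\<tau> * \<delta> \<le> measure lborel ({x - \<delta><..<x + \<delta>} \<inter> \<Sigma>)" by linarith
qed (use compact_schroedinger_spectrum m_pos in auto)

text \<open>Homogeneity excludes isolated points, and density of the gaps excludes
  intervals.\<close>

lemma cantor_spectrum: "cantor_set \<Sigma>"
  unfolding cantor_set_def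
proof (intro conjI ballI allI impI notI)
  fix x assume x: "x \<in> \<Sigma>" "x isolated_in \<Sigma>"
  then obtain T where T: "open T" "T \<inter> \<Sigma> = {x}" unfolding isolated_in_def by blast
  then have "x \<in> T" by blast
  then obtain e where e: "e > 0" "ball x e \<subseteq> T" using T(1) open_contains_ball by blast
  define \<delta> where "\<delta> = min e (m 0)"
  have \<delta>: "0 < \<delta>" "\<delta> \<le> m 0" "\<delta> \<le> e" using e m_pos[of 0] by (auto simp: \<delta>_def)
  have "{x - \<delta><..<x + \<delta>} \<inter> \<Sigma> \<subseteq> {x}" using T(2) e(2) \<delta> by (auto simp: subset_iff dist_real_def)
  then have "{x - \<delta><..<x + \<delta>} \<inter> \<Sigma> = {} \<or> {x - \<delta><..<x + \<delta>} \<inter> \<Sigma> = {x}" by blast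
  then have "measure lborel ({x - \<delta><..<x + \<delta>} \<inter> \<Sigma>) = 0" by (auto simp: measure_def)
  moreover have "(1 - 6 * \<kappa>) * \<delta> > 0" using \<kappa> \<delta> by simp
  ultimately show False using homogeneous_estimate[OF x(1) \<delta>(1,2)] by simp
next
  fix C assume C: "C \<subseteq> \<Sigma>" "connected C"
  show "\<exists>a. C \<subseteq> {a}"
  proof (rule ccontr)
    assume "\<nexists>a. C \<subseteq> {a}"
    then obtain a c where ac: "a \<in> C" "c \<in> C" "a \<noteq> c" by blast
    then have "min a c < max a c" by auto
    then obtain E where E: "min a c < E" "E < max a c" "E \<notin> \<Sigma>" using gap_in_interval by blast
    have "{min a c..max a c} \<subseteq> C" using C(2) ac by (intro connected_contains_Icc) (auto simp: min_def max_def)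
    moreover have "E \<in> {min a c..max a c}" using E by simp
    ultimately show False using E(3) C(1) by blast
  qed
qed (use spectrum_nonempty compact_schroedinger_spectrum in auto)

end

section \<open>Construction of the sequence and density\<close>

lemma gap_sequence_exists:
  assumes pp: "periodic_pair V0 p0" and \<epsilon>: "\<epsilon> > 0" and \<kappa>: "\<kappa> > 0" "\<kappa> < 1 / 6"
  shows "\<exists>V p m b. gap_sequence V p m b \<kappa> \<and> V 0 = V0 \<and> b 0 = \<epsilon>"
proof -
  \<comment> \<open>The clause for k = 0 fixes the starting potential and the total distance
    allowed.\<close>
  define P where "P k s = (case s of (V, p, m, b) \<Rightarrow> periodic_pair V p \<and> band_length_ge V p m \<and> m > 0 \<and> b > 0 \<and>
      (k = 0 \<longrightarrow> V = V0 \<and> b = \<epsilon>))" for k :: nat and s :: "(int \<Rightarrow>\<^sub>C real) \<times> nat \<times> real \<times> real"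
  define Q where "Q k s s' = (case s of (V, p, m, b) \<Rightarrow> case s' of (V', p', m', b') \<Rightarrow>
      m' \<le> m / 2 \<and> b' \<le> b / 2 \<and> b' \<le> \<kappa> * m' \<and> close_pair V p V' p' (int k) (min (b / 2) (\<kappa> * m')) \<and>
      (\<exists>E. fst (rat_interval k) < E \<and> E < snd (rat_interval k) \<and> (\<forall>y\<in>band_set V' p'. 2 * b' \<le> \<bar>y - E\<bar>)))"
    for k :: nat and s s' :: "(int \<Rightarrow>\<^sub>C real) \<times> nat \<times> real \<times> real"
  have "\<exists>f. \<forall>n. P n (f n) \<and> Q n (f n) (f (Suc n))"
  proof (rule dependent_nat_choice)
    obtain m0 where "m0 > 0" "\<forall>t\<in>{0..1}. band_length_ge (V0 + t *\<^sub>R bump p0) p0 m0"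
      using bump_family_band_length[OF pp] by blast
    then have "band_length_ge V0 p0 m0" by (metis add.right_neutral atLeastAtMost_iff order_refl scaleR_zero_left zero_le_one)
    then have "P 0 (V0, p0, m0, \<epsilon>)" using pp \<open>m0 > 0\<close> \<epsilon> by (simp add: P_def)
    then show "\<exists>s. P 0 s" ..
  next
    fix s k assume "P k s"
    then obtain V p m b where s: "s = (V, p, m, b)" "periodic_pair V p" "band_length_ge V p m" "m > 0" "b > 0"
      unfolding P_def by (cases s) auto
    \<comment> \<open>The old bound is halved first, so that the length returned by
      \<open>gap_step\<close> satisfies m' <= m / 2.\<close>
    have len2: "band_length_ge V p (m / 2)"
      unfolding band_length_ge_def
    proof
      fix x assume "x \<in> band_set V p"
      then obtain u v where uv: "u < x" "x < v" "{u<..<v} \<subseteq> band_set V p" "m \<le> v - u"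
        using s(3) unfolding band_length_ge_def by blast
      have "m / 2 \<le> v - u" using uv(4) s(4) by linarith
      then show "\<exists>u v. u < x \<and> x < v \<and> {u<..<v} \<subseteq> band_set V p \<and> m / 2 \<le> v - u"
        using uv(1-3) by blast
    qed
    from gap_step[OF s(2) rat_interval_less[of k] len2, where K="int k"] s(4)
    obtain m' where m': "m' > 0" "m' \<le> m / 2" and step: "\<And>e. e > 0 \<Longrightarrow> \<exists>V' p'. periodic_pair V' p' \<and> band_length_ge V' p' m' \<and>
      close_pair V p V' p' (int k) e \<and>
      (\<exists>E \<gamma>. fst (rat_interval k) < E \<and> E < snd (rat_interval k) \<and> \<gamma> > 0 \<and> (\<forall>y\<in>band_set V' p'. \<gamma> \<le> \<bar>y - E\<bar>))"
      by auto
    define e where "e = min (b / 2) (\<kappa> * m')"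
    have "e > 0" using s(5) \<kappa> m' by (simp add: e_def)
    from step[OF this] obtain V' p' E \<gamma> where V': "periodic_pair V' p'" "band_length_ge V' p' m'"
      "close_pair V p V' p' (int k) e" "fst (rat_interval k) < E" "E < snd (rat_interval k)" "\<gamma> > 0"
      "\<forall>y\<in>band_set V' p'. \<gamma> \<le> \<bar>y - E\<bar>"
      by blast
    \<comment> \<open>Half of the gap distance just obtained limits all later perturbations; this
      keeps the gap open in the limit.\<close>
    define b' where "b' = min e (\<gamma> / 2)"
    have b': "b' > 0" "b' \<le> b / 2" "b' \<le> \<kappa> * m'" "2 * b' \<le> \<gamma>" using \<open>e > 0\<close> V'(6) by (auto simp: b'_def e_def)
    have "P (Suc k) (V', p', m', b')" using V' m' b' by (simp add: P_def)
    moreover have "Q k s (V', p', m', b')"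
      unfolding Q_def s(1) prod.case
    proof (intro conjI)
      show "\<exists>E. fst (rat_interval k) < E \<and> E < snd (rat_interval k) \<and> (\<forall>y\<in>band_set V' p'. 2 * b' \<le> \<bar>y - E\<bar>)"
        using V'(4,5,7) b'(4) by (intro exI[of _ E]) (auto intro: order_trans)
    qed (use m' b' V'(3) in \<open>simp_all add: e_def\<close>)
    ultimately show "\<exists>s'. P (Suc k) s' \<and> Q k s s'" by blast
  qed
  then obtain f where f: "\<And>n. P n (f n)" "\<And>n. Q n (f n) (f (Suc n))" by blast
  define V p m b where "V n = fst (f n)" and "p n = fst (snd (f n))" and "m n = fst (snd (snd (f n)))"
    and "b n = snd (snd (snd (f n)))" for n
  have fn: "f n = (V n, p n, m n, b n)" for n by (simp add: V_def p_def m_def b_def)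
  have f1: "periodic_pair (V n) (p n)" "band_length_ge (V n) (p n) (m n)" "m n > 0" "b n > 0" for n
    using f(1)[of n] unfolding fn P_def prod.case by simp_all
  have f2: "m (Suc n) \<le> m n / 2" "b (Suc n) \<le> b n / 2" "b (Suc n) \<le> \<kappa> * m (Suc n)"
    "close_pair (V n) (p n) (V (Suc n)) (p (Suc n)) (int n) (min (b n / 2) (\<kappa> * m (Suc n)))"
    "\<exists>E. fst (rat_interval n) < E \<and> E < snd (rat_interval n) \<and> (\<forall>y\<in>band_set (V (Suc n)) (p (Suc n)). 2 * b (Suc n) \<le> \<bar>y - E\<bar>)" for n
    using f(2)[of n] unfolding fn Q_def prod.case by simp_all
  have "gap_sequence V p m b \<kappa>"
    by (intro gap_sequence.intro f1 f2 \<kappa>)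
  moreover have "V 0 = V0" "b 0 = \<epsilon>" using f(1)[of 0] unfolding fn P_def by auto
  ultimately show ?thesis by blast
qed

theorem corollary1p3:
  fixes \<tau> :: real
  assumes "0 < \<tau>" and "\<tau> < 1"
  shows "limit_periodic \<subseteq> closure (homogeneous_ac_potentials \<tau>)"
  unfolding limit_periodic_def
\<comment> \<open>The right-hand side is closed, so approximating the periodic potentials
  suffices.\<close>
proof (rule closure_minimal)
  show "{V. periodic_seq (apply_bcontfun V)} \<subseteq> closure (homogeneous_ac_potentials \<tau>)"
  proof
    fix V0 :: "int \<Rightarrow>\<^sub>C real" assume "V0 \<in> {V. periodic_seq (apply_bcontfun V)}"
    then obtain p0 where pp: "periodic_pair V0 p0" using periodic_seq_iff by blast
    show "V0 \<in> closure (homogeneous_ac_potentials \<tau>)"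
      unfolding closure_approachable
    proof (intro allI impI)
      fix e :: real assume e: "e > 0"
      \<comment> \<open>The constant gives 1 - 6 kappa = tau. \<open>b 0\<close> bounds the distance
        from V0 to the limit, so e / 2 yields a strict inequality.\<close>
      obtain V p m b where g: "gap_sequence V p m b ((1 - \<tau>) / 6)" "V 0 = V0" "b 0 = e / 2"
        using gap_sequence_exists[OF pp, of "e / 2" "(1 - \<tau>) / 6"] e assms by auto
      interpret gap_sequence V p m b "(1 - \<tau>) / 6" by (rule g(1))
      have "homogeneous_set \<tau> \<Sigma>" by (rule homogeneous_spectrum) (simp add: field_simps)
      then have "W \<in> homogeneous_ac_potentials \<tau>"
        unfolding homogeneous_ac_potentials_def
        using W_limit_periodic cantor_spectrum W_purely_ac by simp
      moreover have "dist W V0 < e" using W_dist[of 0] g(2,3) e by simp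
      ultimately show "\<exists>W\<in>homogeneous_ac_potentials \<tau>. dist W V0 < e" by blast
    qed
  qed
qed simp

end
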